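(* Assume (A1), (A2), (A3), (A4), (A7) stated in the context. Let $\mathbf T_n$ be any regular asymptotically linear (RAL) estimator of $x^\star$ computed from a sample $\xi_0,\xi_1,\dots,\xi_n$ of the chain with kernel $P$. Then \[ \lim_{n\to\infty}n\cdot\mathbb E(\mathbf T_n-x^\star)(\mathbf T_n-x^\star)^\top\succeq G^{-1}SG^{-\top}, \] where $\succeq$ is the Loewner order and $S:=\mathbb E_{\xi\sim\pi}[U(x^\star,\xi)U(x^\star,\xi)^\top-\mathcal PU(x^\star,\xi)\mathcal PU(x^\star,\xi)^\top]$.
   Context: Setting. $\Xi$ is a Polish space; $P$ is a Markov transition kernel on $\Xi$ with stationary distribution $\pi$. For $F(x,\xi)$, $\mathcal PF(x,\xi):=\int F(x,\xi')P(\xi,d\xi')$, $\mathcal P^t$ its iterate. $\|\cdot\|$ is a norm on $\mathbb R^d$. $H:\mathbb R^d\times\Xi\to\mathbb R^d$ measurable, $g(x):=\int H(x,\xi)\pi(d\xi)$, $g(x^\star)=0$. $U(x,\xi):=\sum_{t\ge0}(\mathcal P^tH(x,\xi)-g(x))$. Perturbations: let $\mathcal B$ be the class of bounded measurable $h:\Xi\times\Xi\to\mathbb R$ with $\int h(\xi,\xi')P(\xi,d\xi')=0$ for all $\xi$. For $h\in\mathcal B$ and $n$ large, define the kernel $P_{nh}(\xi,d\xi')=P(\xi,d\xi')(1+n^{-1/2}h(\xi,\xi'))$, let $\pi_{nh}$ be its stationary distribution and $x^\star_{nh}$ the root of $\int H(x,\xi)\pi_{nh}(d\xi)=0$. An estimator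 $\mathbf T_n$ (measurable function of the data) is regular for $x^\star$ with limit $\mathbf L$ if for all $h\in\mathcal B$, $\sqrt n(\mathbf T_n-x^\star_{nh})\to\mathbf L$ in distribution when the data are generated by $P_{nh}$. It is RAL if it is regular and asymptotically linear: there is a measurable $\varphi$ with $\sqrt n(\mathbf T_n-x^\star)=n^{-1/2}\sum_{i=1}^n\varphi(\xi_{i-1},\xi_i)+o_{P}(1)$, where under $\xi\sim\pi,\xi'\sim P(\xi,\cdot)$, $\mathbb E\varphi(\xi,\xi')=0$ and $\mathbb E\varphi\varphi^\top$ is nonsingular. (A1) $\exists L_G,\delta_G>0$ and $G$ with all eigenvalues of strictly positive real part such that $\|g(x)-G(x-x^\star)\|\le L_G\|x-x^\star\|^2$ when $\|x-x^\star\|\le\delta_G$. (A2) $\exists p>2,\sigma>0$: $\sup_t(\mathbb E\|H(x^\star,\xi_t)\|^p)^{1/p}<\infty$ along the chain, and $\sup_\xi\|\mathcal PH(x^\star,\xi)\|\le\sigma$. (A3) $\exists L_H$: $(\int\|H(x,\xi')-H(y,\xi')\|^pP(\xi,d\xi'))^{1/p}\le L_H\|x-y\|$ for all $x,y,\xi$. (A4) $\pi$ is the unique stationary distribution and $d_{TV}(P^t(\xi,\cdot),\pi)\le\kappa\rho^t/2$ for all $\xi,t$, some $\kappa\ge e$, $\rho\in[0,1)$. (A7) $\exists\gamma\in[0,1),c>0$: $\|\mathcal P(H(x,\xi)-H(y,\xi))-c(x-y)\|\le\gamma c\|x-y\|$ for all $x,y,\xi$. *)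

theory Defs
  imports "HOL-Analysis.Analysis" "HOL-Probability.Probability"
begin

definition is_norm :: "(real^'d \<Rightarrow> real) \<Rightarrow> bool" where
  "is_norm nrm \<longleftrightarrow> (\<forall>x. 0 \<le> nrm x) \<and> (\<forall>x. nrm x = 0 \<longleftrightarrow> x = 0)
     \<and> (\<forall>c x. nrm (c *\<^sub>R x) = \<bar>c\<bar> * nrm x) \<and> (\<forall>x y. nrm (x + y) \<le> nrm x + nrm y)"

definition outer :: "real^'d \<Rightarrow> real^'d \<Rightarrow> real^'d^'d" where
  "outer u v = (\<chi> i j. u $ i * v $ j)"

definition loewner_ge :: "real^'d^'d \<Rightarrow> real^'d^'d \<Rightarrow> bool" where
  "loewner_ge A B \<longleftrightarrow> (\<forall>v. 0 \<le> v \<bullet> ((A - B) *v v))"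

definition complex_eigenvalue :: "real^'d^'d \<Rightarrow> complex \<Rightarrow> bool" where
  "complex_eigenvalue G lam \<longleftrightarrow>
     (\<exists>v::complex^'d. v \<noteq> 0 \<and> (\<chi> i j. complex_of_real (G $ i $ j)) *v v = lam *s v)"

fun kpow :: "('x::topological_space \<Rightarrow> 'x measure) \<Rightarrow> nat \<Rightarrow> 'x \<Rightarrow> 'x measure" where
  "kpow K 0 = (\<lambda>\<xi>. return borel \<xi>)"
| "kpow K (Suc t) = (\<lambda>\<xi>. bind (K \<xi>) (kpow K t))"

definition markov_kernel :: "('x::topological_space \<Rightarrow> 'x measure) \<Rightarrow> bool" where
  "markov_kernel K \<longleftrightarrow> K \<in> borel \<rightarrow>\<^sub>M prob_algebra borel"

definition stationary :: "('x::topological_space \<Rightarrow> 'x measure) \<Rightarrow> 'x measure \<Rightarrow> bool" where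
  "stationary K \<pi> \<longleftrightarrow> prob_space \<pi> \<and> sets \<pi> = sets borel \<and>
     (\<forall>A \<in> sets borel. emeasure \<pi> A = (\<integral>\<^sup>+ \<xi>. emeasure (K \<xi>) A \<partial>\<pi>))"

definition tv_dist :: "'x::topological_space measure \<Rightarrow> 'x measure \<Rightarrow> real" where
  "tv_dist M N = (SUP A \<in> sets borel. \<bar>measure M A - measure N A\<bar>)"

definition Pop :: "('x \<Rightarrow> 'x measure) \<Rightarrow> (real^'d \<Rightarrow> 'x \<Rightarrow> real^'d) \<Rightarrow> real^'d \<Rightarrow> 'x \<Rightarrow> real^'d" where
  "Pop K F x \<xi> = (\<integral>\<xi>'. F x \<xi>' \<partial>K \<xi>)"

definition Pop_pow :: "('x::topological_space \<Rightarrow> 'x measure) \<Rightarrow> nat \<Rightarrow> (real^'d \<Rightarrow> 'x \<Rightarrow> real^'d) \<Rightarrow> real^'d \<Rightarrow> 'x \<Rightarrow> real^'d" where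
  "Pop_pow K t F x \<xi> = (\<integral>\<xi>'. F x \<xi>' \<partial>kpow K t \<xi>)"

definition mean_field :: "'x measure \<Rightarrow> (real^'d \<Rightarrow> 'x \<Rightarrow> real^'d) \<Rightarrow> real^'d \<Rightarrow> real^'d" where
  "mean_field \<pi> H x = (\<integral>\<xi>. H x \<xi> \<partial>\<pi>)"

definition poisson_U :: "('x::topological_space \<Rightarrow> 'x measure) \<Rightarrow> 'x measure \<Rightarrow> (real^'d \<Rightarrow> 'x \<Rightarrow> real^'d) \<Rightarrow> real^'d \<Rightarrow> 'x \<Rightarrow> real^'d" where
  "poisson_U K \<pi> H x \<xi> = (\<Sum>t. Pop_pow K t H x \<xi> - mean_field \<pi> H x)"

definition S_matrix :: "('x::topological_space \<Rightarrow> 'x measure) \<Rightarrow> 'x measure \<Rightarrow> (real^'d \<Rightarrow> 'x \<Rightarrow> real^'d) \<Rightarrow> real^'d \<Rightarrow> real^'d^'d" where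
  "S_matrix K \<pi> H xs = (\<integral>\<xi>. outer (poisson_U K \<pi> H xs \<xi>) (poisson_U K \<pi> H xs \<xi>)
      - outer (Pop K (poisson_U K \<pi> H) xs \<xi>) (Pop K (poisson_U K \<pi> H) xs \<xi>) \<partial>\<pi>)"

fun chain_law :: "'x::topological_space measure \<Rightarrow> ('x \<Rightarrow> 'x measure) \<Rightarrow> nat \<Rightarrow> (nat \<Rightarrow> 'x) measure" where
  "chain_law \<mu> K 0 = distr \<mu> (PiM {..0} (\<lambda>_. borel)) (\<lambda>x. \<lambda>i\<in>{..0::nat}. x)"
| "chain_law \<mu> K (Suc n) = bind (chain_law \<mu> K n)
     (\<lambda>\<omega>. distr (K (\<omega> n)) (PiM {..Suc n} (\<lambda>_. borel)) (\<lambda>y. fun_upd \<omega> (Suc n) y))"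

definition marginal :: "'x::topological_space measure \<Rightarrow> ('x \<Rightarrow> 'x measure) \<Rightarrow> nat \<Rightarrow> 'x measure" where
  "marginal \<mu> K t = distr (chain_law \<mu> K t) borel (\<lambda>\<omega>. \<omega> t)"

definition pair_law :: "'x::topological_space measure \<Rightarrow> ('x \<Rightarrow> 'x measure) \<Rightarrow> ('x \<times> 'x) measure" where
  "pair_law \<pi> K = bind \<pi> (\<lambda>a. distr (K a) borel (\<lambda>b. (a, b)))"

definition perturbation_class :: "('x::topological_space \<Rightarrow> 'x measure) \<Rightarrow> ('x \<Rightarrow> 'x \<Rightarrow> real) set" where
  "perturbation_class K = {h. case_prod h \<in> borel_measurable borel \<and> (\<exists>C. \<forall>a b. \<bar>h a b\<bar> \<le> C)
       \<and> (\<forall>\<xi>. (\<integral>\<xi>'. h \<xi> \<xi>' \<partial>K \<xi>) = 0)}"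

definition pert_kernel :: "('x \<Rightarrow> 'x measure) \<Rightarrow> ('x \<Rightarrow> 'x \<Rightarrow> real) \<Rightarrow> nat \<Rightarrow> 'x \<Rightarrow> 'x measure" where
  "pert_kernel K h n \<xi> = density (K \<xi>) (\<lambda>\<xi>'. ennreal (1 + h \<xi> \<xi>' / sqrt (real n)))"

definition pert_stat :: "('x::topological_space \<Rightarrow> 'x measure) \<Rightarrow> ('x \<Rightarrow> 'x \<Rightarrow> real) \<Rightarrow> nat \<Rightarrow> 'x measure" where
  "pert_stat K h n = (THE \<pi>'. stationary (pert_kernel K h n) \<pi>')"

definition pert_root :: "('x::topological_space \<Rightarrow> 'x measure) \<Rightarrow> (real^'d \<Rightarrow> 'x \<Rightarrow> real^'d) \<Rightarrow> ('x \<Rightarrow> 'x \<Rightarrow> real) \<Rightarrow> nat \<Rightarrow> real^'d" where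
  "pert_root K H h n = (THE x. (\<integral>\<xi>. H x \<xi> \<partial>pert_stat K h n) = 0)"

definition conv_distr :: "(nat \<Rightarrow> 'a measure) \<Rightarrow> (nat \<Rightarrow> 'a \<Rightarrow> real^'d) \<Rightarrow> (real^'d) measure \<Rightarrow> bool" where
  "conv_distr M X L \<longleftrightarrow> (\<forall>f :: real^'d \<Rightarrow> real. continuous_on UNIV f \<and> bounded (range f) \<longrightarrow>
      (\<lambda>n. \<integral>\<omega>. f (X n \<omega>) \<partial>M n) \<longlonglongrightarrow> (\<integral>z. f z \<partial>L))"

definition estimator :: "(nat \<Rightarrow> (nat \<Rightarrow> 'x::topological_space) \<Rightarrow> real^'d) \<Rightarrow> bool" where
  "estimator T \<longleftrightarrow> (\<forall>n. T n \<in> borel_measurable (PiM {..n} (\<lambda>_. (borel :: 'x measure))))"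

definition regular :: "'x::topological_space measure \<Rightarrow> ('x \<Rightarrow> 'x measure) \<Rightarrow> (real^'d \<Rightarrow> 'x \<Rightarrow> real^'d)
    \<Rightarrow> (nat \<Rightarrow> (nat \<Rightarrow> 'x) \<Rightarrow> real^'d) \<Rightarrow> (real^'d) measure \<Rightarrow> bool" where
  "regular \<mu> K H T L \<longleftrightarrow> prob_space L \<and> sets L = sets borel \<and>
     (\<forall>h \<in> perturbation_class K.
        conv_distr (\<lambda>n. chain_law \<mu> (pert_kernel K h n) n)
                   (\<lambda>n \<omega>. sqrt (real n) *\<^sub>R (T n \<omega> - pert_root K H h n)) L)"

definition asymp_linear :: "'x::topological_space measure \<Rightarrow> ('x \<Rightarrow> 'x measure) \<Rightarrow> 'x measure
    \<Rightarrow> real^'d \<Rightarrow> (nat \<Rightarrow> (nat \<Rightarrow> 'x) \<Rightarrow> real^'d) \<Rightarrow> bool" where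
  "asymp_linear \<mu> K \<pi> xs T \<longleftrightarrow> (\<exists>\<phi> :: 'x \<Rightarrow> 'x \<Rightarrow> real^'d.
     case_prod \<phi> \<in> borel_measurable borel \<and>
     integrable (pair_law \<pi> K) (case_prod \<phi>) \<and>
     (\<integral>z. case_prod \<phi> z \<partial>pair_law \<pi> K) = 0 \<and>
     integrable (pair_law \<pi> K) (\<lambda>z. outer (case_prod \<phi> z) (case_prod \<phi> z)) \<and>
     invertible (\<integral>z. outer (case_prod \<phi> z) (case_prod \<phi> z) \<partial>pair_law \<pi> K) \<and>
     (\<forall>\<epsilon>>0. (\<lambda>n. measure (chain_law \<mu> K n)
        {\<omega> \<in> space (chain_law \<mu> K n).
           norm (sqrt (real n) *\<^sub>R (T n \<omega> - xs)
                 - (1 / sqrt (real n)) *\<^sub>R (\<Sum>i\<in>{1..n}. \<phi> (\<omega> (i - 1)) (\<omega> i))) > \<epsilon>})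
      \<longlonglongrightarrow> 0))"

definition RAL :: "'x::topological_space measure \<Rightarrow> ('x \<Rightarrow> 'x measure) \<Rightarrow> 'x measure \<Rightarrow> (real^'d \<Rightarrow> 'x \<Rightarrow> real^'d)
    \<Rightarrow> real^'d \<Rightarrow> (nat \<Rightarrow> (nat \<Rightarrow> 'x) \<Rightarrow> real^'d) \<Rightarrow> bool" where
  "RAL \<mu> K \<pi> H xs T \<longleftrightarrow> estimator T \<and> (\<exists>L. regular \<mu> K H T L) \<and> asymp_linear \<mu> K \<pi> xs T"

end

theory Submission
  imports Defs
begin

text \<open>
  Fix a direction \<open>v\<close>, put \<open>u = G\<^sup>-\<^sup>T v\<close> and let \<open>Y = u \<bullet> U\<close>. For a perturbation \<open>h\<close> the Poisson equation gives
  \<open>\<integral> H x\<^sup>\<star> d\<pi>\<^sub>n\<^sub>h = n\<^sup>-\<^sup>1\<^sup>/\<^sup>2 \<integral> P (h U) d\<pi>\<^sub>n\<^sub>h\<close>, whence \<open>\<surd>n v \<bullet> (x\<^sup>\<star>\<^sub>n\<^sub>h - x\<^sup>\<star>) \<longlonglongrightarrow> - E (h Y)\<close>. The likelihood ratio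
  of the perturbed against the unperturbed path law has second moment at most \<open>1 + \<epsilon>\<^sup>2 E h\<^sup>2 + O(\<epsilon>\<^sup>3)\<close> when \<open>h\<close>
  is replaced by \<open>\<epsilon> h\<close>. By regularity both path laws yield the same limit \<open>L\<close>, so the
  Hammersley--Chapman--Robbins (Cauchy--Schwarz) inequality applied to the clipped statistic gives
  \<open>(E (h Y))\<^sup>2 \<le> (v \<bullet> \<Sigma> v) E h\<^sup>2\<close> after \<open>\<epsilon> \<longlonglongrightarrow> 0\<close>. The optimal choice \<open>h = Y(\<xi>') - P Y(\<xi>)\<close> is unbounded and is
  approximated by truncations, for which \<open>P (h H)\<close> stays bounded because \<open>P H\<close> is.
\<close>

section \<open>Integration against Markov kernels\<close>

text \<open>Three obstacles shape the proof. First, \<open>pert_stat\<close> and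
  \<open>pert_root\<close> are definite descriptions, so existence and uniqueness come before any
  estimate: the perturbed kernel keeps an \<open>m\<close>-step contraction, which yields its
  stationary law as a uniform limit of iterates, and the root is the fixed point of x - (1/c) *
  (mean field at x), a contraction with factor (1 + \<gamma>)/2. Second, \<open>H\<close> is
  unbounded, while uniform ergodicity controls only bounded functions. Null sets and moments are
  therefore carried from \<pi> to the perturbed law by running the chain for \<open>m * k\<close>
  steps: the density bound grows like 2^k, but the mixing error decays like 8^-k. For the same
  reason Poisson's equation is solved for the bounded \<open>P H\<close> and not for
  \<open>H\<close>. Third, second moments of the estimator are given only under \<open>P\<close>,
  and none are given for \<open>L\<close>; so the variance in the Cauchy-Schwarz step is the
  unperturbed one, and the shift of \<open>L\<close> is read off from bounded test
  functions.\<close>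

lemma prob_algebra_kernelD:
  assumes "K \<in> M \<rightarrow>\<^sub>M prob_algebra N" "x \<in> space M"
  shows "prob_space (K x)" "sets (K x) = sets N" "space (K x) = space N"
proof -
  have "K x \<in> space (prob_algebra N)" by (rule measurable_space[OF assms])
  then show "prob_space (K x)" "sets (K x) = sets N" by (auto simp: space_prob_algebra)
  then show "space (K x) = space N" by (auto dest: sets_eq_imp_space_eq)
qed

lemma markov_kernelD:
  assumes "markov_kernel K"
  shows "K \<in> borel \<rightarrow>\<^sub>M prob_algebra borel" "prob_space (K x)" "sets (K x) = sets borel" "space (K x) = UNIV"
  using assms prob_algebra_kernelD[of K borel borel x] by (auto simp: markov_kernel_def)

text \<open>Pushing \<open>K x\<close> forward along \<open>Pair x\<close> turns the integrand that
  varies with \<open>x\<close> into one fixed function on the product space.\<close>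

lemma integral_measurable_kernel:
  fixes f :: "'a \<Rightarrow> 'b \<Rightarrow> 'c::{banach, second_countable_topology}"
  assumes K[measurable]: "K \<in> M \<rightarrow>\<^sub>M prob_algebra N"
    and f[measurable]: "(\<lambda>(x, y). f x y) \<in> borel_measurable (M \<Otimes>\<^sub>M N)"
  shows "(\<lambda>x. \<integral>y. f x y \<partial>K x) \<in> borel_measurable M"
proof -
  have "(\<lambda>x. \<integral>z. (case z of (x, y) \<Rightarrow> f x y) \<partial>distr (K x) (M \<Otimes>\<^sub>M N) (\<lambda>y. (x, y))) \<in> borel_measurable M"
  proof (rule measurable_compose[OF _ integral_measurable_subprob_algebra[OF f]])
    show "(\<lambda>x. distr (K x) (M \<Otimes>\<^sub>M N) (Pair x)) \<in> M \<rightarrow>\<^sub>M subprob_algebra (M \<Otimes>\<^sub>M N)"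
      by (intro measurable_prob_algebraD measurable_distr_prob_space2[where M=N]) auto
  qed
  then show ?thesis
  proof (rule measurable_cong[THEN iffD1, rotated])
    fix x assume x: "x \<in> space M"
    have s: "sets (K x) = sets N" using prob_algebra_kernelD[OF K x] by simp
    show "(\<integral>z. (case z of (x, y) \<Rightarrow> f x y) \<partial>distr (K x) (M \<Otimes>\<^sub>M N) (\<lambda>y. (x, y))) = (\<integral>y. f x y \<partial>K x)"
      by (subst integral_distr) (use x in \<open>auto simp: measurable_cong_sets[OF s refl]\<close>)
  qed
qed

lemma nn_integral_measurable_kernel:
  assumes K: "K \<in> M \<rightarrow>\<^sub>M prob_algebra N"
    and f: "(\<lambda>(x, y). f x y) \<in> borel_measurable (M \<Otimes>\<^sub>M N)"
  shows "(\<lambda>x. \<integral>\<^sup>+y. f x y \<partial>K x) \<in> borel_measurable M"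
  by (rule nn_integral_measurable_subprob_algebra2[OF f measurable_prob_algebraD[OF K]])

lemma markov_integral_measurable:
  fixes f :: "'x::topological_space \<Rightarrow> 'c::{banach, second_countable_topology}"
  assumes "markov_kernel K" "f \<in> borel_measurable borel"
  shows "(\<lambda>x. \<integral>y. f y \<partial>K x) \<in> borel_measurable borel"
  by (rule integral_measurable_kernel[OF markov_kernelD(1)[OF assms(1)]]) (use assms(2) in measurable)

lemma markov_nn_integral_measurable:
  assumes "markov_kernel K" "f \<in> borel_measurable borel"
  shows "(\<lambda>x. \<integral>\<^sup>+y. f y \<partial>K x) \<in> borel_measurable borel"
  by (rule nn_integral_measurable_kernel[OF markov_kernelD(1)[OF assms(1)]]) (use assms(2) in measurable)

text \<open>Fubini for \<open>bind\<close> with Banach-valued integrands. Fibres are integrable only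
  almost surely; on the exceptional fibres the Bochner integral has its default value 0, so
  identities inside the induction are AE statements.\<close>

lemma
  fixes f :: "'b \<Rightarrow> 'c::{banach, second_countable_topology}"
  assumes N[measurable]: "N \<in> M \<rightarrow>\<^sub>M prob_algebra B" and M: "prob_space M"
    and f: "integrable (M \<bind> N) f"
  shows AE_integrable_bind_kernel: "AE x in M. integrable (N x) f"
    and integrable_bind_kernel: "integrable M (\<lambda>x. \<integral>y. f y \<partial>N x)"
    and integral_bind_kernel: "(\<integral>z. f z \<partial>(M \<bind> N)) = (\<integral>x. \<integral>y. f y \<partial>N x \<partial>M)"
proof -
  interpret prob_space M by fact
  have Ns: "N \<in> M \<rightarrow>\<^sub>M subprob_algebra B" by (rule measurable_prob_algebraD[OF N])
  have sb: "sets (M \<bind> N) = sets B"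
    by (rule sets_bind) (auto simp: prob_algebra_kernelD[OF N] not_empty)
  note meas = measurable_cong_sets[OF sb refl]
  have AEi: "AE x in M. integrable (N x) g" if g: "integrable (M \<bind> N) g"
    for g :: "'b \<Rightarrow> 'c"
  proof -
    have [measurable]: "g \<in> borel_measurable B" using borel_measurable_integrable[OF g] by (simp add: meas)
    have "(\<integral>\<^sup>+x. \<integral>\<^sup>+y. norm (g y) \<partial>N x \<partial>M) = (\<integral>\<^sup>+z. norm (g z) \<partial>(M \<bind> N))"
      by (rule nn_integral_bind[OF _ Ns, symmetric]) measurable
    also have "\<dots> < \<infinity>" using g by (simp add: integrable_iff_bounded)
    finally have "AE x in M. (\<integral>\<^sup>+y. norm (g y) \<partial>N x) \<noteq> \<infinity>"
      by (intro nn_integral_PInf_AE nn_integral_measurable_kernel[OF N]) auto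
    then show ?thesis
    proof (rule AE_mp, intro AE_I2 impI)
      fix x assume x: "x \<in> space M" and "(\<integral>\<^sup>+y. norm (g y) \<partial>N x) \<noteq> \<infinity>"
      then show "integrable (N x) g"
        by (auto simp: integrable_iff_bounded less_top measurable_cong_sets[OF prob_algebra_kernelD(2)[OF N x] refl])
    qed
  qed
  show "AE x in M. integrable (N x) f" by (rule AEi[OF f])
  \<comment> \<open>This bound has two uses: it makes \<open>int\<close> follow by comparison, and
    it supplies the dominating function in the limit case of the induction.\<close>
  have norm_int: "integrable M (\<lambda>x. \<integral>y. norm (g y) \<partial>N x)" if g: "integrable (M \<bind> N) g"
    for g :: "'b \<Rightarrow> 'c"
  proof -
    have [measurable]: "g \<in> borel_measurable B" using borel_measurable_integrable[OF g] by (simp add: meas)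
    have "(\<integral>\<^sup>+x. norm (\<integral>y. norm (g y) \<partial>N x) \<partial>M) = (\<integral>\<^sup>+x. \<integral>\<^sup>+y. norm (g y) \<partial>N x \<partial>M)"
    proof (rule nn_integral_cong_AE, use AEi[OF g] in eventually_elim)
      fix x assume "integrable (N x) g"
      then have "integrable (N x) (\<lambda>y. norm (g y))" by simp
      from nn_integral_eq_integral[OF this] show "ennreal (norm (\<integral>y. norm (g y) \<partial>N x)) = (\<integral>\<^sup>+y. norm (g y) \<partial>N x)"
        by simp
    qed
    also have "\<dots> = (\<integral>\<^sup>+z. norm (g z) \<partial>(M \<bind> N))"
      by (rule nn_integral_bind[OF _ Ns, symmetric]) measurable
    also have "\<dots> < \<infinity>" using g by (simp add: integrable_iff_bounded)
    finally show ?thesis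
      by (subst integrable_iff_bounded) (auto intro!: integral_measurable_kernel[OF N])
  qed
  have int: "integrable M (\<lambda>x. \<integral>y. g y \<partial>N x)" if g: "integrable (M \<bind> N) g"
    for g :: "'b \<Rightarrow> 'c"
  proof (rule Bochner_Integration.integrable_bound[OF norm_int[OF g]])
    have [measurable]: "g \<in> borel_measurable B" using borel_measurable_integrable[OF g] by (simp add: meas)
    show "(\<lambda>x. \<integral>y. g y \<partial>N x) \<in> borel_measurable M"
      by (auto intro!: integral_measurable_kernel[OF N])
    show "AE x in M. norm (\<integral>y. g y \<partial>N x) \<le> norm (\<integral>y. norm (g y) \<partial>N x)"
      by (intro AE_I2 order_trans[OF integral_norm_bound]) simp
  qed
  show "integrable M (\<lambda>x. \<integral>y. f y \<partial>N x)" by (rule int[OF f])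
  show "(\<integral>z. f z \<partial>(M \<bind> N)) = (\<integral>x. \<integral>y. f y \<partial>N x \<partial>M)"
    using f
  proof (induction rule: integrable_induct)
    case (base A c)
    then have A[measurable]: "A \<in> sets B" by (simp add: sb)
    have "(\<integral>x. \<integral>y. indicator A y *\<^sub>R c \<partial>N x \<partial>M) = (\<integral>x. measure (N x) A *\<^sub>R c \<partial>M)"
    proof (intro Bochner_Integration.integral_cong refl)
      fix x assume "x \<in> space M"
      note k = prob_algebra_kernelD[OF N this]
      interpret Nx: prob_space "N x" by (rule k)
      have "A \<in> sets (N x)" using k A by simp
      then have "(\<integral>y. indicator A y *\<^sub>R c \<partial>N x) = (\<integral>y. indicator A y \<partial>N x) *\<^sub>R c"
        by (intro integral_scaleR_left) (simp add: Nx.emeasure_finite less_top[symmetric])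
      also have "(\<integral>y. indicator A y \<partial>N x) = measure (N x) A"
        using \<open>A \<in> sets (N x)\<close> sets.sets_into_space[OF \<open>A \<in> sets (N x)\<close>] by (simp add: Int_absorb1 Int_absorb2)
      finally show "(\<integral>y. indicator A y *\<^sub>R c \<partial>N x) = measure (N x) A *\<^sub>R c" .
    qed
    also have "\<dots> = (\<integral>x. measure (N x) A \<partial>M) *\<^sub>R c"
    proof (rule integral_scaleR_left)
      show "integrable M (\<lambda>x. measure (N x) A)"
        by (rule integrable_const_bound[where B=1])
         (auto simp: prob_algebra_kernelD[OF N] prob_space.prob_le_1 intro!: measure_measurable_prob_algebra2[OF _ N])
    qed
    also have "(\<integral>x. measure (N x) A \<partial>M) = measure (M \<bind> N) A"
      using subprob_space.measure_bind[OF prob_space_imp_subprob_space Ns A] M by simp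
    finally show ?case using base by simp
  next
    case (add f g)
    have "(\<integral>x. \<integral>y. f y + g y \<partial>N x \<partial>M) = (\<integral>x. (\<integral>y. f y \<partial>N x) + (\<integral>y. g y \<partial>N x) \<partial>M)"
    proof (rule integral_cong_AE)
      have [measurable]: "f \<in> borel_measurable B" "g \<in> borel_measurable B"
        using add.hyps(1,2) borel_measurable_integrable by (auto simp: meas[symmetric])
      show "(\<lambda>x. \<integral>y. f y + g y \<partial>N x) \<in> borel_measurable M"
        "(\<lambda>x. (\<integral>y. f y \<partial>N x) + (\<integral>y. g y \<partial>N x)) \<in> borel_measurable M"
        by (intro borel_measurable_add integral_measurable_kernel[OF N]; measurable)+
      show "AE x in M. (\<integral>y. f y + g y \<partial>N x) = (\<integral>y. f y \<partial>N x) + (\<integral>y. g y \<partial>N x)"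
        using AEi[OF add.hyps(1)] AEi[OF add.hyps(2)] by eventually_elim simp
    qed
    also have "\<dots> = (\<integral>x. (\<integral>y. f y \<partial>N x) \<partial>M) + (\<integral>x. (\<integral>y. g y \<partial>N x) \<partial>M)"
      by (intro Bochner_Integration.integral_add int add)
    finally show ?case using add by simp
  next
    case (lim f s)
    have fm[measurable]: "f \<in> borel_measurable B" using lim borel_measurable_integrable by (auto simp: meas[symmetric])
    have sm[measurable]: "s i \<in> borel_measurable B" for i using lim borel_measurable_integrable by (auto simp: meas[symmetric])
    have sp: "space (M \<bind> N) = space B" using sb by (rule sets_eq_imp_space_eq)
    have l1: "(\<lambda>i. \<integral>z. s i z \<partial>(M \<bind> N)) \<longlonglongrightarrow> (\<integral>z. f z \<partial>(M \<bind> N))"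
      by (rule integral_dominated_convergence[where w="\<lambda>z. 2 * norm (f z)"]) (use lim in \<open>auto simp: meas\<close>)
    have l2: "(\<lambda>i. \<integral>x. \<integral>y. s i y \<partial>N x \<partial>M) \<longlonglongrightarrow> (\<integral>x. \<integral>y. f y \<partial>N x \<partial>M)"
    proof (rule integral_dominated_convergence[where w="\<lambda>x. 2 * (\<integral>y. norm (f y) \<partial>N x)"])
      show "(\<lambda>x. \<integral>y. f y \<partial>N x) \<in> borel_measurable M" "(\<lambda>x. \<integral>y. s i y \<partial>N x) \<in> borel_measurable M" for i
        by (intro integral_measurable_kernel[OF N]; measurable)+
      show "integrable M (\<lambda>x. 2 * (\<integral>y. norm (f y) \<partial>N x))"
        using norm_int[of f] lim by simp
      show "AE x in M. (\<lambda>i. \<integral>y. s i y \<partial>N x) \<longlonglongrightarrow> (\<integral>y. f y \<partial>N x)"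
        using AEi[of f, OF lim(4)] AE_space
      proof eventually_elim
        case (elim x)
        note k = prob_algebra_kernelD[OF N elim(2)]
        show ?case
          by (rule integral_dominated_convergence[where w="\<lambda>z. 2 * norm (f z)"])
            (use lim elim k in \<open>auto simp: measurable_cong_sets[OF k(2) refl] sp\<close>)
      qed
      fix i
      have "AE x in M. integrable (N x) (s i)" using lim by (intro AEi) auto
      with AEi[of f, OF lim(4)] AE_space show "AE x in M. norm (\<integral>y. s i y \<partial>N x) \<le> 2 * (\<integral>y. norm (f y) \<partial>N x)"
      proof eventually_elim
        case (elim x)
        note k = prob_algebra_kernelD[OF N elim(2)]
        have "norm (\<integral>y. s i y \<partial>N x) \<le> (\<integral>y. norm (s i y) \<partial>N x)" by (rule integral_norm_bound)
        also have "\<dots> \<le> (\<integral>y. 2 * norm (f y) \<partial>N x)"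
          by (rule integral_mono) (use lim elim k in \<open>auto simp: sp\<close>)
        finally show ?case by simp
      qed
    qed
    show ?case using LIMSEQ_unique[OF l1] l2 lim(5) by simp
  qed
qed

section \<open>Iterates of a Markov kernel\<close>

lemma markov_kernel_kpow:
  assumes "markov_kernel K" shows "markov_kernel (kpow K t)"
proof (induction t)
  case 0
  then show ?case by (simp add: markov_kernel_def)
next
  case (Suc t)
  then show ?case using assms unfolding markov_kernel_def
    by (simp add: measurable_bind_prob_space[where N=borel])
qed

text \<open>Chapman-Kolmogorov. \<open>kpow\<close> splits off the first step; associativity of
  \<open>bind\<close> permits a split anywhere, in particular before the last step as in
  \<open>kpow_Suc_right\<close>.\<close>

lemma kpow_add:
  assumes K: "markov_kernel K"
  shows "kpow K (s + t) x = kpow K s x \<bind> kpow K t"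
proof (induction s arbitrary: x)
  case 0
  have "kpow K t \<in> borel \<rightarrow>\<^sub>M subprob_algebra borel"
    by (intro measurable_prob_algebraD markov_kernelD markov_kernel_kpow K)
  then show ?case by (simp add: bind_return[where N=borel])
next
  case (Suc s)
  have m: "kpow K t \<in> borel \<rightarrow>\<^sub>M subprob_algebra borel" for t
    by (intro measurable_prob_algebraD markov_kernelD markov_kernel_kpow K)
  have "kpow K s \<in> K x \<rightarrow>\<^sub>M subprob_algebra borel"
    using m[of s] by (simp add: measurable_cong_sets[OF markov_kernelD(3)[OF K] refl])
  from bind_assoc[OF this m[of t]] have "kpow K (Suc s) x \<bind> kpow K t = K x \<bind> (\<lambda>x. kpow K s x \<bind> kpow K t)"
    by simp
  also have "(\<lambda>x. kpow K s x \<bind> kpow K t) = kpow K (s + t)" using Suc by auto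
  finally show ?case by simp
qed

lemma kpow_1: "markov_kernel K \<Longrightarrow> kpow K 1 x = K x"
  using bind_return''[of "K x" borel] by (simp add: markov_kernelD)

lemma kpow_Suc_right:
  assumes "markov_kernel K" shows "kpow K (Suc t) x = kpow K t x \<bind> K"
proof -
  have "kpow K 1 = K" using kpow_1[OF assms] by auto
  with kpow_add[OF assms, of t 1 x] show ?thesis by simp
qed

lemma nn_integral_bind_markov:
  assumes K: "markov_kernel K" and M: "sets M = sets borel" and f: "f \<in> borel_measurable borel"
  shows "(\<integral>\<^sup>+z. f z \<partial>(M \<bind> K)) = (\<integral>\<^sup>+x. \<integral>\<^sup>+y. f y \<partial>K x \<partial>M)"
  by (rule nn_integral_bind[OF f])
    (use markov_kernelD(1)[OF K] in \<open>simp add: measurable_prob_algebraD measurable_cong_sets[OF M refl]\<close>)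

lemma integrable_bounded_borel:
  fixes q :: "'x::topological_space \<Rightarrow> 'c::{banach, second_countable_topology}"
  assumes "prob_space M" "sets M = sets borel" "q \<in> borel_measurable borel" "\<And>x. norm (q x) \<le> B"
  shows "integrable M q"
  by (rule finite_measure.integrable_const_bound[where B=B])
    (use assms in \<open>auto simp: prob_space.finite_measure measurable_cong_sets[OF assms(2) refl]\<close>)

lemma prob_space_bind_markov:
  assumes K: "markov_kernel K" and M: "prob_space M" "sets M = sets borel"
  shows "prob_space (M \<bind> K)" "sets (M \<bind> K) = sets borel"
proof -
  have k: "K \<in> borel \<rightarrow>\<^sub>M prob_algebra borel" using K by (simp add: markov_kernel_def)
  have m: "M \<in> space (prob_algebra borel)" using M by (simp add: space_prob_algebra)
  show "prob_space (M \<bind> K)" "sets (M \<bind> K) = sets borel"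
    using prob_space_bind'[OF m k] sets_bind'[OF m k] by auto
qed

lemma
  fixes q :: "'x::topological_space \<Rightarrow> 'c::{banach, second_countable_topology}"
  assumes K: "markov_kernel K" and M: "prob_space M" "sets M = sets borel"
    and q: "integrable (M \<bind> K) q"
  shows AE_integrable_bind_markov: "AE x in M. integrable (K x) q"
    and integrable_bind_markov: "integrable M (\<lambda>x. \<integral>y. q y \<partial>K x)"
    and integral_bind_markov: "(\<integral>z. q z \<partial>(M \<bind> K)) = (\<integral>x. \<integral>y. q y \<partial>K x \<partial>M)"
proof -
  have k: "K \<in> M \<rightarrow>\<^sub>M prob_algebra borel"
    using K by (simp add: markov_kernel_def measurable_cong_sets[OF M(2) refl])
  show "AE x in M. integrable (K x) q" "integrable M (\<lambda>x. \<integral>y. q y \<partial>K x)"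
    "(\<integral>z. q z \<partial>(M \<bind> K)) = (\<integral>x. \<integral>y. q y \<partial>K x \<partial>M)"
    using AE_integrable_bind_kernel[OF k M(1) q] integrable_bind_kernel[OF k M(1) q]
      integral_bind_kernel[OF k M(1) q] by auto
qed

lemma integral_bind_markov_bounded:
  fixes q :: "'x::topological_space \<Rightarrow> 'c::{banach, second_countable_topology}"
  assumes K: "markov_kernel K" and M: "prob_space M" "sets M = sets borel"
    and q: "q \<in> borel_measurable borel" "\<And>x. norm (q x) \<le> B"
  shows "(\<integral>z. q z \<partial>(M \<bind> K)) = (\<integral>x. \<integral>y. q y \<partial>K x \<partial>M)"
  by (intro integral_bind_markov K M integrable_bounded_borel[OF _ _ q] prob_space_bind_markov)

text \<open>A non-integrable function has Bochner integral 0, and \<open>B\<close> is nonnegative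
  because a probability space has a point; so the bound can be used before integrability is
  settled.\<close>

lemma norm_integral_le_prob:
  fixes q :: "'a \<Rightarrow> 'c::{banach, second_countable_topology}"
  assumes "prob_space M" "\<And>x. x \<in> space M \<Longrightarrow> norm (q x) \<le> B"
  shows "norm (\<integral>x. q x \<partial>M) \<le> B"
proof (cases "integrable M q")
  case True
  interpret prob_space M by fact
  have "norm (\<integral>x. q x \<partial>M) \<le> (\<integral>x. norm (q x) \<partial>M)" by (rule integral_norm_bound)
  also have "\<dots> \<le> (\<integral>x. B \<partial>M)" by (rule integral_mono) (use True assms in auto)
  finally show ?thesis by (simp add: prob_space)
next
  case False
  obtain x where "x \<in> space M" using prob_space.not_empty[OF assms(1)] by auto
  with assms(2)[OF this] have "0 \<le> B" using norm_ge_zero order_trans by blast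
  then show ?thesis using False by (simp add: not_integrable_integral_eq)
qed

section \<open>Total variation and stationary distributions\<close>

text \<open>A function with values in [0,1] is a dyadic combination of indicators whose weights 1/2,
  1/4, ... add up to 1. Hence the setwise bound carries over without a factor 2.\<close>

lemma integral_diff_le_of_sets_unit:
  fixes q :: "'x::topological_space \<Rightarrow> real"
  assumes M: "prob_space M" "sets M = sets borel" and N: "prob_space N" "sets N = sets borel"
    and d: "\<And>A. A \<in> sets borel \<Longrightarrow> \<bar>measure M A - measure N A\<bar> \<le> \<delta>"
    and q: "q \<in> borel_measurable borel" "\<And>x. 0 \<le> q x" "\<And>x. q x \<le> 1"
  shows "\<bar>(\<integral>x. q x \<partial>M) - (\<integral>x. q x \<partial>N)\<bar> \<le> \<delta>"
proof -
  have d0: "0 \<le> \<delta>" using d[of "{}"] by simp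
  have "\<bar>(\<integral>x. q x \<partial>M) - (\<integral>x. q x \<partial>N)\<bar> \<le> \<delta> + (1/2)^k" for k
    using q
  proof (induction k arbitrary: q)
    case 0
    have *: "0 \<le> (\<integral>x. q x \<partial>L) \<and> (\<integral>x. q x \<partial>L) \<le> 1" if "prob_space L" for L
      using norm_integral_le_prob[OF that, of q 1] 0 by (auto intro!: integral_nonneg)
    show ?case using *[OF M(1)] *[OF N(1)] d0 by (auto simp: abs_le_iff)
  next
    \<comment> \<open>Peel off the leading binary digit of \<open>q\<close>.\<close>
    case (Suc k)
    define B where "B = {x. 1/2 \<le> q x}"
    define r where "r x = 2 * q x - indicator B x" for x
    have B[measurable]: "B \<in> sets borel"
      unfolding B_def using Suc.prems(1) by measurable
    have r: "r \<in> borel_measurable borel" "\<And>x. 0 \<le> r x" "\<And>x. r x \<le> 1"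
      proof -
      show "r \<in> borel_measurable borel" unfolding r_def[abs_def] using Suc.prems(1) by measurable
    qed (use Suc.prems in \<open>auto simp: r_def B_def indicator_def\<close>)
    have e: "(\<integral>x. q x \<partial>L) = measure L B / 2 + (\<integral>x. r x \<partial>L) / 2"
      if L: "prob_space L" "sets L = sets borel" for L
    proof -
      have "integrable L r" by (rule integrable_bounded_borel[OF L, where B=1]) (use r in auto)
      moreover have "integrable L (indicator B :: _ \<Rightarrow> real)"
        by (rule integrable_bounded_borel[OF L, where B=1]) (auto simp: indicator_def)
      ultimately have "(\<integral>x. indicator B x / 2 + r x / 2 \<partial>L) = (\<integral>x. indicator B x \<partial>L) / 2 + (\<integral>x. r x \<partial>L) / 2"
        by simp
      moreover have "(\<lambda>x. indicator B x / 2 + r x / 2) = q" by (rule ext) (simp add: r_def field_simps)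
      moreover have "B \<inter> space L = B" using sets_eq_imp_space_eq[OF L(2)] by simp
      ultimately show ?thesis by simp
    qed
    have "\<bar>(\<integral>x. r x \<partial>M) - (\<integral>x. r x \<partial>N)\<bar> \<le> \<delta> + (1/2)^k" by (rule Suc.IH[OF r])
    moreover have "\<bar>measure M B - measure N B\<bar> \<le> \<delta>" by (rule d) measurable
    ultimately show ?case unfolding e[OF M] e[OF N] by (simp add: power_Suc)
  qed
  then have "\<bar>(\<integral>x. q x \<partial>M) - (\<integral>x. q x \<partial>N)\<bar> - \<delta> \<le> (1/2)^k" for k by (simp add: algebra_simps)
  moreover have "(\<lambda>k. (1/2::real)^k) \<longlonglongrightarrow> 0" by (rule LIMSEQ_realpow_zero) auto
  ultimately have "\<bar>(\<integral>x. q x \<partial>M) - (\<integral>x. q x \<partial>N)\<bar> - \<delta> \<le> 0"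
    by (intro LIMSEQ_le_const[where X="\<lambda>k. (1/2::real)^k"]) auto
  then show ?thesis by simp
qed

text \<open>Oscillation rather than the supremum is what an averaging kernel contracts.
  \<open>q\<close> is shifted by its infimum and scaled into [0,1]; \<open>w = 0\<close> is set
  apart because of the division.\<close>

lemma integral_diff_le_of_sets_osc:
  fixes q :: "'x::topological_space \<Rightarrow> real"
  assumes M: "prob_space M" "sets M = sets borel" and N: "prob_space N" "sets N = sets borel"
    and d: "\<And>A. A \<in> sets borel \<Longrightarrow> \<bar>measure M A - measure N A\<bar> \<le> \<delta>"
    and q: "q \<in> borel_measurable borel" "\<And>x y. \<bar>q x - q y\<bar> \<le> w"
  shows "\<bar>(\<integral>x. q x \<partial>M) - (\<integral>x. q x \<partial>N)\<bar> \<le> w * \<delta>"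
proof (cases "w = 0")
  case True
  then have "q = (\<lambda>x. q undefined)" using q(2)[of _ undefined] by auto
  then obtain c where c: "q = (\<lambda>x. c)" by blast
  show ?thesis
    by (simp add: True c prob_space.prob_space[OF M(1)] prob_space.prob_space[OF N(1)])
next
  case False
  moreover have "0 \<le> w" using q(2)[of undefined undefined] by simp
  ultimately have w: "0 < w" by simp
  have bd: "bdd_below (range q)"
    by (rule bdd_belowI[of _ "q undefined - w"]) (use q(2)[of _ undefined] in \<open>auto simp: abs_le_iff algebra_simps\<close>)
  define I where "I = (INF x. q x)"
  have I1: "I \<le> q x" for x unfolding I_def by (rule cINF_lower[OF bd]) auto
  have I2: "q x - w \<le> I" for x unfolding I_def
    by (rule cINF_greatest) (use q(2) in \<open>auto simp: abs_le_iff algebra_simps\<close>)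
  define r where "r x = (q x - I) / w" for x
  have r: "r \<in> borel_measurable borel" "\<And>x. 0 \<le> r x" "\<And>x. r x \<le> 1"
    using q(1) I1 I2 w by (auto simp: r_def[abs_def] divide_simps algebra_simps)
  have e: "(\<integral>x. q x \<partial>L) = w * (\<integral>x. r x \<partial>L) + I" if L: "prob_space L" "sets L = sets borel" for L
  proof -
    interpret prob_space L by fact
    have "integrable L r" by (rule integrable_bounded_borel[OF L, where B=1]) (use r in auto)
    then have "(\<integral>x. w * r x + I \<partial>L) = w * (\<integral>x. r x \<partial>L) + I" by (simp add: prob_space)
    moreover have "(\<lambda>x. w * r x + I) = q" using w by (auto simp: r_def)
    ultimately show ?thesis by simp
  qed
  have "\<bar>(\<integral>x. q x \<partial>M) - (\<integral>x. q x \<partial>N)\<bar> = w * \<bar>(\<integral>x. r x \<partial>M) - (\<integral>x. r x \<partial>N)\<bar>"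
    unfolding e[OF M] e[OF N] using w by (simp add: abs_mult right_diff_distrib[symmetric])
  also have "\<dots> \<le> w * \<delta>"
    by (intro mult_left_mono integral_diff_le_of_sets_unit[OF M N d r]) (use w in auto)
  finally show ?thesis .
qed

lemma stationary_bind:
  assumes K: "markov_kernel K" and s: "stationary K \<nu>"
  shows "\<nu> \<bind> K = \<nu>"
proof -
  have n: "prob_space \<nu>" "sets \<nu> = sets borel" using s by (auto simp: stationary_def)
  show ?thesis
  proof (rule measure_eqI)
    show "sets (\<nu> \<bind> K) = sets \<nu>" using prob_space_bind_markov[OF K n] n by simp
    fix A assume "A \<in> sets (\<nu> \<bind> K)"
    then have A: "A \<in> sets borel" using prob_space_bind_markov[OF K n] by simp
    have "\<nu> \<in> space (prob_algebra borel)" using n by (simp add: space_prob_algebra)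
    then show "emeasure (\<nu> \<bind> K) A = emeasure \<nu> A"
      using emeasure_bind_prob_algebra[OF _ markov_kernelD(1)[OF K] A] s A by (simp add: stationary_def)
  qed
qed

lemma stationary_bind_kpow:
  assumes K: "markov_kernel K" and s: "stationary K \<nu>"
  shows "\<nu> \<bind> kpow K t = \<nu>"
proof (induction t)
  case 0
  have "sets \<nu> = sets borel" using s by (auto simp: stationary_def)
  then show ?case by (simp add: bind_return'')
next
  case (Suc t)
  have n: "sets \<nu> = sets borel" using s by (auto simp: stationary_def)
  have m: "kpow K t \<in> borel \<rightarrow>\<^sub>M subprob_algebra borel"
    by (intro measurable_prob_algebraD markov_kernelD markov_kernel_kpow K)
  have k: "K \<in> \<nu> \<rightarrow>\<^sub>M subprob_algebra borel"
    using markov_kernelD(1)[OF K] by (simp add: measurable_prob_algebraD measurable_cong_sets[OF n refl])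
  have "\<nu> \<bind> kpow K (Suc t) = \<nu> \<bind> K \<bind> kpow K t"
    using bind_assoc[OF k m] by simp
  then show ?case using Suc stationary_bind[OF K s] by simp
qed

lemma kpow_integral_add:
  fixes q :: "'x::topological_space \<Rightarrow> real"
  assumes K: "markov_kernel K" and q: "q \<in> borel_measurable borel" "\<And>x. \<bar>q x\<bar> \<le> B"
  shows "(\<integral>y. q y \<partial>kpow K (s + t) x) = (\<integral>z. \<integral>y. q y \<partial>kpow K t z \<partial>kpow K s x)"
  unfolding kpow_add[OF K]
  by (rule integral_bind_markov_bounded[where B=B]) (use assms in \<open>auto intro!: markov_kernelD markov_kernel_kpow\<close>)

section \<open>Stationary laws from an m-step contraction\<close>

context
  fixes K :: "'x::topological_space \<Rightarrow> 'x measure" and m :: nat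
  assumes K: "markov_kernel K"
    and contr: "\<And>x y A. A \<in> sets borel \<Longrightarrow> \<bar>measure (kpow K m x) A - measure (kpow K m y) A\<bar> \<le> 1/2"
begin

text \<open>Dobrushin's argument: the average over \<open>j\<close> blocks has oscillation at most
  (1/2)^j, and averaging it once more over two laws that differ by at most 1/2 on every set halves
  this.\<close>

lemma kpow_osc_contraction:
  fixes q :: "'x \<Rightarrow> real"
  assumes q: "q \<in> borel_measurable borel" "\<And>x. 0 \<le> q x" "\<And>x. q x \<le> 1"
  shows "\<bar>(\<integral>z. q z \<partial>kpow K (j * m) x) - (\<integral>z. q z \<partial>kpow K (j * m) y)\<bar> \<le> (1/2)^j"
proof (induction j arbitrary: x y)
  case 0
  have "\<bar>q x - q y\<bar> \<le> 1" using q(2,3)[of x] q(2,3)[of y] by linarith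
  then show ?case using q(1) by (simp add: integral_return)
next
  case (Suc j)
  note kk = markov_kernelD[OF markov_kernel_kpow[OF K]]
  have q': "\<bar>q x\<bar> \<le> 1" for x using q(2,3)[of x] by simp
  have *: "(\<integral>z. q z \<partial>kpow K (Suc j * m) x) = (\<integral>z. \<integral>y. q y \<partial>kpow K (j * m) z \<partial>kpow K m x)" for x
    using kpow_integral_add[OF K q(1) q', of m "j * m" x] by simp
  have "\<bar>(\<integral>z. q z \<partial>kpow K (Suc j * m) x) - (\<integral>z. q z \<partial>kpow K (Suc j * m) y)\<bar> \<le> (1/2)^j * (1/2)"
    unfolding * by (intro integral_diff_le_of_sets_osc kk contr Suc.IH markov_integral_measurable markov_kernel_kpow K q)
  then show ?case by simp
qed

text \<open>Used with two choices of \<open>M\<close>: a stationary law, which \<open>kpow\<close>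
  preserves, gives uniqueness; the law \<open>kpow K s x\<close> gives the Cauchy property behind
  existence.\<close>

lemma kpow_diff_kpow_add:
  fixes q :: "'x \<Rightarrow> real"
  assumes q: "q \<in> borel_measurable borel" "\<And>x. 0 \<le> q x" "\<And>x. q x \<le> 1"
    and M: "prob_space M" "sets M = sets borel"
  shows "\<bar>(\<integral>z. q z \<partial>kpow K (j * m) x) - (\<integral>y. \<integral>z. q z \<partial>kpow K (j * m) y \<partial>M)\<bar> \<le> (1/2)^j"
proof -
  interpret prob_space M by fact
  define r where "r y = (\<integral>z. q z \<partial>kpow K (j * m) y)" for y
  have "\<bar>r y\<bar> \<le> 1" for y using norm_integral_le_prob[OF markov_kernelD(2)[OF markov_kernel_kpow[OF K]], where q=q and B=1] q
    by (simp add: r_def)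
  moreover have "r \<in> borel_measurable borel" unfolding r_def
    by (intro markov_integral_measurable markov_kernel_kpow K q)
  ultimately have "integrable M r" by (intro integrable_bounded_borel[OF M, where B=1]) auto
  then have "r x - (\<integral>y. r y \<partial>M) = (\<integral>y. r x - r y \<partial>M)" by (simp add: prob_space)
  also have "norm \<dots> \<le> (1/2)^j"
    by (rule norm_integral_le_prob[OF M(1)]) (use kpow_osc_contraction[OF q] in \<open>auto simp: r_def\<close>)
  finally show ?thesis by (simp add: r_def)
qed

lemma stationary_unique_of_contraction:
  assumes "stationary K \<nu>\<^sub>1" "stationary K \<nu>\<^sub>2"
  shows "\<nu>\<^sub>1 = \<nu>\<^sub>2"
proof (rule measure_eqI)
  have s: "prob_space \<nu>\<^sub>1" "sets \<nu>\<^sub>1 = sets borel" "prob_space \<nu>\<^sub>2" "sets \<nu>\<^sub>2 = sets borel"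
    using assms by (auto simp: stationary_def)
  show "sets \<nu>\<^sub>1 = sets \<nu>\<^sub>2" using s by simp
  fix A assume "A \<in> sets \<nu>\<^sub>1"
  then have A[measurable]: "A \<in> sets borel" using s by simp
  have i: "measure \<nu> A = (\<integral>y. \<integral>z. indicator A z \<partial>kpow K (j * m) y \<partial>\<nu>)" if st: "stationary K \<nu>" for \<nu> j
  proof -
    have n: "prob_space \<nu>" "sets \<nu> = sets borel" using st by (auto simp: stationary_def)
    have "measure \<nu> A = (\<integral>z. indicator A z \<partial>\<nu>)" using sets_eq_imp_space_eq[OF n(2)] by simp
    also have "\<dots> = (\<integral>z. indicator A z \<partial>(\<nu> \<bind> kpow K (j * m)))" by (simp only: stationary_bind_kpow[OF K st])
    also have "\<dots> = (\<integral>y. \<integral>z. indicator A z \<partial>kpow K (j * m) y \<partial>\<nu>)"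
      by (rule integral_bind_markov_bounded[where B=1]) (use n in \<open>auto intro!: markov_kernel_kpow K simp: indicator_def\<close>)
    finally show ?thesis .
  qed
  let ?x = "undefined :: 'x"
  have b: "\<bar>measure \<nu>\<^sub>1 A - measure \<nu>\<^sub>2 A\<bar> \<le> (1/2)^j + (1/2)^j" for j
  proof -
    have "\<bar>(\<integral>z. indicator A z \<partial>kpow K (j * m) ?x) - (\<integral>y. \<integral>z. indicator A z \<partial>kpow K (j * m) y \<partial>\<nu>\<^sub>1)\<bar> \<le> (1/2::real)^j"
      "\<bar>(\<integral>z. indicator A z \<partial>kpow K (j * m) ?x) - (\<integral>y. \<integral>z. indicator A z \<partial>kpow K (j * m) y \<partial>\<nu>\<^sub>2)\<bar> \<le> (1/2::real)^j"
      using s by (intro kpow_diff_kpow_add; simp add: indicator_def)+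
    then show ?thesis unfolding i[OF assms(1), of j] i[OF assms(2), of j] by linarith
  qed
  have "(\<lambda>j. (1/2::real)^j + (1/2)^j) \<longlonglongrightarrow> 0 + 0" by (intro tendsto_add LIMSEQ_realpow_zero) auto
  then have "\<bar>measure \<nu>\<^sub>1 A - measure \<nu>\<^sub>2 A\<bar> \<le> 0 + 0"
    by (rule LIMSEQ_le_const) (use b in blast)
  then have "measure \<nu>\<^sub>1 A = measure \<nu>\<^sub>2 A" by simp
  then show "emeasure \<nu>\<^sub>1 A = emeasure \<nu>\<^sub>2 A"
    using s by (simp add: finite_measure.emeasure_eq_measure prob_space.finite_measure)
qed

text \<open>The laws at times \<open>j * m\<close> from an arbitrary starting point are Cauchy
  uniformly over Borel sets. Their setwise limit is finitely additive, and the uniform rate upgrades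
  this to countable additivity.\<close>

lemma stationary_exists_of_contraction: "\<exists>\<nu>. stationary K \<nu>"
proof -
  let ?x = "undefined :: 'x"
  define a where "a j A = measure (kpow K (j * m) ?x) A" for j A
  note kk = markov_kernelD[OF markov_kernel_kpow[OF K]]
  have sp: "A \<inter> space (kpow K t x) = A" for t x and A :: "'x set" by (simp add: kk)
  have aint: "a j A = (\<integral>z. indicator A z \<partial>kpow K (j * m) ?x)" if "A \<in> sets borel" for j A
    using that by (simp add: a_def sp)
  have shift: "\<bar>a j A - measure (kpow K (s + j * m) ?x) A\<bar> \<le> (1/2)^j" if A[measurable]: "A \<in> sets borel" for j s A
  proof -
    have "\<bar>(\<integral>z. indicator A z \<partial>kpow K (j * m) ?x) - (\<integral>y. \<integral>z. indicator A z \<partial>kpow K (j * m) y \<partial>kpow K s ?x)\<bar> \<le> (1/2::real)^j"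
      by (intro kpow_diff_kpow_add kk; simp add: indicator_def)
    also have "(\<integral>y. \<integral>z. indicator A z \<partial>kpow K (j * m) y \<partial>kpow K s ?x) = (\<integral>z. indicator A z \<partial>kpow K (s + j * m) ?x :: real)"
      by (rule kpow_integral_add[OF K, symmetric, where B=1]) (auto simp: indicator_def)
    finally show ?thesis by (simp add: aint sp)
  qed
  have a_le: "\<bar>a j A - a i A\<bar> \<le> (1/2)^j" if "A \<in> sets borel" "j \<le> i" for i j A
  proof -
    have "i * m = (i * m - j * m) + j * m" using that(2) by simp
    then show ?thesis using shift[OF that(1), of j "i * m - j * m"] by (simp add: a_def)
  qed
  have p0: "(\<lambda>j. (1/2::real)^j) \<longlonglongrightarrow> 0" by (rule LIMSEQ_realpow_zero) auto
  have conv: "convergent (\<lambda>j. a j A)" if A: "A \<in> sets borel" for A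
  proof (rule Cauchy_convergent, rule metric_CauchyI)
    fix e :: real assume "0 < e"
    then obtain j where j: "(1/2::real)^j < e / 2" using real_arch_pow_inv[of "e/2" "1/2"] by auto
    show "\<exists>M. \<forall>i\<ge>M. \<forall>k\<ge>M. dist (a i A) (a k A) < e"
    proof (intro exI allI impI)
      fix i k assume "j \<le> i" "j \<le> k"
      with a_le[OF A \<open>j \<le> i\<close>] a_le[OF A \<open>j \<le> k\<close>] j show "dist (a i A) (a k A) < e"
        by (simp add: dist_real_def)
    qed
  qed
  define v where "v A = lim (\<lambda>j. a j A)" for A
  have vlim: "(\<lambda>j. a j A) \<longlonglongrightarrow> v A" if "A \<in> sets borel" for A
    using conv[OF that] by (simp add: v_def convergent_LIMSEQ_iff)
  have v_le: "\<bar>a j A - v A\<bar> \<le> (1/2)^j" if A: "A \<in> sets borel" for j A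
  proof (rule LIMSEQ_le_const2[where X="\<lambda>i. \<bar>a j A - a i A\<bar>"])
    show "(\<lambda>i. \<bar>a j A - a i A\<bar>) \<longlonglongrightarrow> \<bar>a j A - v A\<bar>" by (intro tendsto_intros vlim A)
    show "\<exists>N. \<forall>n\<ge>N. \<bar>a j A - a n A\<bar> \<le> (1/2)^j" using a_le[OF A] by blast
  qed
  have v0: "0 \<le> v A" if "A \<in> sets borel" for A
    by (rule LIMSEQ_le_const[OF vlim[OF that]]) (auto simp: a_def)
  have pos: "positive (sets borel) (\<lambda>A. ennreal (v A))"
  proof -
    have "(\<lambda>j. a j {}) \<longlonglongrightarrow> 0" by (simp add: a_def)
    then have "v {} = 0" using vlim[of "{}"] LIMSEQ_unique by auto
    then show ?thesis by (simp add: positive_def)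
  qed
  have addv: "v (A \<union> B) = v A + v B" if A: "A \<in> sets borel" and B: "B \<in> sets borel" and AB: "A \<inter> B = {}" for A B
  proof -
    have "a j (A \<union> B) = a j A + a j B" for j unfolding a_def
      by (rule finite_measure.finite_measure_Union) (use A B AB in \<open>auto simp: kk intro!: prob_space.finite_measure kk\<close>)
    moreover have "(\<lambda>j. a j A + a j B) \<longlonglongrightarrow> v A + v B" by (intro tendsto_add vlim A B)
    ultimately have "(\<lambda>j. a j (A \<union> B)) \<longlonglongrightarrow> v A + v B" by simp
    then show ?thesis using vlim[of "A \<union> B"] LIMSEQ_unique A B by blast
  qed
  have additive: "additive (sets borel) (\<lambda>A. ennreal (v A))"
    by (auto simp: additive_def addv v0)
  \<comment> \<open>Exchange of limits: \<open>j\<close> is fixed first by the rate that is uniform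
    in the set, then continuity from above of the single measure \<open>a j\<close> is used.\<close>
  have cont: "(\<lambda>i. ennreal (v (A i))) \<longlonglongrightarrow> 0"
    if A: "range A \<subseteq> sets borel" "decseq A" "(\<Inter>i. A i) = {}" for A :: "nat \<Rightarrow> 'x set"
  proof -
    have Ai: "A i \<in> sets borel" for i using A by auto
    have "(\<lambda>i. v (A i)) \<longlonglongrightarrow> 0"
    proof (rule LIMSEQ_I)
      fix e :: real assume "0 < e"
      then obtain j where j: "(1/2::real)^j < e / 2" using real_arch_pow_inv[of "e/2" "1/2"] by auto
      have "(\<lambda>i. a j (A i)) \<longlonglongrightarrow> a j (\<Inter>i. A i)" unfolding a_def
        by (rule finite_measure.finite_Lim_measure_decseq) (use A in \<open>auto simp: kk intro!: prob_space.finite_measure kk\<close>)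
      then have "(\<lambda>i. a j (A i)) \<longlonglongrightarrow> 0" using A(3) by (simp add: a_def)
      then obtain N where N: "\<And>i. i \<ge> N \<Longrightarrow> norm (a j (A i) - 0) < e / 2"
        using LIMSEQ_D[of _ 0 "e/2"] \<open>0 < e\<close> by (metis half_gt_zero)
      show "\<exists>N. \<forall>i\<ge>N. norm (v (A i) - 0) < e"
      proof (intro exI allI impI)
        fix i assume "N \<le> i"
        from N[OF this] v_le[OF Ai, of j i] j show "norm (v (A i) - 0) < e" by simp
      qed
    qed
    from tendsto_ennrealI[OF this] show ?thesis by simp
  qed
  have ca: "countably_additive (sets borel) (\<lambda>A. ennreal (v A))"
    by (rule sets.empty_continuous_imp_countably_additive) (use pos additive cont in auto)
  define \<nu> :: "'x measure" where "\<nu> = measure_of UNIV (sets borel) (\<lambda>A. ennreal (v A))"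
  have sa: "sigma_algebra UNIV (sets (borel :: 'x measure))" using sets.sigma_algebra_axioms[of "borel :: 'x measure"] by simp
  have sets: "sets \<nu> = sets borel" unfolding \<nu>_def using sets.sigma_sets_eq[of "borel :: 'x measure"] by simp
  have em: "emeasure \<nu> A = ennreal (v A)" if "A \<in> sets borel" for A
    unfolding \<nu>_def by (rule emeasure_measure_of_sigma[OF sa pos ca that])
  have prob: "prob_space \<nu>"
  proof
    have "a j UNIV = 1" for j unfolding a_def using prob_space.prob_space[OF kk(2)[of "j*m" ?x]] by (simp add: kk)
    then have "v UNIV = 1" using vlim[of UNIV] by (simp add: LIMSEQ_const_iff)
    then show "emeasure \<nu> (space \<nu>) = 1" using em[of UNIV] sets_eq_imp_space_eq[OF sets] by simp
  qed
  have mv: "measure \<nu> A = v A" if "A \<in> sets borel" for A using em[OF that] v0[OF that] by (simp add: measure_def)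
  have "measure \<nu> A = (\<integral>x. measure (K x) A \<partial>\<nu>)" if A[measurable]: "A \<in> sets borel" for A
  proof -
    define q where "q x = measure (K x) A" for x
    have qi: "q x = (\<integral>z. indicator A z \<partial>K x)" for x by (simp add: q_def markov_kernelD[OF K])
    have q: "q \<in> borel_measurable borel" "\<And>x. 0 \<le> q x" "\<And>x. q x \<le> 1"
    proof -
      show "q \<in> borel_measurable borel" unfolding qi[abs_def] by (intro markov_integral_measurable K) auto
      show "\<And>x. 0 \<le> q x" "\<And>x. q x \<le> 1"
        unfolding q_def using prob_space.prob_le_1[OF markov_kernelD(2)[OF K]] by auto
    qed
    \<comment> \<open>The three errors are: \<nu> against the law at time \<open>j * m\<close> on
      \<open>A\<close>, one extra step of the chain, and the law at time \<open>j * m\<close>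
      against \<nu> inside the integral of \<open>q\<close>.\<close>
    have "\<bar>measure \<nu> A - (\<integral>x. q x \<partial>\<nu>)\<bar> \<le> (1/2)^j + ((1/2)^j + (1/2)^j)" for j
    proof -
      have 1: "\<bar>(\<integral>x. q x \<partial>kpow K (j * m) ?x) - (\<integral>x. q x \<partial>\<nu>)\<bar> \<le> (1/2)^j"
        by (rule integral_diff_le_of_sets_unit[OF kk(2,3) prob sets _ q])
          (use v_le mv in \<open>auto simp: a_def\<close>)
      have "(\<integral>x. q x \<partial>kpow K (j * m) ?x) = (\<integral>z. indicator A z \<partial>(kpow K (j * m) ?x \<bind> K))"
        unfolding qi by (rule integral_bind_markov_bounded[OF K, symmetric, where B=1]) (auto simp: kk indicator_def)
      also have "\<dots> = measure (kpow K (1 + j * m) ?x) A"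
        using sp[of A "Suc (j * m)" ?x] by (simp add: kpow_Suc_right[OF K, symmetric] del: kpow.simps)
      finally have 2: "(\<integral>x. q x \<partial>kpow K (j * m) ?x) = measure (kpow K (1 + j * m) ?x) A" .
      show ?thesis using 1 2 shift[OF A, of j 1] v_le[OF A, of j] mv[OF A] by linarith
    qed
    moreover have "(\<lambda>j. (1/2::real)^j + ((1/2)^j + (1/2)^j)) \<longlonglongrightarrow> 0 + (0 + 0)" by (intro tendsto_add p0)
    ultimately have "\<bar>measure \<nu> A - (\<integral>x. q x \<partial>\<nu>)\<bar> \<le> 0 + (0 + 0)"
      by (intro LIMSEQ_le_const[where X="\<lambda>j. (1/2::real)^j + ((1/2)^j + (1/2)^j)"]) blast+
    then show ?thesis by (simp add: q_def)
  qed
  note meq = this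
  have "stationary K \<nu>" unfolding stationary_def
  proof (intro conjI prob sets ballI)
    fix A :: "'x set" assume A[measurable]: "A \<in> sets borel"
    have "(\<integral>\<^sup>+x. emeasure (K x) A \<partial>\<nu>) = (\<integral>\<^sup>+x. ennreal (measure (K x) A) \<partial>\<nu>)"
      by (intro nn_integral_cong) (simp add: finite_measure.emeasure_eq_measure prob_space.finite_measure markov_kernelD[OF K])
    also have "\<dots> = ennreal (\<integral>x. measure (K x) A \<partial>\<nu>)"
    proof (rule nn_integral_eq_integral)
      have "(\<lambda>x. measure (K x) A) = (\<lambda>x. \<integral>z. indicator A z \<partial>K x)" by (simp add: markov_kernelD[OF K])
      moreover have "(\<lambda>x. \<integral>z. indicator A z \<partial>K x :: real) \<in> borel_measurable borel"
        by (intro markov_integral_measurable K) auto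
      ultimately show "integrable \<nu> (\<lambda>x. measure (K x) A)"
        by (intro integrable_bounded_borel[OF prob sets, where B=1])
          (auto simp: prob_space.prob_le_1 markov_kernelD[OF K])
    qed auto
    finally show "emeasure \<nu> A = (\<integral>\<^sup>+x. emeasure (K x) A \<partial>\<nu>)"
      using meq[OF A] prob by (simp add: finite_measure.emeasure_eq_measure prob_space.finite_measure)
  qed
  then show ?thesis by blast
qed

end

section \<open>Perturbed kernels\<close>

locale ergodic_chain =
  fixes P :: "'x::polish_space \<Rightarrow> 'x measure" and \<pi> :: "'x measure" and \<kappa> \<rho> :: real
  assumes kernel: "markov_kernel P"
    and stat: "stationary P \<pi>"
    and rho: "0 \<le> \<rho>" "\<rho> < 1"
    and mix: "\<And>x t A. A \<in> sets borel \<Longrightarrow> \<bar>measure (kpow P t x) A - measure \<pi> A\<bar> \<le> \<kappa> * \<rho> ^ t"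
begin

lemma pi_prob: "prob_space \<pi>" and pi_sets: "sets \<pi> = sets borel" and pi_space: "space \<pi> = UNIV"
  using stat sets_eq_imp_space_eq[of \<pi> borel] by (auto simp: stationary_def)

lemmas P_D = markov_kernelD[OF kernel]
lemmas kpow_D = markov_kernelD[OF markov_kernel_kpow[OF kernel]]

lemma kappa_nonneg: "0 \<le> \<kappa>"
  using mix[of "{}" 0] by simp

lemma mix_integral:
  fixes q :: "'x \<Rightarrow> real"
  assumes q: "q \<in> borel_measurable borel" "\<And>x. \<bar>q x\<bar> \<le> B"
  shows "\<bar>(\<integral>y. q y \<partial>kpow P t x) - (\<integral>y. q y \<partial>\<pi>)\<bar> \<le> 2 * B * (\<kappa> * \<rho> ^ t)"
proof -
  have "\<bar>q x - q y\<bar> \<le> 2 * B" for x y using q(2)[of x] q(2)[of y] by linarith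
  then show ?thesis by (intro integral_diff_le_of_sets_osc kpow_D pi_prob pi_sets mix q)
qed

lemma integrable_pi_bounded:
  fixes q :: "'x \<Rightarrow> 'c::{banach, second_countable_topology}"
  shows "q \<in> borel_measurable borel \<Longrightarrow> (\<And>x. norm (q x) \<le> B) \<Longrightarrow> integrable \<pi> q"
  by (rule integrable_bounded_borel[OF pi_prob pi_sets])

lemma
  fixes q :: "'x \<Rightarrow> 'c::{banach, second_countable_topology}"
  assumes q: "integrable \<pi> q"
  shows AE_integrable_kernel: "AE x in \<pi>. integrable (P x) q"
    and integrable_kernel: "integrable \<pi> (\<lambda>x. \<integral>y. q y \<partial>P x)"
    and integral_kernel: "(\<integral>x. \<integral>y. q y \<partial>P x \<partial>\<pi>) = (\<integral>z. q z \<partial>\<pi>)"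
  using AE_integrable_bind_markov[OF kernel pi_prob pi_sets, of q] integrable_bind_markov[OF kernel pi_prob pi_sets, of q]
   integral_bind_markov[OF kernel pi_prob pi_sets, of q] q by (auto simp: stationary_bind[OF kernel stat])

definition poisson_sol :: "('x \<Rightarrow> real) \<Rightarrow> 'x \<Rightarrow> real" where
  "poisson_sol q x = (\<Sum>t. \<integral>y. q y \<partial>kpow P t x)"

context
  fixes q :: "'x \<Rightarrow> real" and B :: real
  assumes q: "q \<in> borel_measurable borel" "\<And>x. \<bar>q x\<bar> \<le> B" and q0: "(\<integral>x. q x \<partial>\<pi>) = 0"
begin

lemma poisson_term_le: "\<bar>\<integral>y. q y \<partial>kpow P t x\<bar> \<le> 2 * B * \<kappa> * \<rho> ^ t"
  using mix_integral[OF q, of t x] q0 by (simp add: mult.assoc)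

lemma summable_poisson_bound: "summable (\<lambda>t. 2 * B * \<kappa> * \<rho> ^ t)"
  using rho by (intro summable_mult summable_geometric) auto

lemma summable_poisson: "summable (\<lambda>t. \<integral>y. q y \<partial>kpow P t x)"
  by (rule summable_comparison_test'[OF summable_poisson_bound, of 0]) (use poisson_term_le in auto)

lemma poisson_sol_le: "\<bar>poisson_sol q x\<bar> \<le> 2 * B * \<kappa> / (1 - \<rho>)"
proof -
  have s: "summable (\<lambda>t. \<bar>\<integral>y. q y \<partial>kpow P t x\<bar>)"
    by (rule summable_comparison_test'[OF summable_poisson_bound, of 0]) (use poisson_term_le in auto)
  have "\<bar>poisson_sol q x\<bar> \<le> (\<Sum>t. \<bar>\<integral>y. q y \<partial>kpow P t x\<bar>)"
    unfolding poisson_sol_def using summable_rabs[OF s] by simp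
  also have "\<dots> \<le> (\<Sum>t. 2 * B * \<kappa> * \<rho> ^ t)"
    by (intro suminf_le poisson_term_le s summable_poisson_bound)
  also have "\<dots> = 2 * B * \<kappa> * (1 / (1 - \<rho>))"
    using rho by (subst suminf_mult) (auto intro!: summable_geometric simp: suminf_geometric)
  finally show ?thesis by simp
qed

lemma poisson_sol_measurable: "poisson_sol q \<in> borel_measurable borel"
  unfolding poisson_sol_def[abs_def]
  by (intro borel_measurable_suminf markov_integral_measurable markov_kernel_kpow kernel q)

text \<open>Applying \<open>P\<close> shifts the series by one index, so only the term t = 0, which
  is \<open>q\<close>, is lost. The geometric bound justifies exchanging sum and integral.\<close>

lemma poisson_eq: "poisson_sol q x = q x + (\<integral>y. poisson_sol q y \<partial>P x)"
proof -
  have qm: "(\<lambda>y. \<integral>z. q z \<partial>kpow P t y) \<in> borel_measurable borel" for t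
    by (intro markov_integral_measurable markov_kernel_kpow kernel q)
  have step: "(\<integral>y. \<integral>z. q z \<partial>kpow P t y \<partial>P x) = (\<integral>z. q z \<partial>kpow P (Suc t) x)" for t
    using kpow_integral_add[OF kernel q, of 1 t x] kpow_1[OF kernel] by simp
  have "(\<integral>y. poisson_sol q y \<partial>P x) = (\<Sum>t. \<integral>y. \<integral>z. q z \<partial>kpow P t y \<partial>P x)"
    unfolding poisson_sol_def
  proof (rule integral_suminf)
    show int: "integrable (P x) (\<lambda>y. \<integral>z. q z \<partial>kpow P t y)" for t
      by (rule integrable_bounded_borel[OF P_D(2,3) qm]) (use poisson_term_le in auto)
    show "AE y in P x. summable (\<lambda>t. norm (\<integral>z. q z \<partial>kpow P t y))"
      by (intro AE_I2 summable_comparison_test'[OF summable_poisson_bound, of 0]) (use poisson_term_le in auto)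
    show "summable (\<lambda>t. \<integral>y. norm (\<integral>z. q z \<partial>kpow P t y) \<partial>P x)"
    proof (rule summable_comparison_test'[OF summable_poisson_bound, of 0])
      fix t
      show "norm (\<integral>y. norm (\<integral>z. q z \<partial>kpow P t y) \<partial>P x) \<le> 2 * B * \<kappa> * \<rho> ^ t"
        by (rule norm_integral_le_prob[OF P_D(2)]) (use poisson_term_le in auto)
    qed
  qed
  also have "\<dots> = (\<Sum>t. \<integral>z. q z \<partial>kpow P (Suc t) x)" by (simp only: step)
  also have "\<dots> = poisson_sol q x - (\<integral>z. q z \<partial>kpow P 0 x)"
    unfolding poisson_sol_def by (rule suminf_split_head[OF summable_poisson])
  also have "(\<integral>z. q z \<partial>kpow P 0 x) = q x" using q(1) by (simp add: integral_return)
  finally show ?thesis by simp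
qed

end

end

text \<open>The bounds by 1/8 are budgets. Comparing two starting points over \<open>m\<close> steps
  costs two mixing errors and two perturbation errors, 4 * 1/8 = 1/2 in all. In
  \<open>pin_moment_finite\<close> a mixing error (1/8)^k is weighted by 2^k * 2^k and must stay
  summable.\<close>

locale perturbed_chain = ergodic_chain P \<pi> \<kappa> \<rho>
  for P :: "'x::polish_space \<Rightarrow> 'x measure" and \<pi> \<kappa> \<rho> +
  fixes h :: "'x \<Rightarrow> 'x \<Rightarrow> real" and C :: real and m n :: nat
  assumes h: "h \<in> perturbation_class P" and h_le: "\<And>x y. \<bar>h x y\<bar> \<le> C"
    and m_pos: "0 < m" and rho_m: "\<rho> ^ m \<le> 1/8" "\<kappa> * \<rho> ^ m \<le> 1/8"
    and n_large: "m * (C / sqrt n) \<le> 1/8"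
begin

definition \<theta> :: real where "\<theta> = 1 / sqrt n"
abbreviation "Pn \<equiv> pert_kernel P h n"
abbreviation "\<pi>n \<equiv> pert_stat P h n"

lemma theta_nonneg: "0 \<le> \<theta>" by (simp add: \<theta>_def)

lemma Pn_eq: "Pn x = density (P x) (\<lambda>y. ennreal (1 + \<theta> * h x y))"
  by (simp add: pert_kernel_def \<theta>_def)

lemma C_nonneg: "0 \<le> C" using h_le[of undefined undefined] by simp

lemma C_theta: "0 \<le> C * \<theta>" "m * (C * \<theta>) \<le> 1/8" "C * \<theta> \<le> 1/8"
proof -
  show 1: "0 \<le> C * \<theta>" using C_nonneg theta_nonneg by simp
  show 2: "m * (C * \<theta>) \<le> 1/8" using n_large by (simp add: \<theta>_def)
  have "1 * (C * \<theta>) \<le> m * (C * \<theta>)" using m_pos 1 by (intro mult_right_mono) auto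
  then show "C * \<theta> \<le> 1/8" using 2 by simp
qed

lemma theta_h_le: "\<bar>\<theta> * h x y\<bar> \<le> C * \<theta>"
  using h_le[of x y] mult_right_mono[OF h_le theta_nonneg] theta_nonneg by (simp add: abs_mult mult.commute)

lemma h_measurable: "(\<lambda>(x, y). h x y) \<in> borel_measurable (borel \<Otimes>\<^sub>M borel)"
  using h by (simp add: perturbation_class_def borel_prod)

lemma h_measurable': "h x \<in> borel_measurable borel"
  using measurable_Pair2[OF h_measurable, of x] by simp

lemma h_integral: "(\<integral>y. h x y \<partial>P x) = 0"
  using h by (simp add: perturbation_class_def)

text \<open>Since the weight stays away from 0, the cast to \<open>ennreal\<close> in
  \<open>pert_kernel\<close> cuts nothing off, and \<open>P\<close> and \<open>Pn\<close> dominate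
  each other up to constants.\<close>

lemma weight_bounds: "7/8 \<le> 1 + \<theta> * h x y" "1 + \<theta> * h x y \<le> 1 + C * \<theta>"
  using theta_h_le[of x y] C_theta(3) by (auto simp: abs_le_iff)

lemma nn_integral_Pn:
  assumes f: "f \<in> borel_measurable borel"
  shows "(\<integral>\<^sup>+y. f y \<partial>Pn x) = (\<integral>\<^sup>+y. ennreal (1 + \<theta> * h x y) * f y \<partial>P x)"
  unfolding Pn_eq
  by (rule nn_integral_density) (use f h_measurable'[of x] in \<open>simp_all add: measurable_cong_sets[OF P_D(3) refl]\<close>)

lemma markov_Pn: "markov_kernel Pn"
  unfolding markov_kernel_def
proof (rule measurable_prob_algebraI)
  have s: "sets (Pn x) = sets borel" for x by (simp add: Pn_eq P_D)
  have em: "emeasure (Pn x) A = (\<integral>\<^sup>+y. ennreal (1 + \<theta> * h x y) * indicator A y \<partial>P x)" if "A \<in> sets borel" for A x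
    using nn_integral_Pn[of "indicator A" x] that by (simp add: s)
  show pr: "prob_space (Pn x)" for x
  proof
    have ih: "integrable (P x) (h x)" by (rule integrable_bounded_borel[OF P_D(2,3) h_measurable']) (use h_le in simp)
    interpret prob_space "P x" by (rule P_D)
    have "emeasure (Pn x) UNIV = (\<integral>\<^sup>+y. ennreal (1 + \<theta> * h x y) \<partial>P x)" by (simp add: em)
    also have "\<dots> = ennreal (\<integral>y. 1 + \<theta> * h x y \<partial>P x)"
    proof (rule nn_integral_eq_integral)
      show "integrable (P x) (\<lambda>y. 1 + \<theta> * h x y)" using ih by simp
      show "AE y in P x. 0 \<le> 1 + \<theta> * h x y" by (rule AE_I2) (rule order_trans[OF _ weight_bounds(1)], simp)
    qed
    also have "(\<integral>y. 1 + \<theta> * h x y \<partial>P x) = 1" using ih h_integral[of x] by (simp add: prob_space)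
    finally show "emeasure (Pn x) (space (Pn x)) = 1" using sets_eq_imp_space_eq[OF s] by simp
  qed
  show "Pn \<in> borel \<rightarrow>\<^sub>M subprob_algebra borel"
  proof (rule measurable_subprob_algebra)
    show "subprob_space (Pn x)" for x using pr by (rule prob_space_imp_subprob_space)
    fix A :: "'x set" assume A[measurable]: "A \<in> sets borel"
    note h_measurable[measurable]
    have "(\<lambda>(x, y). ennreal (1 + \<theta> * h x y) * indicator A y) \<in> borel_measurable (borel \<Otimes>\<^sub>M borel)" by measurable
    from nn_integral_measurable_kernel[OF P_D(1) this]
    show "(\<lambda>x. emeasure (Pn x) A) \<in> borel_measurable borel" by (simp add: em)
  qed (rule s)
qed

lemmas Pn_D = markov_kernelD[OF markov_Pn]
lemmas kpow_n_D = markov_kernelD[OF markov_kernel_kpow[OF markov_Pn]]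

lemma nn_integral_Pn_le:
  assumes f: "f \<in> borel_measurable borel"
  shows "(\<integral>\<^sup>+y. f y \<partial>Pn x) \<le> ennreal (1 + C * \<theta>) * (\<integral>\<^sup>+y. f y \<partial>P x)"
proof -
  have "(\<integral>\<^sup>+y. f y \<partial>Pn x) \<le> (\<integral>\<^sup>+y. ennreal (1 + C * \<theta>) * f y \<partial>P x)"
    unfolding nn_integral_Pn[OF f]
    by (intro nn_integral_mono mult_right_mono ennreal_leI weight_bounds) auto
  also have "\<dots> = ennreal (1 + C * \<theta>) * (\<integral>\<^sup>+y. f y \<partial>P x)"
    by (rule nn_integral_cmult) (use f in \<open>simp add: measurable_cong_sets[OF P_D(3) refl]\<close>)
  finally show ?thesis .
qed

lemma nn_integral_P_le_Pn:
  assumes f: "f \<in> borel_measurable borel"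
  shows "(\<integral>\<^sup>+y. f y \<partial>P x) \<le> 2 * (\<integral>\<^sup>+y. f y \<partial>Pn x)"
proof -
  have f': "f \<in> borel_measurable (P x)" using f by (simp add: measurable_cong_sets[OF P_D(3) refl])
  have "(\<integral>\<^sup>+y. f y \<partial>P x) = (\<integral>\<^sup>+y. 1 * f y \<partial>P x)" by simp
  also have "\<dots> \<le> (\<integral>\<^sup>+y. (2 * ennreal (1 + \<theta> * h x y)) * f y \<partial>P x)"
  proof (intro nn_integral_mono mult_right_mono)
    fix y
    have "1 \<le> 2 * (1 + \<theta> * h x y)" using weight_bounds(1)[of x y] by simp
    then have "ennreal 1 \<le> ennreal (2 * (1 + \<theta> * h x y))" by (rule ennreal_leI)
    also have "\<dots> = 2 * ennreal (1 + \<theta> * h x y)" using weight_bounds(1)[of x y] by (subst ennreal_mult) auto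
    finally show "1 \<le> 2 * ennreal (1 + \<theta> * h x y)" by simp
  qed simp
  also have "\<dots> = 2 * (\<integral>\<^sup>+y. ennreal (1 + \<theta> * h x y) * f y \<partial>P x)"
    unfolding mult.assoc by (rule nn_integral_cmult)
      (use f' h_measurable'[of x] in \<open>simp add: measurable_cong_sets[OF P_D(3) refl]\<close>)
  finally show ?thesis by (simp add: nn_integral_Pn[OF f])
qed

lemma integrable_Pn_iff:
  fixes f :: "'x \<Rightarrow> 'c::{banach, second_countable_topology}"
  shows "integrable (Pn x) f \<longleftrightarrow> integrable (P x) f"
proof (cases "f \<in> borel_measurable borel")
  case True
  then have "(\<integral>\<^sup>+y. norm (f y) \<partial>Pn x) \<le> ennreal (1 + C * \<theta>) * (\<integral>\<^sup>+y. norm (f y) \<partial>P x)"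
    "(\<integral>\<^sup>+y. norm (f y) \<partial>P x) \<le> 2 * (\<integral>\<^sup>+y. norm (f y) \<partial>Pn x)"
    by (intro nn_integral_Pn_le nn_integral_P_le_Pn; measurable)+
  then have "(\<integral>\<^sup>+y. norm (f y) \<partial>Pn x) < \<infinity> \<longleftrightarrow> (\<integral>\<^sup>+y. norm (f y) \<partial>P x) < \<infinity>"
    by (metis ennreal_less_top ennreal_mult_less_top infinity_ennreal_def le_less_trans ennreal_numeral_less_top)
  then show ?thesis unfolding integrable_iff_bounded
    by (simp add: measurable_cong_sets[OF P_D(3) refl] measurable_cong_sets[OF Pn_D(3) refl])
next
  case False
  then show ?thesis unfolding integrable_iff_bounded
    by (simp add: measurable_cong_sets[OF P_D(3) refl] measurable_cong_sets[OF Pn_D(3) refl])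
qed

lemma integrable_h_scale:
  fixes f :: "'x \<Rightarrow> 'c::{banach, second_countable_topology}"
  assumes f: "integrable (P x) f"
  shows "integrable (P x) (\<lambda>y. h x y *\<^sub>R f y)"
proof (rule Bochner_Integration.integrable_bound[of _ "\<lambda>y. C *\<^sub>R f y"])
  show "integrable (P x) (\<lambda>y. C *\<^sub>R f y)" using f by simp
  show "(\<lambda>y. h x y *\<^sub>R f y) \<in> borel_measurable (P x)"
    using h_measurable'[of x] borel_measurable_integrable[OF f] by (simp add: measurable_cong_sets[OF P_D(3) refl])
  show "AE y in P x. norm (h x y *\<^sub>R f y) \<le> norm (C *\<^sub>R f y)"
    using h_le C_nonneg by (auto intro!: mult_right_mono)
qed

lemma integral_Pn:
  fixes f :: "'x \<Rightarrow> 'c::{banach, second_countable_topology}"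
  assumes f: "integrable (P x) f"
  shows "(\<integral>y. f y \<partial>Pn x) = (\<integral>y. f y \<partial>P x) + \<theta> *\<^sub>R (\<integral>y. h x y *\<^sub>R f y \<partial>P x)"
proof -
  have "(\<integral>y. f y \<partial>Pn x) = (\<integral>y. (1 + \<theta> * h x y) *\<^sub>R f y \<partial>P x)"
    unfolding Pn_eq
  proof (rule integral_density)
    show "f \<in> borel_measurable (P x)" using f by simp
    show "(\<lambda>y. 1 + \<theta> * h x y) \<in> borel_measurable (P x)"
      using h_measurable'[of x] by (simp add: measurable_cong_sets[OF P_D(3) refl])
    show "AE y in P x. 0 \<le> 1 + \<theta> * h x y" by (rule AE_I2) (rule order_trans[OF _ weight_bounds(1)], simp)
  qed
  also have "\<dots> = (\<integral>y. f y + \<theta> *\<^sub>R (h x y *\<^sub>R f y) \<partial>P x)"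
    by (simp add: scaleR_add_left)
  also have "\<dots> = (\<integral>y. f y \<partial>P x) + (\<integral>y. \<theta> *\<^sub>R (h x y *\<^sub>R f y) \<partial>P x)"
    by (intro Bochner_Integration.integral_add f integrable_scaleR_right integrable_h_scale)
  also have "(\<integral>y. \<theta> *\<^sub>R (h x y *\<^sub>R f y) \<partial>P x) = \<theta> *\<^sub>R (\<integral>y. h x y *\<^sub>R f y \<partial>P x)"
    by (rule integral_scaleR_right)
  finally show ?thesis .
qed

text \<open>Multiplicative comparison, one density factor per step. It is fit for null sets and
  tails, where the additive bound of \<open>kpow_Pn_diff\<close> says nothing.\<close>

lemma kpow_Pn_le:
  assumes f: "f \<in> borel_measurable borel"
  shows "(\<integral>\<^sup>+y. f y \<partial>kpow Pn t x) \<le> ennreal ((1 + C * \<theta>) ^ t) * (\<integral>\<^sup>+y. f y \<partial>kpow P t x)"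
proof (induction t arbitrary: x)
  case 0
  then show ?case by simp
next
  case (Suc t)
  have mt: "(\<lambda>z. \<integral>\<^sup>+y. f y \<partial>kpow P t z) \<in> borel_measurable borel"
    by (intro markov_nn_integral_measurable markov_kernel_kpow kernel f)
  have "(\<integral>\<^sup>+y. f y \<partial>kpow Pn (Suc t) x) = (\<integral>\<^sup>+z. \<integral>\<^sup>+y. f y \<partial>kpow Pn t z \<partial>Pn x)"
    using nn_integral_bind_markov[OF markov_kernel_kpow[OF markov_Pn, of t] Pn_D(3) f] by simp
  also have "\<dots> \<le> (\<integral>\<^sup>+z. ennreal ((1 + C * \<theta>) ^ t) * (\<integral>\<^sup>+y. f y \<partial>kpow P t z) \<partial>Pn x)"
    by (intro nn_integral_mono Suc.IH)
  also have "\<dots> = ennreal ((1 + C * \<theta>) ^ t) * (\<integral>\<^sup>+z. \<integral>\<^sup>+y. f y \<partial>kpow P t z \<partial>Pn x)"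
    by (rule nn_integral_cmult) (use mt in \<open>simp add: measurable_cong_sets[OF Pn_D(3) refl]\<close>)
  also have "\<dots> \<le> ennreal ((1 + C * \<theta>) ^ t) * (ennreal (1 + C * \<theta>) * (\<integral>\<^sup>+z. \<integral>\<^sup>+y. f y \<partial>kpow P t z \<partial>P x))"
    by (intro mult_left_mono nn_integral_Pn_le mt) auto
  also have "(\<integral>\<^sup>+z. \<integral>\<^sup>+y. f y \<partial>kpow P t z \<partial>P x) = (\<integral>\<^sup>+y. f y \<partial>kpow P (Suc t) x)"
    using nn_integral_bind_markov[OF markov_kernel_kpow[OF kernel, of t] P_D(3) f] by simp
  also have "ennreal ((1 + C * \<theta>) ^ t) * (ennreal (1 + C * \<theta>) * (\<integral>\<^sup>+y. f y \<partial>kpow P (Suc t) x))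
      = ennreal ((1 + C * \<theta>) ^ Suc t) * (\<integral>\<^sup>+y. f y \<partial>kpow P (Suc t) x)"
    using C_theta(1) by (simp add: ennreal_mult mult.assoc mult.commute mult.left_commute del: kpow.simps)
  finally show ?case .
qed

text \<open>Steps are exchanged one at a time: the first one costs its \<open>h\<close> term, at
  most \<open>C * \<theta>\<close>, and averaging the remaining error over an unperturbed step does
  not enlarge it.\<close>

lemma kpow_Pn_diff:
  fixes q :: "'x \<Rightarrow> real"
  assumes q: "q \<in> borel_measurable borel" "\<And>x. \<bar>q x\<bar> \<le> 1"
  shows "\<bar>(\<integral>y. q y \<partial>kpow Pn t x) - (\<integral>y. q y \<partial>kpow P t x)\<bar> \<le> t * (C * \<theta>)"
proof (induction t arbitrary: x)
  case 0
  then show ?case by simp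
next
  case (Suc t)
  define r where "r z = (\<integral>y. q y \<partial>kpow Pn t z)" for z
  define r' where "r' z = (\<integral>y. q y \<partial>kpow P t z)" for z
  have r: "r \<in> borel_measurable borel" "\<And>x. \<bar>r x\<bar> \<le> 1"
    unfolding r_def using norm_integral_le_prob[OF kpow_n_D(2), where q=q and B=1] q
    by (auto intro!: markov_integral_measurable markov_kernel_kpow markov_Pn)
  have r': "r' \<in> borel_measurable borel" "\<And>x. \<bar>r' x\<bar> \<le> 1"
    unfolding r'_def using norm_integral_le_prob[OF kpow_D(2), where q=q and B=1] q
    by (auto intro!: markov_integral_measurable markov_kernel_kpow kernel)
  have int: "integrable (P x) r" "integrable (P x) r'"
    using r r' by (intro integrable_bounded_borel[OF P_D(2,3), where B=1]; simp)+
  have e1: "(\<integral>y. q y \<partial>kpow Pn (Suc t) x) = (\<integral>z. r z \<partial>Pn x)"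
    using kpow_integral_add[OF markov_Pn q, of 1 t x] kpow_1[OF markov_Pn] by (simp add: r_def)
  have e2: "(\<integral>y. q y \<partial>kpow P (Suc t) x) = (\<integral>z. r' z \<partial>P x)"
    using kpow_integral_add[OF kernel q, of 1 t x] kpow_1[OF kernel] by (simp add: r'_def)
  have e3: "(\<integral>z. r z \<partial>Pn x) = (\<integral>z. r z \<partial>P x) + \<theta> * (\<integral>z. h x z * r z \<partial>P x)"
    using integral_Pn[OF int(1)] by simp
  have "\<bar>h x z * r z\<bar> \<le> C * 1" for z unfolding abs_mult
    by (intro mult_mono h_le r C_nonneg) auto
  then have "\<bar>\<integral>z. h x z * r z \<partial>P x\<bar> \<le> C"
    using norm_integral_le_prob[OF P_D(2), where q="\<lambda>z. h x z * r z" and B=C] by simp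
  then have "\<bar>\<theta> * (\<integral>z. h x z * r z \<partial>P x)\<bar> \<le> \<theta> * C" unfolding abs_mult
    using theta_nonneg by (intro mult_mono) auto
  moreover have "\<bar>(\<integral>z. r z \<partial>P x) - (\<integral>z. r' z \<partial>P x)\<bar> \<le> t * (C * \<theta>)"
  proof -
    have "\<bar>\<integral>z. r z - r' z \<partial>P x\<bar> \<le> t * (C * \<theta>)"
      using norm_integral_le_prob[OF P_D(2), where q="\<lambda>z. r z - r' z"] Suc.IH by (simp add: r_def r'_def)
    then show ?thesis using int by simp
  qed
  ultimately show ?case unfolding e1 e2 e3 by (simp add: distrib_right mult.commute)
qed

lemma Pn_contraction:
  assumes A[measurable]: "A \<in> sets borel"
  shows "\<bar>measure (kpow Pn m x) A - measure (kpow Pn m y) A\<bar> \<le> 1/2"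
proof -
  have d: "\<bar>measure (kpow Pn m x) A - measure (kpow P m x) A\<bar> \<le> 1/8" for x
  proof -
    have "\<bar>(\<integral>z. indicator A z \<partial>kpow Pn m x) - (\<integral>z. indicator A z \<partial>kpow P m x)\<bar> \<le> m * (C * \<theta>)"
      by (rule kpow_Pn_diff) (auto simp: indicator_def)
    then show ?thesis using C_theta(2) by (simp add: kpow_D kpow_n_D)
  qed
  show ?thesis using d[of x] d[of y] mix[OF A, of m x] mix[OF A, of m y] rho_m(2) by linarith
qed

text \<open>Discharges the definite description in \<open>pert_stat\<close>; without uniqueness
  nothing could be said about \<open>\<pi>n\<close>.\<close>

lemma stationary_pin: "stationary Pn \<pi>n"
proof -
  obtain \<nu> where \<nu>: "stationary Pn \<nu>"
    using stationary_exists_of_contraction[OF markov_Pn Pn_contraction] by auto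
  have "\<And>\<nu>'. stationary Pn \<nu>' \<Longrightarrow> \<nu>' = \<nu>"
    using stationary_unique_of_contraction[OF markov_Pn Pn_contraction] \<nu> by blast
  with \<nu> show ?thesis unfolding pert_stat_def by (rule theI)
qed

lemma pin_prob: "prob_space \<pi>n" and pin_sets: "sets \<pi>n = sets borel"
  using stationary_pin by (auto simp: stationary_def)

section \<open>The perturbed stationary law compared with the original one\<close>

lemma one_plus_power_le: "(1 + C * \<theta>) ^ (m * k) \<le> 2 ^ k"
proof -
  have "(1 + C * \<theta>) ^ m \<le> exp (C * \<theta>) ^ m"
    using C_theta(1) by (intro power_mono exp_ge_add_one_self) auto
  also have "\<dots> = exp (m * (C * \<theta>))" by (rule exp_of_nat_mult[symmetric])
  also have "\<dots> \<le> exp (1/8)" using C_theta(2) by simp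
  also have "\<dots> \<le> 1 + 2 * (1/8)" using real_exp_bound_lemma[of "1/8"] by simp
  also have "\<dots> \<le> (2::real)" by simp
  finally have "((1 + C * \<theta>) ^ m) ^ k \<le> 2 ^ k" using C_theta(1) by (intro power_mono) auto
  then show ?thesis by (simp add: power_mult)
qed

text \<open>\<open>\<pi>n\<close> is replaced by its own evolution over \<open>m * k\<close> steps.
  The factor 2^k bounds the density of that evolution against \<open>kpow P\<close>, and the
  unperturbed evolution is within \<open>\<kappa> * (1/8) ^ k\<close> of \<pi>. The parameter
  \<open>k\<close> is free: it tends to infinity for null sets and follows the tail level for
  moments.\<close>

lemma pin_measure_le:
  assumes A[measurable]: "A \<in> sets borel"
  shows "measure \<pi>n A \<le> 2 ^ k * (measure \<pi> A + \<kappa> * (1/8) ^ k)"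
proof -
  interpret pn: prob_space \<pi>n by (rule pin_prob)
  let ?t = "m * k"
  have "emeasure \<pi>n A = emeasure (\<pi>n \<bind> kpow Pn ?t) A" by (simp add: stationary_bind_kpow[OF markov_Pn stationary_pin])
  also have "\<dots> = (\<integral>\<^sup>+x. \<integral>\<^sup>+y. indicator A y \<partial>kpow Pn ?t x \<partial>\<pi>n)"
    using nn_integral_bind_markov[OF markov_kernel_kpow[OF markov_Pn, of ?t] pin_sets, of "indicator A"]
      prob_space_bind_markov(2)[OF markov_kernel_kpow[OF markov_Pn, of ?t] pin_prob pin_sets]
    by simp
  also have "\<dots> \<le> (\<integral>\<^sup>+x. ennreal (2 ^ k * (measure \<pi> A + \<kappa> * (1/8) ^ k)) \<partial>\<pi>n)"
  proof (rule nn_integral_mono)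
    fix x
    have "(\<integral>\<^sup>+y. indicator A y \<partial>kpow Pn ?t x) \<le> ennreal ((1 + C * \<theta>) ^ ?t) * (\<integral>\<^sup>+y. indicator A y \<partial>kpow P ?t x)"
      by (rule kpow_Pn_le) simp
    also have "(\<integral>\<^sup>+y. indicator A y \<partial>kpow P ?t x) = ennreal (measure (kpow P ?t x) A)"
      by (simp add: kpow_D finite_measure.emeasure_eq_measure prob_space.finite_measure)
    also have "\<dots> \<le> ennreal (measure \<pi> A + \<kappa> * (1/8) ^ k)"
    proof (rule ennreal_leI)
      have "\<rho> ^ ?t \<le> (1/8) ^ k" using rho_m(1) rho by (simp add: power_mult power_mono)
      then have "\<kappa> * \<rho> ^ ?t \<le> \<kappa> * (1/8) ^ k" using kappa_nonneg by (intro mult_left_mono)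
      then show "measure (kpow P ?t x) A \<le> measure \<pi> A + \<kappa> * (1/8) ^ k" using mix[OF A, of ?t x] by linarith
    qed
    also have "ennreal ((1 + C * \<theta>) ^ ?t) * ennreal (measure \<pi> A + \<kappa> * (1/8) ^ k) \<le>
        ennreal (2 ^ k) * ennreal (measure \<pi> A + \<kappa> * (1/8) ^ k)"
      by (intro mult_right_mono ennreal_leI one_plus_power_le) auto
    finally show "(\<integral>\<^sup>+y. indicator A y \<partial>kpow Pn ?t x) \<le> ennreal (2 ^ k * (measure \<pi> A + \<kappa> * (1/8) ^ k))"
      using kappa_nonneg by (simp add: ennreal_mult mult_left_mono)
  qed
  also have "\<dots> = ennreal (2 ^ k * (measure \<pi> A + \<kappa> * (1/8) ^ k))" by (simp add: pn.emeasure_space_1)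
  finally show ?thesis using kappa_nonneg by (simp add: pn.emeasure_eq_measure)
qed

text \<open>On a \<pi>-null set the previous bound reads \<kappa> * (2/8)^k for every
  \<open>k\<close>. This absolute continuity lets almost sure integrability of \<open>H xs\<close>
  under \<open>P \<xi>\<close> pass from \<pi> to \<open>\<pi>n\<close>.\<close>

lemma pin_AE:
  assumes "AE x in \<pi>. Q x"
  shows "AE x in \<pi>n. Q x"
proof -
  obtain N' where N': "\<And>x. x \<in> space \<pi> - N' \<Longrightarrow> Q x" "N' \<in> null_sets \<pi>"
    using AE_E3[OF assms] by blast
  then obtain N where N: "{x. \<not> Q x} \<subseteq> N" "N \<in> sets borel" "emeasure \<pi> N = 0"
    unfolding null_sets_def pi_space pi_sets by blast
  have "measure \<pi> N = 0" using N by (simp add: measure_def)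
  have b: "measure \<pi>n N \<le> \<kappa> * (1/4) ^ k" for k
  proof -
    have "measure \<pi>n N \<le> 2 ^ k * (\<kappa> * (1/8) ^ k)" using pin_measure_le[OF N(2), of k] \<open>measure \<pi> N = 0\<close> by simp
    also have "\<dots> = \<kappa> * (2 * (1/8)) ^ k" by (simp only: power_mult_distrib) simp
    finally show ?thesis by simp
  qed
  have "(\<lambda>k. \<kappa> * (1/4) ^ k) \<longlonglongrightarrow> \<kappa> * 0" by (intro tendsto_mult_left LIMSEQ_realpow_zero) auto
  then have "measure \<pi>n N \<le> \<kappa> * 0" by (rule LIMSEQ_le_const) (use b in blast)
  then have "measure \<pi>n N = 0" by (simp add: measure_le_0_iff)
  then have "emeasure \<pi>n N = 0" by (simp add: finite_measure.emeasure_eq_measure[OF prob_space.finite_measure[OF pin_prob]])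
  then show ?thesis by (intro AE_I[of _ _ N]) (use N pin_sets in auto)
qed

text \<open>The tails \<open>\<pi>n {f > 2\<^sup>k}\<close> are compared with those of \<open>\<pi>\<close> after \<open>m * k\<close> steps, at the cost of a factor \<open>2\<^sup>k\<close>;
  this is where \<open>p > 2\<close> is needed.\<close>

lemma pin_moment_finite:
  fixes f :: "'x \<Rightarrow> real" and p :: real
  assumes f[measurable]: "f \<in> borel_measurable borel" and f0: "\<And>x. 0 \<le> f x"
    and p: "2 < p" and fp: "(\<integral>\<^sup>+x. ennreal (f x powr p) \<partial>\<pi>) < \<infinity>"
  shows "(\<integral>\<^sup>+x. ennreal (f x) \<partial>\<pi>n) < \<infinity>"
proof -
  interpret pn: prob_space \<pi>n by (rule pin_prob)
  interpret p0: prob_space \<pi> by (rule pi_prob)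
  define b where "b = enn2real (\<integral>\<^sup>+x. ennreal (f x powr p) \<partial>\<pi>)"
  have b: "(\<integral>\<^sup>+x. ennreal (f x powr p) \<partial>\<pi>) = ennreal b" "0 \<le> b" using fp by (auto simp: b_def)
  define A where "A k = {x. 2 ^ k < f x}" for k :: nat
  have A[measurable]: "A k \<in> sets borel" for k unfolding A_def by measurable
  \<comment> \<open>The level 2^k, the density factor 2^k and Markov's tail bound 2^(-p k) combine
    to \<open>s ^ k\<close> with s = 4 * 2^-p, and this is below 1 exactly when p > 2.\<close>
  define s where "s = (1/2) powr (p - 2)"
  have s: "0 < s" "s < 1" unfolding s_def using p powr_less_mono2_neg[of "2 - p" 1 2]
    by (auto simp: powr_minus_divide[symmetric] powr_divide)
  have piA: "measure \<pi> (A k) \<le> b * (1/2 powr p) ^ k" for k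
  proof -
    have mp: "(2 ^ k) powr p = (2 powr p) ^ k" by (simp add: powr_realpow[symmetric] powr_powr mult.commute)
    have "ennreal ((2 powr p) ^ k) * emeasure \<pi> (A k) = (\<integral>\<^sup>+x. ennreal ((2 powr p) ^ k) * indicator (A k) x \<partial>\<pi>)"
      by (simp add: pi_sets nn_integral_cmult_indicator)
    also have "\<dots> \<le> (\<integral>\<^sup>+x. ennreal (f x powr p) \<partial>\<pi>)"
    proof (rule nn_integral_mono)
      fix x
      have "2 ^ k < f x \<Longrightarrow> (2 powr p) ^ k \<le> f x powr p"
        unfolding mp[symmetric] using p by (intro powr_mono2) auto
      then show "ennreal ((2 powr p) ^ k) * indicator (A k) x \<le> ennreal (f x powr p)"
        by (auto simp: A_def indicator_def intro!: ennreal_leI)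
    qed
    finally have "ennreal ((2 powr p) ^ k * measure \<pi> (A k)) \<le> ennreal b"
      using b by (simp add: p0.emeasure_eq_measure ennreal_mult)
    then have "(2 powr p) ^ k * measure \<pi> (A k) \<le> b" using b by simp
    then show ?thesis by (simp add: field_simps power_divide)
  qed
  have tm: "2 ^ k * measure \<pi>n (A k) \<le> b * s ^ k + \<kappa> * (1/2) ^ k" for k
  proof -
    have "2 ^ k * measure \<pi>n (A k) \<le> 2 ^ k * (2 ^ k * (measure \<pi> (A k) + \<kappa> * (1/8) ^ k))"
      by (intro mult_left_mono pin_measure_le) auto
    also have "\<dots> \<le> 2 ^ k * (2 ^ k * (b * (1/2 powr p) ^ k + \<kappa> * (1/8) ^ k))"
      by (intro mult_left_mono add_mono piA order_refl) (auto simp: kappa_nonneg)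
    also have "\<dots> = b * (2 * 2 * (1/2 powr p)) ^ k + \<kappa> * (2 * 2 * (1/8)) ^ k"
      by (simp only: power_mult_distrib) (simp add: algebra_simps)
    also have "2 * 2 * (1/2 powr p) = s"
      by (simp add: s_def powr_divide powr_diff)
    finally show ?thesis by simp
  qed
  have "summable (\<lambda>k. b * s ^ k + \<kappa> * (1/2) ^ k)"
    using s by (intro summable_add summable_mult summable_geometric) auto
  then have sm: "summable (\<lambda>k. 2 ^ k * measure \<pi>n (A k))"
    by (rule summable_comparison_test'[of _ 0]) (use tm in \<open>auto simp: abs_mult\<close>)
  \<comment> \<open>Dyadic layers: if f x lies between 2^j and 2^(j+1), then the layers 0, ..., j
    are all active and 1 + (2^0 + ... + 2^j) = 2^(j+1).\<close>
  have pt: "ennreal (f x) \<le> 1 + (\<Sum>k. ennreal (2 ^ k) * indicator (A k) x)" for x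
  proof -
    have fin: "ennreal (f x) \<le> 1 + (\<Sum>k<j. ennreal (2 ^ k) * indicator (A k) x)" if "f x \<le> 2 ^ j" for j
      using that
    proof (induction j)
      case 0
      then show ?case by (simp add: ennreal_le_1)
    next
      case (Suc j)
      show ?case
      proof (cases "f x \<le> 2 ^ j")
        case True
        then show ?thesis using Suc.IH
            by (intro order_trans[OF Suc.IH[OF True]]) (simp add: add_left_mono)
      next
        case False
        then have "(\<Sum>k<Suc j. ennreal (2 ^ k) * indicator (A k) x) = (\<Sum>k<Suc j. ennreal (2 ^ k))"
        proof (intro sum.cong refl)
          fix k assume "k \<in> {..<Suc j}"
          then have "(2::real) ^ k \<le> 2 ^ j" by (intro power_increasing) auto
          then have "x \<in> A k" using False unfolding A_def mem_Collect_eq by linarith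
          then show "ennreal (2 ^ k) * indicator (A k) x = ennreal (2 ^ k)" by simp
        qed
        also have "\<dots> = ennreal (\<Sum>k<Suc j. 2 ^ k)" by (rule sum_ennreal) auto
        also have "1 + \<dots> = ennreal (1 + (\<Sum>k<Suc j. 2 ^ k))" by (subst ennreal_plus) (auto intro!: sum_nonneg add_nonneg_nonneg)
        also have "1 + (\<Sum>k<Suc j. 2 ^ k) = (2::real) ^ Suc j"
          by (subst geometric_sum) auto
        finally show ?thesis using Suc.prems by (simp add: ennreal_leI)
      qed
    qed
    obtain j where "f x \<le> 2 ^ j" using real_arch_pow[of 2 "f x"] by (auto intro: less_imp_le)
    from fin[OF this] show ?thesis
      by (rule order_trans) (intro add_left_mono sum_le_suminf, auto)
  qed
  have "(\<integral>\<^sup>+x. ennreal (f x) \<partial>\<pi>n) \<le> (\<integral>\<^sup>+x. 1 + (\<Sum>k. ennreal (2 ^ k) * indicator (A k) x) \<partial>\<pi>n)"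
    by (intro nn_integral_mono pt)
  also have "\<dots> = 1 + (\<integral>\<^sup>+x. (\<Sum>k. ennreal (2 ^ k) * indicator (A k) x) \<partial>\<pi>n)"
    by (subst nn_integral_add) (auto simp: pn.emeasure_space_1 measurable_cong_sets[OF pin_sets refl])
  also have "(\<integral>\<^sup>+x. (\<Sum>k. ennreal (2 ^ k) * indicator (A k) x) \<partial>\<pi>n) = (\<Sum>k. ennreal (2 ^ k * measure \<pi>n (A k)))"
    by (subst nn_integral_suminf)
      (auto simp: measurable_cong_sets[OF pin_sets refl] nn_integral_cmult_indicator pin_sets pn.emeasure_eq_measure ennreal_mult)
  also have "\<dots> = ennreal (\<Sum>k. 2 ^ k * measure \<pi>n (A k))"
    by (rule suminf_ennreal_eq) (auto intro: summable_sums sm)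
  also have "1 + \<dots> < \<infinity>" by simp
  finally show ?thesis .
qed

text \<open>Stationarity under the perturbed kernel, with one step expanded in \<theta>. The inner
  integrals may take default values where \<open>q\<close> is not \<open>P x\<close>-integrable, but
  only on a null set of \<open>\<pi>n\<close>.\<close>

lemma
  fixes q :: "'x \<Rightarrow> 'c::{banach, second_countable_topology}"
  assumes q: "integrable \<pi>n q"
  shows integrable_pin_kernel: "integrable \<pi>n (\<lambda>x. (\<integral>y. q y \<partial>P x) + \<theta> *\<^sub>R (\<integral>y. h x y *\<^sub>R q y \<partial>P x))"
    and integral_pin: "(\<integral>x. q x \<partial>\<pi>n) = (\<integral>x. (\<integral>y. q y \<partial>P x) + \<theta> *\<^sub>R (\<integral>y. h x y *\<^sub>R q y \<partial>P x) \<partial>\<pi>n)"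
proof -
  have q': "integrable (\<pi>n \<bind> Pn) q" using q by (simp add: stationary_bind[OF markov_Pn stationary_pin])
  have qm[measurable]: "q \<in> borel_measurable borel" using q borel_measurable_integrable[OF q]
    by (simp add: measurable_cong_sets[OF pin_sets refl])
  have m1: "(\<lambda>x. \<integral>y. q y \<partial>Pn x) \<in> borel_measurable \<pi>n"
    using markov_integral_measurable[OF markov_Pn qm] by (simp add: measurable_cong_sets[OF pin_sets refl])
  note h_measurable[measurable]
  have m2: "(\<lambda>x. (\<integral>y. q y \<partial>P x) + \<theta> *\<^sub>R (\<integral>y. h x y *\<^sub>R q y \<partial>P x)) \<in> borel_measurable \<pi>n"
    unfolding measurable_cong_sets[OF pin_sets refl]
    by (intro borel_measurable_add borel_measurable_scaleR borel_measurable_const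
        integral_measurable_kernel[OF P_D(1)]; measurable)
  have ae: "AE x in \<pi>n. integrable (P x) q"
    using AE_integrable_bind_markov[OF markov_Pn pin_prob pin_sets q'] by (simp add: integrable_Pn_iff)
  have ae': "AE x in \<pi>n. (\<integral>y. q y \<partial>Pn x) = (\<integral>y. q y \<partial>P x) + \<theta> *\<^sub>R (\<integral>y. h x y *\<^sub>R q y \<partial>P x)"
    using ae by eventually_elim (rule integral_Pn)
  show "integrable \<pi>n (\<lambda>x. (\<integral>y. q y \<partial>P x) + \<theta> *\<^sub>R (\<integral>y. h x y *\<^sub>R q y \<partial>P x))"
    using integrable_bind_markov[OF markov_Pn pin_prob pin_sets q']
    by (rule Bochner_Integration.integrable_cong_AE_imp[OF _ m2]) (use ae' in eventually_elim, simp)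
  show "(\<integral>x. q x \<partial>\<pi>n) = (\<integral>x. (\<integral>y. q y \<partial>P x) + \<theta> *\<^sub>R (\<integral>y. h x y *\<^sub>R q y \<partial>P x) \<partial>\<pi>n)"
    using integral_bind_markov[OF markov_Pn pin_prob pin_sets q'] integral_cong_AE[OF m1 m2 ae']
    by (simp add: stationary_bind[OF markov_Pn stationary_pin])
qed

lemma integrable_pin_bounded:
  fixes q :: "'x \<Rightarrow> 'c::{banach, second_countable_topology}"
  shows "q \<in> borel_measurable borel \<Longrightarrow> (\<And>x. norm (q x) \<le> B) \<Longrightarrow> integrable \<pi>n q"
  by (rule integrable_bounded_borel[OF pin_prob pin_sets])

lemma kernel_h_integral:
  fixes q :: "'x \<Rightarrow> real"
  assumes q: "q \<in> borel_measurable borel" "\<And>x. \<bar>q x\<bar> \<le> B"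
  shows "(\<lambda>x. \<integral>y. h x y * q y \<partial>P x) \<in> borel_measurable borel" "\<bar>\<integral>y. h x y * q y \<partial>P x\<bar> \<le> C * B"
proof -
  note h_measurable[measurable] q(1)[measurable]
  show "(\<lambda>x. \<integral>y. h x y * q y \<partial>P x) \<in> borel_measurable borel"
    by (intro integral_measurable_kernel[OF P_D(1)]) measurable
  have "\<bar>h x y * q y\<bar> \<le> C * B" for y unfolding abs_mult by (intro mult_mono h_le q C_nonneg) auto
  then show "\<bar>\<integral>y. h x y * q y \<partial>P x\<bar> \<le> C * B"
    using norm_integral_le_prob[OF P_D(2), where q="\<lambda>y. h x y * q y"] by simp
qed

text \<open>Write q = R - P R. Under \<open>\<pi>n\<close> the integral of R equals that of one
  perturbed step applied to R, so P R cancels and only the \<open>h\<close> part remains.\<close>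

lemma pin_poisson:
  fixes q :: "'x \<Rightarrow> real"
  assumes q: "q \<in> borel_measurable borel" "\<And>x. \<bar>q x\<bar> \<le> B" and q0: "(\<integral>x. q x \<partial>\<pi>) = 0"
  shows "(\<integral>x. q x \<partial>\<pi>n) = \<theta> * (\<integral>x. \<integral>y. h x y * poisson_sol q y \<partial>P x \<partial>\<pi>n)"
proof -
  let ?R = "poisson_sol q"
  let ?B = "2 * B * \<kappa> / (1 - \<rho>)"
  have R: "?R \<in> borel_measurable borel" "\<bar>?R x\<bar> \<le> ?B" for x
    using poisson_sol_measurable[OF q q0] poisson_sol_le[OF q q0] by auto
  have iR: "integrable \<pi>n ?R" using R by (intro integrable_pin_bounded[where B="?B"]) auto
  have PR: "(\<lambda>x. \<integral>y. ?R y \<partial>P x) \<in> borel_measurable borel" "\<bar>\<integral>y. ?R y \<partial>P x\<bar> \<le> ?B" for x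
    using norm_integral_le_prob[OF P_D(2), where q="?R" and B="?B"] R
    by (auto intro!: markov_integral_measurable kernel)
  have i1: "integrable \<pi>n (\<lambda>x. \<integral>y. ?R y \<partial>P x)" using PR by (intro integrable_pin_bounded[where B="?B"]) auto
  have i2: "integrable \<pi>n (\<lambda>x. \<integral>y. h x y * ?R y \<partial>P x)"
    using kernel_h_integral[OF R] by (intro integrable_pin_bounded[where B="C * ?B"]) auto
  have "(\<integral>x. q x \<partial>\<pi>n) = (\<integral>x. ?R x - (\<integral>y. ?R y \<partial>P x) \<partial>\<pi>n)"
  proof (rule Bochner_Integration.integral_cong[OF refl])
    show "q x = ?R x - (\<integral>y. ?R y \<partial>P x)" for x using poisson_eq[OF q q0, of x] by linarith
  qed
  also have "\<dots> = (\<integral>x. ?R x \<partial>\<pi>n) - (\<integral>x. \<integral>y. ?R y \<partial>P x \<partial>\<pi>n)"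
    by (intro Bochner_Integration.integral_diff iR i1)
  also have "(\<integral>x. ?R x \<partial>\<pi>n) = (\<integral>x. \<integral>y. ?R y \<partial>P x \<partial>\<pi>n) + \<theta> * (\<integral>x. \<integral>y. h x y * ?R y \<partial>P x \<partial>\<pi>n)"
    using integral_pin[OF iR] i1 i2 by simp
  finally show ?thesis by simp
qed

text \<open>Centring \<open>q\<close> doubles its bound, which turns the constant
  \<open>2 * B\<close> of \<open>poisson_sol_le\<close> into \<open>4 * B\<close>.\<close>

lemma pin_close:
  fixes q :: "'x \<Rightarrow> real"
  assumes q: "q \<in> borel_measurable borel" "\<And>x. \<bar>q x\<bar> \<le> B"
  shows "\<bar>(\<integral>x. q x \<partial>\<pi>n) - (\<integral>x. q x \<partial>\<pi>)\<bar> \<le> \<theta> * (C * (4 * B * \<kappa> / (1 - \<rho>)))"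
proof -
  interpret pn: prob_space \<pi>n by (rule pin_prob)
  interpret p0: prob_space \<pi> by (rule pi_prob)
  define c where "c = (\<integral>x. q x \<partial>\<pi>)"
  define r where "r x = q x - c" for x
  have cB: "\<bar>c\<bar> \<le> B" using norm_integral_le_prob[OF pi_prob, where q=q and B=B] q by (simp add: c_def)
  have r: "r \<in> borel_measurable borel" using q(1) by (simp add: r_def[abs_def])
  have rB: "\<bar>r x\<bar> \<le> 2 * B" for x using q(2)[of x] cB by (simp add: r_def)
  have ii: "integrable \<pi> q" "integrable \<pi>n q"
    using integrable_pi_bounded[of q B] integrable_pin_bounded[of q B] q by auto
  have r0: "(\<integral>x. r x \<partial>\<pi>) = 0" using ii by (simp add: r_def c_def p0.prob_space)
  have "(\<integral>x. q x \<partial>\<pi>n) - c = (\<integral>x. r x \<partial>\<pi>n)" using ii by (simp add: r_def pn.prob_space)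
  also have "\<dots> = \<theta> * (\<integral>x. \<integral>y. h x y * poisson_sol r y \<partial>P x \<partial>\<pi>n)" by (rule pin_poisson[OF r rB r0])
  finally have "\<bar>(\<integral>x. q x \<partial>\<pi>n) - c\<bar> = \<theta> * \<bar>\<integral>x. \<integral>y. h x y * poisson_sol r y \<partial>P x \<partial>\<pi>n\<bar>"
    using theta_nonneg by (simp add: abs_mult)
  also have "\<dots> \<le> \<theta> * (C * (2 * (2 * B) * \<kappa> / (1 - \<rho>)))"
  proof (intro mult_left_mono)
    have "\<bar>\<integral>y. h x y * poisson_sol r y \<partial>P x\<bar> \<le> C * (2 * (2 * B) * \<kappa> / (1 - \<rho>))" for x
      by (rule kernel_h_integral(2)[OF poisson_sol_measurable[OF r rB r0] poisson_sol_le[OF r rB r0]])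
    then show "\<bar>\<integral>x. \<integral>y. h x y * poisson_sol r y \<partial>P x \<partial>\<pi>n\<bar> \<le> C * (2 * (2 * B) * \<kappa> / (1 - \<rho>))"
      using norm_integral_le_prob[OF pin_prob, where q="\<lambda>x. \<integral>y. h x y * poisson_sol r y \<partial>P x"] by simp
  qed (rule theta_nonneg)
  finally show ?thesis by (simp add: c_def)
qed

end

section \<open>Roots of the perturbed mean field\<close>

context
  fixes nrm :: "real^'d \<Rightarrow> real"
  assumes nrm: "is_norm nrm"
begin

lemma is_normD: "0 \<le> nrm x" "nrm x = 0 \<longleftrightarrow> x = 0" "nrm (r *\<^sub>R x) = \<bar>r\<bar> * nrm x" "nrm (x + y) \<le> nrm x + nrm y"
  using nrm by (auto simp: is_norm_def)

lemma is_norm_minus: "nrm (- x) = nrm x"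
  using is_normD(3)[of "-1" x] by simp

lemma is_norm_triangle: "nrm x \<le> nrm (x - y) + nrm y"
  using is_normD(4)[of "x - y" y] by simp

lemma is_norm_sum: "nrm (\<Sum>i\<in>A. f i) \<le> (\<Sum>i\<in>A. nrm (f i))"
proof (induction A rule: infinite_finite_induct)
  case (insert x F)
  then show ?case using is_normD(4)[of "f x" "sum f F"] by simp
qed (use is_normD(2)[of 0] in auto)

lemma is_norm_le_norm: "\<exists>a>0. \<forall>x. nrm x \<le> a * norm x"
proof (intro exI conjI allI)
  let ?a = "1 + (\<Sum>i\<in>UNIV. nrm (axis i 1))"
  have s: "0 \<le> (\<Sum>i\<in>UNIV. nrm (axis i 1))" by (intro sum_nonneg is_normD)
  then show "0 < ?a" by simp
  fix x :: "real^'d"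
  have "x = (\<Sum>i\<in>UNIV. (x $ i) *\<^sub>R axis i 1)" using basis_expansion[of x] by (simp add: scalar_mult_eq_scaleR)
  then have "nrm x \<le> (\<Sum>i\<in>UNIV. nrm ((x $ i) *\<^sub>R axis i 1))"
    using is_norm_sum[of "\<lambda>i. (x $ i) *\<^sub>R axis i 1" UNIV] by simp
  also have "\<dots> \<le> (\<Sum>i\<in>UNIV. norm x * nrm (axis i 1))"
    unfolding is_normD(3) by (intro sum_mono mult_right_mono component_le_norm_cart is_normD)
  also have "\<dots> = norm x * (\<Sum>i\<in>UNIV. nrm (axis i 1))" by (simp add: sum_distrib_left)
  also have "\<dots> \<le> ?a * norm x" using s by (simp add: algebra_simps)
  finally show "nrm x \<le> ?a * norm x" .
qed

lemma is_norm_continuous: "continuous_on S nrm"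
proof -
  obtain a where a: "a > 0" "\<And>x. nrm x \<le> a * norm x" using is_norm_le_norm by auto
  have "a-lipschitz_on S nrm"
  proof (rule lipschitz_onI)
    fix x y
    have "\<bar>nrm x - nrm y\<bar> \<le> nrm (x - y)"
      using is_norm_triangle[of x y] is_norm_triangle[of y x] is_norm_minus[of "x - y"] by simp
    also have "\<dots> \<le> a * norm (x - y)" by (rule a)
    finally show "dist (nrm x) (nrm y) \<le> a * dist x y" by (simp add: dist_norm)
  qed (use a in simp)
  then show ?thesis by (rule lipschitz_on_continuous_on)
qed

lemma norm_le_is_norm: "\<exists>b>0. \<forall>x. norm x \<le> b * nrm x"
proof -
  have "sphere 0 1 \<noteq> ({} :: (real^'d) set)" using norm_axis_1[of undefined] by (metis mem_sphere_0 empty_iff)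
  then obtain z :: "real^'d" where z: "norm z = 1" "\<And>y. norm y = 1 \<Longrightarrow> nrm z \<le> nrm y"
    using continuous_attains_inf[OF compact_sphere[of 0 1] _ is_norm_continuous] by auto
  have "z \<noteq> 0" using z(1) by auto
  then have pz: "0 < nrm z" using is_normD(1,2)[of z] by linarith
  have "norm x \<le> (1 / nrm z) * nrm x" for x
  proof (cases "x = 0")
    case False
    have "nrm z \<le> nrm ((1 / norm x) *\<^sub>R x)" using False by (intro z) simp
    then have "nrm z * norm x \<le> nrm x" using False by (simp add: is_normD(3) field_simps)
    then show ?thesis using pz by (simp add: field_simps)
  qed (use is_normD(2)[of 0] in simp)
  with pz show ?thesis by (intro exI[of _ "1 / nrm z"]) auto
qed

text \<open>\<open>nrm\<close> is not the norm of the type, so the bound comes from convexity: its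
  ball is closed and convex, and a mean outside would be strictly separated from almost all
  values.\<close>

lemma is_norm_integral_le:
  assumes M: "prob_space M" and f: "integrable M f" and B: "AE x in M. nrm (f x) \<le> B"
  shows "nrm (\<integral>x. f x \<partial>M) \<le> B"
proof (rule ccontr)
  interpret prob_space M by fact
  define S where "S = {z. nrm z \<le> B}"
  assume "\<not> ?thesis"
  then have nS: "(\<integral>x. f x \<partial>M) \<notin> S" by (simp add: S_def)
  have conv: "convex S"
  proof (rule convexI)
    fix x y and u v :: real assume *: "x \<in> S" "y \<in> S" "0 \<le> u" "0 \<le> v" "u + v = 1"
    have "nrm (u *\<^sub>R x + v *\<^sub>R y) \<le> u * nrm x + v * nrm y"
      using is_normD(4)[of "u *\<^sub>R x" "v *\<^sub>R y"] * by (simp add: is_normD(3))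
    also have "\<dots> \<le> u * B + v * B" using * by (intro add_mono mult_left_mono) (auto simp: S_def)
    also have "\<dots> = B" using * by (metis distrib_right mult_1)
    finally show "u *\<^sub>R x + v *\<^sub>R y \<in> S" by (simp add: S_def)
  qed
  have clo: "closed S" unfolding S_def
    by (intro closed_Collect_le is_norm_continuous continuous_intros)
  obtain a b where ab: "inner a (\<integral>x. f x \<partial>M) < b" "\<And>x. x \<in> S \<Longrightarrow> inner a x > b"
    using separating_hyperplane_closed_point[OF conv clo nS] by blast
  have "b = (\<integral>x. b \<partial>M)" by (simp add: prob_space)
  also have "\<dots> \<le> (\<integral>x. inner a (f x) \<partial>M)"
    using B f ab(2) by (intro integral_mono_AE) (auto simp: S_def less_imp_le)
  also have "\<dots> = inner a (\<integral>x. f x \<partial>M)" using f by simp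
  finally show False using ab(1) by simp
qed

text \<open>Passing from \<open>nrm\<close> to the norm of the type costs the factor
  \<open>b * a\<close>, which may destroy the contraction; a high iterate absorbs it. The fixed
  point of the iterate is unique and \<phi> maps it to another one, hence it is fixed by \<phi>
  itself.\<close>

lemma is_norm_contraction_fixpoint:
  fixes \<phi> :: "real^'d \<Rightarrow> real^'d"
  assumes q: "0 \<le> q" "q < 1" and \<phi>: "\<And>x y. nrm (\<phi> x - \<phi> y) \<le> q * nrm (x - y)"
  shows "\<exists>x. \<phi> x = x"
proof -
  obtain a where a: "a > 0" "\<And>x. nrm x \<le> a * norm x" using is_norm_le_norm by auto
  obtain b where b: "b > 0" "\<And>x. norm x \<le> b * nrm x" using norm_le_is_norm by auto
  have it: "nrm ((\<phi> ^^ k) x - (\<phi> ^^ k) y) \<le> q ^ k * nrm (x - y)" for k x y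
  proof (induction k)
    case (Suc k)
    have "nrm ((\<phi> ^^ Suc k) x - (\<phi> ^^ Suc k) y) \<le> q * nrm ((\<phi> ^^ k) x - (\<phi> ^^ k) y)" using \<phi> by simp
    also have "\<dots> \<le> q * (q ^ k * nrm (x - y))" by (intro mult_left_mono Suc q)
    finally show ?case by (simp add: mult.assoc)
  qed simp
  have "(\<lambda>k. (b * a) * q ^ k) \<longlonglongrightarrow> (b * a) * 0" using q by (intro tendsto_mult_left LIMSEQ_realpow_zero)
  then have "eventually (\<lambda>k. (b * a) * q ^ k < 1/2) sequentially" by (intro order_tendstoD(2)) auto
  then obtain k where k: "(b * a) * q ^ k < 1/2" by (auto simp: eventually_sequentially)
  have "dist ((\<phi> ^^ k) x) ((\<phi> ^^ k) y) \<le> 1/2 * dist x y" for x y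
  proof -
    have "norm ((\<phi> ^^ k) x - (\<phi> ^^ k) y) \<le> b * (q ^ k * (a * norm (x - y)))"
      by (intro order_trans[OF b(2)] mult_left_mono order_trans[OF it] a) (use q b in auto)
    also have "\<dots> = ((b * a) * q ^ k) * norm (x - y)" by simp
    also have "\<dots> \<le> 1/2 * norm (x - y)" using k by (intro mult_right_mono) auto
    finally show ?thesis by (simp add: dist_norm)
  qed
  then have "\<exists>!x. (\<phi> ^^ k) x = x" by (intro banach_fix_type[of "1/2"]) auto
  then obtain x where x: "(\<phi> ^^ k) x = x" "\<And>y. (\<phi> ^^ k) y = y \<Longrightarrow> y = x" by blast
  have "(\<phi> ^^ k) (\<phi> x) = \<phi> ((\<phi> ^^ k) x)" by (metis funpow_swap1)
  then have "(\<phi> ^^ k) (\<phi> x) = \<phi> x" by (simp only: x(1))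
  then have "\<phi> x = x" by (rule x(2))
  then show ?thesis ..
qed

end

text \<open>All assumptions are recast for the norm of the type and for first moments where these
  suffice, with one exception: \<open>contr\<close> keeps \<open>nrm\<close>, since a change of norm
  could push the factor \<gamma> above 1.\<close>

locale stoch_approx = ergodic_chain P \<pi> \<kappa> \<rho>
  for P :: "'x::polish_space \<Rightarrow> 'x measure" and \<pi> \<kappa> \<rho> +
  fixes H :: "real^'d \<Rightarrow> 'x \<Rightarrow> real^'d" and xs :: "real^'d" and nrm :: "real^'d \<Rightarrow> real"
    and p \<sigma> LH \<gamma> c LG \<delta> :: real and G :: "real^'d^'d"
  assumes nrm: "is_norm nrm"
    and H_meas: "case_prod H \<in> borel_measurable borel"
    and root: "(\<integral>\<xi>. H xs \<xi> \<partial>\<pi>) = 0"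
    and p: "2 < p" and moment: "(\<integral>\<^sup>+\<xi>. ennreal (norm (H xs \<xi>) powr p) \<partial>\<pi>) < \<infinity>"
    and PH_le: "\<And>\<xi>. norm (Pop P H xs \<xi>) \<le> \<sigma>"
    and LH: "0 \<le> LH"
      "\<And>x y \<xi>. (\<integral>\<^sup>+\<xi>'. ennreal (norm (H x \<xi>' - H y \<xi>')) \<partial>P \<xi>) \<le> ennreal (LH * norm (x - y))"
    and contr: "0 \<le> \<gamma>" "\<gamma> < 1" "0 < c"
      "\<And>x y \<xi>. nrm ((\<integral>\<xi>'. H x \<xi>' - H y \<xi>' \<partial>P \<xi>) - c *\<^sub>R (x - y)) \<le> \<gamma> * c * nrm (x - y)"
    and lin: "0 < \<delta>"
      "\<And>x. norm (x - xs) \<le> \<delta> \<Longrightarrow> norm ((\<integral>\<xi>. H x \<xi> \<partial>\<pi>) - G *v (x - xs)) \<le> LG * (norm (x - xs))\<^sup>2"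
begin

lemma H_measurable[measurable]: "H x \<in> borel_measurable borel"
proof -
  have "(\<lambda>(x, y). H x y) \<in> borel_measurable (borel \<Otimes>\<^sub>M borel)" using H_meas by (simp add: borel_prod)
  from measurable_Pair2[OF this, of x] show ?thesis by simp
qed

lemma H_diff_integrable: "integrable (P \<xi>) (\<lambda>\<xi>'. H x \<xi>' - H y \<xi>')"
  and H_diff_norm_integral: "(\<integral>\<xi>'. norm (H x \<xi>' - H y \<xi>') \<partial>P \<xi>) \<le> LH * norm (x - y)"
proof -
  have "(\<integral>\<^sup>+\<xi>'. ennreal (norm (H x \<xi>' - H y \<xi>')) \<partial>P \<xi>) < \<infinity>"
    using LH(2)[where x=x and y=y and \<xi>=\<xi>] by (auto intro: le_less_trans)
  then show i: "integrable (P \<xi>) (\<lambda>\<xi>'. H x \<xi>' - H y \<xi>')"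
    unfolding integrable_iff_bounded by (simp add: measurable_cong_sets[OF P_D(3) refl])
  have "ennreal (\<integral>\<xi>'. norm (H x \<xi>' - H y \<xi>') \<partial>P \<xi>) = (\<integral>\<^sup>+\<xi>'. ennreal (norm (H x \<xi>' - H y \<xi>')) \<partial>P \<xi>)"
    by (rule nn_integral_eq_integral[symmetric]) (use i in auto)
  also have "\<dots> \<le> ennreal (LH * norm (x - y))" by (rule LH(2))
  finally show "(\<integral>\<xi>'. norm (H x \<xi>' - H y \<xi>') \<partial>P \<xi>) \<le> LH * norm (x - y)"
    using LH(1) by (subst (asm) ennreal_le_iff) auto
qed

lemma H_diff_integral_le: "norm (\<integral>\<xi>'. H x \<xi>' - H y \<xi>' \<partial>P \<xi>) \<le> LH * norm (x - y)"
  by (rule order_trans[OF integral_norm_bound H_diff_norm_integral])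

lemma H_xs_integrable: "integrable \<pi> (H xs)"
proof -
  have "(\<integral>\<^sup>+\<xi>. ennreal (norm (H xs \<xi>)) \<partial>\<pi>) \<le> (\<integral>\<^sup>+\<xi>. 1 + ennreal (norm (H xs \<xi>) powr p) \<partial>\<pi>)"
  proof (rule nn_integral_mono)
    fix \<xi>
    have "norm (H xs \<xi>) \<le> 1 + norm (H xs \<xi>) powr p"
    proof (cases "norm (H xs \<xi>) \<le> 1")
      case False
      then have "norm (H xs \<xi>) powr 1 \<le> norm (H xs \<xi>) powr p" using p by (intro powr_mono) auto
      then show ?thesis using False by simp
    qed (simp add: add_increasing2)
    then show "ennreal (norm (H xs \<xi>)) \<le> 1 + ennreal (norm (H xs \<xi>) powr p)"
      by (metis ennreal_1 ennreal_leI ennreal_plus powr_ge_zero zero_le_one)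
  qed
  also have "\<dots> = 1 + (\<integral>\<^sup>+\<xi>. ennreal (norm (H xs \<xi>) powr p) \<partial>\<pi>)"
    by (subst nn_integral_add) (auto simp: measurable_cong_sets[OF pi_sets refl] prob_space.emeasure_space_1[OF pi_prob])
  also have "\<dots> < \<infinity>" using moment by simp
  finally show ?thesis unfolding integrable_iff_bounded by (simp add: measurable_cong_sets[OF pi_sets refl])
qed

lemma H_xs_integrable_AE: "AE \<xi> in \<pi>. integrable (P \<xi>) (H xs)"
  by (rule AE_integrable_kernel[OF H_xs_integrable])

text \<open>\<open>R u\<close> is \<open>u \<bullet> P U\<close> almost everywhere. Poisson's
  equation is solved for the bounded \<open>P H\<close>, and the unbounded solution is recovered as
  U = H + R.\<close>

abbreviation "r u \<xi> \<equiv> u \<bullet> Pop P H xs \<xi>"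
abbreviation "R u \<equiv> poisson_sol (r u)"

lemma Pop_measurable: "Pop P H xs \<in> borel_measurable borel"
  unfolding Pop_def[abs_def] by (intro markov_integral_measurable kernel) simp

lemma r_props: "r u \<in> borel_measurable borel" "\<bar>r u \<xi>\<bar> \<le> norm u * \<sigma>" "(\<integral>\<xi>. r u \<xi> \<partial>\<pi>) = 0"
proof -
  show "r u \<in> borel_measurable borel" using Pop_measurable by simp
  show "\<bar>r u \<xi>\<bar> \<le> norm u * \<sigma>"
    by (rule order_trans[OF Cauchy_Schwarz_ineq2]) (intro mult_left_mono PH_le norm_ge_zero)
  have "(\<integral>\<xi>. u \<bullet> Pop P H xs \<xi> \<partial>\<pi>) = u \<bullet> (\<integral>\<xi>. Pop P H xs \<xi> \<partial>\<pi>)"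
    using integrable_kernel[OF H_xs_integrable] by (simp add: Pop_def[abs_def])
  also have "(\<integral>\<xi>. Pop P H xs \<xi> \<partial>\<pi>) = 0"
    using integral_kernel[OF H_xs_integrable] root by (simp add: Pop_def)
  finally show "(\<integral>\<xi>. r u \<xi> \<partial>\<pi>) = 0" by simp
qed

lemma R_props: "R u \<in> borel_measurable borel" "\<bar>R u \<xi>\<bar> \<le> 2 * (norm u * \<sigma>) * \<kappa> / (1 - \<rho>)"
  using poisson_sol_measurable[OF r_props] poisson_sol_le[OF r_props] by auto

lemma R_eq: "R u \<xi> = r u \<xi> + (\<integral>y. R u y \<partial>P \<xi>)"
  by (rule poisson_eq[OF r_props])

end

text \<open>\<open>n_contr\<close> reserves half of the gap (1 - \<gamma>) c for the perturbation,
  the constants \<open>a\<close> and \<open>b\<close> paying for two changes of norm.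
  \<open>W\<close> makes the function \<open>J\<close> bounded, so that \<open>pin_close\<close>
  applies to it.\<close>

locale stoch_approx_pert = stoch_approx P \<pi> \<kappa> \<rho> H xs nrm p \<sigma> LH \<gamma> c LG \<delta> G + perturbed_chain P \<pi> \<kappa> \<rho> h C m n
  for P :: "'x::polish_space \<Rightarrow> 'x measure" and \<pi> \<kappa> \<rho> and H :: "real^'d \<Rightarrow> 'x \<Rightarrow> real^'d" and xs nrm p \<sigma> LH \<gamma> c LG \<delta> G h C m n +
  fixes W :: "real^'d \<Rightarrow> real" and a b :: real
  assumes ab: "0 < a" "\<And>x. nrm x \<le> a * norm x" "0 < b" "\<And>x. norm x \<le> b * nrm x"
    and n_contr: "a * (C * LH / sqrt n) * b \<le> (1 - \<gamma>) * c / 2"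
    and hH_le: "\<And>u \<xi>. integrable (P \<xi>) (H xs) \<Longrightarrow> \<bar>\<integral>y. h \<xi> y * (u \<bullet> H xs y) \<partial>P \<xi>\<bar> \<le> W u"
begin

text \<open>At \<open>xs\<close> this is the transfer of moments. Away from \<open>xs\<close>,
  stationarity inserts one perturbed step, over which the Lipschitz bound for \<open>P\<close> holds
  up to the density factor.\<close>

lemma H_integrable_pin: "integrable \<pi>n (H x)"
proof -
  have 1: "integrable \<pi>n (H xs)"
    using pin_moment_finite[OF _ _ p moment] unfolding integrable_iff_bounded
    by (simp add: measurable_cong_sets[OF pin_sets refl])
  have "(\<integral>\<^sup>+\<xi>. ennreal (norm (H x \<xi> - H xs \<xi>)) \<partial>\<pi>n) = (\<integral>\<^sup>+\<xi>. ennreal (norm (H x \<xi> - H xs \<xi>)) \<partial>(\<pi>n \<bind> Pn))"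
    by (simp add: stationary_bind[OF markov_Pn stationary_pin])
  also have "\<dots> = (\<integral>\<^sup>+\<xi>. \<integral>\<^sup>+\<xi>'. ennreal (norm (H x \<xi>' - H xs \<xi>')) \<partial>Pn \<xi> \<partial>\<pi>n)"
    by (rule nn_integral_bind_markov[OF markov_Pn pin_sets]) simp
  also have "\<dots> \<le> (\<integral>\<^sup>+\<xi>. ennreal (1 + C * \<theta>) * ennreal (LH * norm (x - xs)) \<partial>\<pi>n)"
    by (intro nn_integral_mono order_trans[OF nn_integral_Pn_le] mult_left_mono LH(2)) auto
  also have "\<dots> < \<infinity>"
    by (simp add: prob_space.emeasure_space_1[OF pin_prob] ennreal_mult_less_top)
  finally have "integrable \<pi>n (\<lambda>\<xi>. H x \<xi> - H xs \<xi>)"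
    unfolding integrable_iff_bounded by (simp add: measurable_cong_sets[OF pin_sets refl])
  from Bochner_Integration.integrable_add[OF this 1] show ?thesis by simp
qed

lemma hD_measurable: "(\<lambda>\<xi>. \<integral>y. h \<xi> y *\<^sub>R (H x y - H z y) \<partial>P \<xi>) \<in> borel_measurable borel"
  and D_measurable: "(\<lambda>\<xi>. \<integral>y. H x y - H z y \<partial>P \<xi>) \<in> borel_measurable borel"
proof -
  note h_measurable[measurable]
  show "(\<lambda>\<xi>. \<integral>y. h \<xi> y *\<^sub>R (H x y - H z y) \<partial>P \<xi>) \<in> borel_measurable borel"
    "(\<lambda>\<xi>. \<integral>y. H x y - H z y \<partial>P \<xi>) \<in> borel_measurable borel"
    by (intro integral_measurable_kernel[OF P_D(1)]; measurable)+
qed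

lemma hD_le: "norm (\<integral>y. h \<xi> y *\<^sub>R (H x y - H z y) \<partial>P \<xi>) \<le> C * (LH * norm (x - z))"
proof -
  have "norm (\<integral>y. h \<xi> y *\<^sub>R (H x y - H z y) \<partial>P \<xi>) \<le> (\<integral>y. norm (h \<xi> y *\<^sub>R (H x y - H z y)) \<partial>P \<xi>)"
    by (rule integral_norm_bound)
  also have "\<dots> \<le> (\<integral>y. C * norm (H x y - H z y) \<partial>P \<xi>)"
    by (intro integral_mono integrable_norm integrable_h_scale integrable_mult_right H_diff_integrable)
      (auto intro!: mult_right_mono h_le)
  also have "\<dots> \<le> C * (LH * norm (x - z))"
    using H_diff_norm_integral[where x=x and y=z and \<xi>=\<xi>] C_nonneg by (simp add: mult_left_mono)
  finally show ?thesis .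
qed

lemma D_pin: "(\<integral>\<xi>. H x \<xi> - H z \<xi> \<partial>\<pi>n) =
    (\<integral>\<xi>. \<integral>y. H x y - H z y \<partial>P \<xi> \<partial>\<pi>n) + \<theta> *\<^sub>R (\<integral>\<xi>. \<integral>y. h \<xi> y *\<^sub>R (H x y - H z y) \<partial>P \<xi> \<partial>\<pi>n)"
proof -
  have "integrable \<pi>n (\<lambda>\<xi>. H x \<xi> - H z \<xi>)" by (intro Bochner_Integration.integrable_diff H_integrable_pin)
  note integral_pin[OF this]
  also have "(\<integral>\<xi>. (\<integral>y. H x y - H z y \<partial>P \<xi>) + \<theta> *\<^sub>R (\<integral>y. h \<xi> y *\<^sub>R (H x y - H z y) \<partial>P \<xi>) \<partial>\<pi>n) =
    (\<integral>\<xi>. \<integral>y. H x y - H z y \<partial>P \<xi> \<partial>\<pi>n) + (\<integral>\<xi>. \<theta> *\<^sub>R (\<integral>y. h \<xi> y *\<^sub>R (H x y - H z y) \<partial>P \<xi>) \<partial>\<pi>n)"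
    by (intro Bochner_Integration.integral_add integrable_scaleR_right
        integrable_pin_bounded[OF D_measurable H_diff_integral_le] integrable_pin_bounded[OF hD_measurable hD_le])
  finally show ?thesis by simp
qed

lemma hD_pin_le: "norm (\<theta> *\<^sub>R (\<integral>\<xi>. \<integral>y. h \<xi> y *\<^sub>R (H x y - H z y) \<partial>P \<xi> \<partial>\<pi>n)) \<le> \<theta> * (C * LH) * norm (x - z)"
  using norm_integral_le_prob[OF pin_prob hD_le] theta_nonneg by (simp add: mult_left_mono mult.assoc)

text \<open>The contraction assumption holds at every state, so it survives averaging under any law.
  The \<open>h\<close> part uses the reserve (1 - \<gamma>) c / 2, and \<gamma> + (1 - \<gamma>)/2 =
  (1 + \<gamma>)/2.\<close>

lemma pin_field_contraction:
  "nrm ((\<integral>\<xi>. H x \<xi> \<partial>\<pi>n) - (\<integral>\<xi>. H z \<xi> \<partial>\<pi>n) - c *\<^sub>R (x - z)) \<le> (1 + \<gamma>) / 2 * c * nrm (x - z)"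
proof -
  let ?E = "\<theta> *\<^sub>R (\<integral>\<xi>. \<integral>y. h \<xi> y *\<^sub>R (H x y - H z y) \<partial>P \<xi> \<partial>\<pi>n)"
  let ?D = "\<lambda>\<xi>. (\<integral>y. H x y - H z y \<partial>P \<xi>) - c *\<^sub>R (x - z)"
  have iD: "integrable \<pi>n (\<lambda>\<xi>. \<integral>y. H x y - H z y \<partial>P \<xi>)"
    by (rule integrable_pin_bounded[OF D_measurable H_diff_integral_le])
  interpret pn: prob_space \<pi>n by (rule pin_prob)
  have "(\<integral>\<xi>. H x \<xi> \<partial>\<pi>n) - (\<integral>\<xi>. H z \<xi> \<partial>\<pi>n) - c *\<^sub>R (x - z) = (\<integral>\<xi>. ?D \<xi> \<partial>\<pi>n) + ?E"
    using D_pin[of x z] iD H_integrable_pin by (simp add: pn.prob_space)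
  then have "nrm ((\<integral>\<xi>. H x \<xi> \<partial>\<pi>n) - (\<integral>\<xi>. H z \<xi> \<partial>\<pi>n) - c *\<^sub>R (x - z)) \<le> nrm (\<integral>\<xi>. ?D \<xi> \<partial>\<pi>n) + nrm ?E"
    using is_normD(4)[OF nrm] by simp
  also have "nrm (\<integral>\<xi>. ?D \<xi> \<partial>\<pi>n) \<le> \<gamma> * c * nrm (x - z)"
    by (rule is_norm_integral_le[OF nrm pin_prob]) (use iD contr(4) in auto)
  also have "nrm ?E \<le> a * (\<theta> * (C * LH) * (b * nrm (x - z)))"
    by (intro order_trans[OF ab(2)] mult_left_mono order_trans[OF hD_pin_le] ab(4))
      (use ab theta_nonneg C_nonneg LH in auto)
  also have "\<dots> = (a * (C * LH / sqrt n) * b) * nrm (x - z)" by (simp add: \<theta>_def)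
  also have "\<dots> \<le> ((1 - \<gamma>) * c / 2) * nrm (x - z)"
    by (intro mult_right_mono n_contr is_normD(1)[OF nrm])
  finally show ?thesis by (simp add: field_simps)
qed

lemma pin_field_expansive:
  "(1 - \<gamma>) / 2 * c * nrm (x - z) \<le> nrm ((\<integral>\<xi>. H x \<xi> \<partial>\<pi>n) - (\<integral>\<xi>. H z \<xi> \<partial>\<pi>n))"
proof -
  let ?d = "(\<integral>\<xi>. H x \<xi> \<partial>\<pi>n) - (\<integral>\<xi>. H z \<xi> \<partial>\<pi>n)"
  have "c * nrm (x - z) = nrm (c *\<^sub>R (x - z))" using contr(3) by (simp add: is_normD(3)[OF nrm])
  also have "\<dots> \<le> nrm (c *\<^sub>R (x - z) - ?d) + nrm ?d" by (rule is_norm_triangle[OF nrm])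
  also have "nrm (c *\<^sub>R (x - z) - ?d) = nrm (?d - c *\<^sub>R (x - z))"
    using is_norm_minus[OF nrm, of "?d - c *\<^sub>R (x - z)"] by simp
  finally show ?thesis using pin_field_contraction[of x z] by (simp add: field_simps)
qed

section \<open>The perturbed root and its first-order expansion\<close>

abbreviation "xn \<equiv> pert_root P H h n"

text \<open>Existence is a fixed point of x - (1/c) * (mean field at x), for which the step 1/c
  gives the factor (1 + \<gamma>)/2; uniqueness is \<open>pin_field_expansive\<close>. Both are
  needed for the definite description in \<open>pert_root\<close>.\<close>

lemma xn_root: "(\<integral>\<xi>. H xn \<xi> \<partial>\<pi>n) = 0"
proof -
  define \<phi> where "\<phi> x = x - (1 / c) *\<^sub>R (\<integral>\<xi>. H x \<xi> \<partial>\<pi>n)" for x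
  have "\<exists>x. \<phi> x = x"
  proof (rule is_norm_contraction_fixpoint[OF nrm, of "(1 + \<gamma>) / 2"])
    fix x z
    have "\<phi> x - \<phi> z = (- (1 / c)) *\<^sub>R ((\<integral>\<xi>. H x \<xi> \<partial>\<pi>n) - (\<integral>\<xi>. H z \<xi> \<partial>\<pi>n) - c *\<^sub>R (x - z))"
      using contr(3) by (simp add: \<phi>_def algebra_simps)
    then have "nrm (\<phi> x - \<phi> z) = (1 / c) * nrm ((\<integral>\<xi>. H x \<xi> \<partial>\<pi>n) - (\<integral>\<xi>. H z \<xi> \<partial>\<pi>n) - c *\<^sub>R (x - z))"
      using contr(3) by (simp only: is_normD(3)[OF nrm]) simp
    also have "\<dots> \<le> (1 / c) * ((1 + \<gamma>) / 2 * c * nrm (x - z))"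
      using contr(3) by (intro mult_left_mono pin_field_contraction) auto
    finally show "nrm (\<phi> x - \<phi> z) \<le> (1 + \<gamma>) / 2 * nrm (x - z)" using contr(3) by simp
  qed (use contr in auto)
  then obtain x where x: "(\<integral>\<xi>. H x \<xi> \<partial>\<pi>n) = 0" using contr(3) by (auto simp: \<phi>_def)
  have "z = x" if "(\<integral>\<xi>. H z \<xi> \<partial>\<pi>n) = 0" for z
  proof -
    have "(1 - \<gamma>) / 2 * c * nrm (z - x) \<le> 0"
      using pin_field_expansive[of z x] x that is_normD(2)[OF nrm, of 0] by simp
    then have "nrm (z - x) \<le> 0" using contr by (simp add: mult_le_0_iff)
    then show ?thesis using is_normD(1,2)[OF nrm, of "z - x"] by simp
  qed
  with x show ?thesis unfolding pert_root_def by (rule theI)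
qed

text \<open>The clipping in \<open>J\<close> is only active on the null set where \<open>H xs\<close> is not \<open>P \<xi>\<close>-integrable.\<close>

definition J :: "real^'d \<Rightarrow> 'x \<Rightarrow> real" where
  "J u \<xi> = max (- W u) (min (W u) (\<integral>y. h \<xi> y * (u \<bullet> H xs y) \<partial>P \<xi>)) + (\<integral>y. h \<xi> y * R u y \<partial>P \<xi>)"

definition J_bound :: "real^'d \<Rightarrow> real" where
  "J_bound u = \<bar>W u\<bar> + C * (2 * (norm u * \<sigma>) * \<kappa> / (1 - \<rho>))"

lemma J_props: "J u \<in> borel_measurable borel" "\<bar>J u \<xi>\<bar> \<le> J_bound u"
proof -
  note h_measurable[measurable]
  have 1: "(\<lambda>\<xi>. \<integral>y. h \<xi> y * (u \<bullet> H xs y) \<partial>P \<xi>) \<in> borel_measurable borel"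
    by (intro integral_measurable_kernel[OF P_D(1)]) measurable
  show "J u \<in> borel_measurable borel"
    unfolding J_def[abs_def]
    by (intro borel_measurable_add borel_measurable_max borel_measurable_min borel_measurable_const 1 kernel_h_integral(1)[OF R_props])
  have "\<bar>max (- W u) (min (W u) (\<integral>y. h \<xi> y * (u \<bullet> H xs y) \<partial>P \<xi>))\<bar> \<le> \<bar>W u\<bar>" by linarith
  then show "\<bar>J u \<xi>\<bar> \<le> J_bound u"
    unfolding J_def J_bound_def by (rule order_trans[OF abs_triangle_ineq add_mono[OF _ kernel_h_integral(2)[OF R_props]]])
qed

lemma J_eq:
  assumes "integrable (P \<xi>) (H xs)"
  shows "J u \<xi> = (\<integral>y. h \<xi> y * (u \<bullet> H xs y + R u y) \<partial>P \<xi>)"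
proof -
  have i1: "integrable (P \<xi>) (\<lambda>y. h \<xi> y * (u \<bullet> H xs y))"
    using integrable_h_scale[of \<xi> "\<lambda>y. u \<bullet> H xs y"] assms by simp
  have i2: "integrable (P \<xi>) (\<lambda>y. h \<xi> y * R u y)"
    using integrable_h_scale[of \<xi> "R u"] integrable_bounded_borel[OF P_D(2,3) R_props(1), of u] R_props(2)[of u] by auto
  have "J u \<xi> = (\<integral>y. h \<xi> y * (u \<bullet> H xs y) \<partial>P \<xi>) + (\<integral>y. h \<xi> y * R u y \<partial>P \<xi>)"
    unfolding J_def using hH_le[OF assms, of u] by simp
  also have "\<dots> = (\<integral>y. h \<xi> y * (u \<bullet> H xs y + R u y) \<partial>P \<xi>)"
    using i1 i2 by (simp add: distrib_left)
  finally show ?thesis .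
qed

text \<open>Order \<theta> has two sources: the last step pairs \<open>h\<close> with
  \<open>H\<close>, and the Poisson correction for the bounded \<open>r u\<close> pairs
  \<open>h\<close> with \<open>R u\<close>. Their sum is the pairing with u \<bullet> U.\<close>

lemma H_xs_pin: "u \<bullet> (\<integral>\<xi>. H xs \<xi> \<partial>\<pi>n) = \<theta> * (\<integral>\<xi>. J u \<xi> \<partial>\<pi>n)"
proof -
  have iu: "integrable \<pi>n (\<lambda>\<xi>. u \<bullet> H xs \<xi>)" using H_integrable_pin by simp
  have ir: "integrable \<pi>n (r u)" using r_props[of u] by (intro integrable_pin_bounded) auto
  have iJ: "integrable \<pi>n (J u)" using J_props[of u] by (intro integrable_pin_bounded) auto
  have ihR: "integrable \<pi>n (\<lambda>\<xi>. \<integral>y. h \<xi> y * R u y \<partial>P \<xi>)"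
    using kernel_h_integral[OF R_props[of u]] by (intro integrable_pin_bounded) auto
  have "u \<bullet> (\<integral>\<xi>. H xs \<xi> \<partial>\<pi>n) = (\<integral>\<xi>. u \<bullet> H xs \<xi> \<partial>\<pi>n)" using H_integrable_pin by simp
  also have "\<dots> = (\<integral>\<xi>. (\<integral>y. u \<bullet> H xs y \<partial>P \<xi>) + \<theta> * (\<integral>y. h \<xi> y * (u \<bullet> H xs y) \<partial>P \<xi>) \<partial>\<pi>n)"
    using integral_pin[OF iu] by simp
  also have "\<dots> = (\<integral>\<xi>. r u \<xi> + \<theta> * (J u \<xi> - (\<integral>y. h \<xi> y * R u y \<partial>P \<xi>)) \<partial>\<pi>n)"
  proof (rule integral_cong_AE)
    show "(\<lambda>\<xi>. (\<integral>y. u \<bullet> H xs y \<partial>P \<xi>) + \<theta> * (\<integral>y. h \<xi> y * (u \<bullet> H xs y) \<partial>P \<xi>)) \<in> borel_measurable \<pi>n"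
      using borel_measurable_integrable[OF integrable_pin_kernel[OF iu]] by simp
    show "(\<lambda>\<xi>. r u \<xi> + \<theta> * (J u \<xi> - (\<integral>y. h \<xi> y * R u y \<partial>P \<xi>))) \<in> borel_measurable \<pi>n"
      by (intro borel_measurable_integrable Bochner_Integration.integrable_add ir integrable_mult_right
          Bochner_Integration.integrable_diff iJ ihR)
    show "AE \<xi> in \<pi>n. (\<integral>y. u \<bullet> H xs y \<partial>P \<xi>) + \<theta> * (\<integral>y. h \<xi> y * (u \<bullet> H xs y) \<partial>P \<xi>) =
       r u \<xi> + \<theta> * (J u \<xi> - (\<integral>y. h \<xi> y * R u y \<partial>P \<xi>))"
      using pin_AE[OF H_xs_integrable_AE]
    proof eventually_elim
      case (elim \<xi>)
      have "J u \<xi> - (\<integral>y. h \<xi> y * R u y \<partial>P \<xi>) = (\<integral>y. h \<xi> y * (u \<bullet> H xs y) \<partial>P \<xi>)"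
        unfolding J_def using hH_le[OF elim, of u] by simp
      then show ?case using elim by (simp add: Pop_def)
    qed
  qed
  also have "\<dots> = (\<integral>\<xi>. r u \<xi> \<partial>\<pi>n) + \<theta> * ((\<integral>\<xi>. J u \<xi> \<partial>\<pi>n) - (\<integral>\<xi>. \<integral>y. h \<xi> y * R u y \<partial>P \<xi> \<partial>\<pi>n))"
    using ir iJ ihR by simp
  also have "(\<integral>\<xi>. r u \<xi> \<partial>\<pi>n) = \<theta> * (\<integral>\<xi>. \<integral>y. h \<xi> y * R u y \<partial>P \<xi> \<partial>\<pi>n)"
    by (rule pin_poisson[OF r_props])
  finally show ?thesis by (simp add: algebra_simps)
qed

definition K0 :: real where "K0 = (\<Sum>i\<in>UNIV. J_bound (axis i 1 :: real^'d))"

lemma J_bound_nonneg: "0 \<le> J_bound u"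
  using J_props(2)[of u undefined] by simp

lemma K0_nonneg: "0 \<le> K0" unfolding K0_def by (intro sum_nonneg J_bound_nonneg)

lemma H_xs_pin_norm: "norm (\<integral>\<xi>. H xs \<xi> \<partial>\<pi>n) \<le> \<theta> * K0"
proof -
  have "norm (\<integral>\<xi>. H xs \<xi> \<partial>\<pi>n) \<le> (\<Sum>i\<in>UNIV. \<bar>(\<integral>\<xi>. H xs \<xi> \<partial>\<pi>n) $ i\<bar>)" by (rule norm_le_l1_cart)
  also have "\<dots> \<le> (\<Sum>i\<in>UNIV. \<theta> * J_bound (axis i 1))"
  proof (rule sum_mono)
    fix i
    have "(\<integral>\<xi>. H xs \<xi> \<partial>\<pi>n) $ i = \<theta> * (\<integral>\<xi>. J (axis i 1) \<xi> \<partial>\<pi>n)"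
      using H_xs_pin[of "axis i 1"] by (simp add: inner_axis')
    moreover have "\<bar>\<integral>\<xi>. J (axis i 1) \<xi> \<partial>\<pi>n\<bar> \<le> J_bound (axis i 1)"
      using norm_integral_le_prob[OF pin_prob, of "J (axis i 1)"] J_props(2) by simp
    ultimately show "\<bar>(\<integral>\<xi>. H xs \<xi> \<partial>\<pi>n) $ i\<bar> \<le> \<theta> * J_bound (axis i 1)"
      using theta_nonneg by (simp add: abs_mult mult_left_mono)
  qed
  finally show ?thesis by (simp add: K0_def sum_distrib_left)
qed

text \<open>The inverse of the expansivity constant (1 - \<gamma>) c / 2, with \<open>a\<close> and
  \<open>b\<close> for passing to \<open>nrm\<close> and back.\<close>

definition K1 :: real where "K1 = b * (2 / ((1 - \<gamma>) * c)) * a * K0"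

lemma xn_close: "norm (xn - xs) \<le> \<theta> * K1"
proof -
  have "(1 - \<gamma>) / 2 * c * nrm (xn - xs) \<le> nrm (\<integral>\<xi>. H xs \<xi> \<partial>\<pi>n)"
    using pin_field_expansive[of xn xs] xn_root is_norm_minus[OF nrm] by simp
  also have "\<dots> \<le> a * (\<theta> * K0)"
    by (intro order_trans[OF ab(2)] mult_left_mono H_xs_pin_norm) (use ab in auto)
  finally have "nrm (xn - xs) \<le> 2 / ((1 - \<gamma>) * c) * (a * (\<theta> * K0))"
    using contr by (simp add: field_simps)
  then have "b * nrm (xn - xs) \<le> b * (2 / ((1 - \<gamma>) * c) * (a * (\<theta> * K0)))" using ab by (intro mult_left_mono) auto
  with ab(4)[of "xn - xs"] show ?thesis by (simp add: K1_def mult_ac)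
qed

definition K2 :: real where
  "K2 = real CARD('d) * (C * (4 * (LH * K1) * \<kappa> / (1 - \<rho>))) + C * LH * K1"

text \<open>Second order because two small effects multiply: the one-step difference is already of
  size \<theta>, as \<open>xn\<close> is that close to \<open>xs\<close>, and replacing \<pi> by
  \<open>\<pi>n\<close>, or taking the \<open>h\<close> term, gains another \<theta>.\<close>

lemma D_diff_le: "norm ((\<integral>\<xi>. H xn \<xi> - H xs \<xi> \<partial>\<pi>n) - (\<integral>\<xi>. H xn \<xi> \<partial>\<pi>)) \<le> \<theta>\<^sup>2 * K2"
proof -
  let ?D = "\<lambda>\<xi>. \<integral>y. H xn y - H xs y \<partial>P \<xi>"
  have Dle: "norm (?D \<xi>) \<le> \<theta> * (LH * K1)" for \<xi>
  proof -
    have "norm (?D \<xi>) \<le> LH * norm (xn - xs)" by (rule H_diff_integral_le)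
    also have "\<dots> \<le> LH * (\<theta> * K1)" by (intro mult_left_mono xn_close LH)
    finally show ?thesis by (simp add: mult_ac)
  qed
  have iD: "integrable \<pi> ?D" "integrable \<pi>n ?D"
    using integrable_pi_bounded[OF D_measurable Dle] integrable_pin_bounded[OF D_measurable Dle] by auto
  have iHd: "integrable \<pi> (\<lambda>\<xi>. H xn \<xi> - H xs \<xi>)"
  proof -
    have "(\<integral>\<^sup>+\<xi>. ennreal (norm (H xn \<xi> - H xs \<xi>)) \<partial>\<pi>) = (\<integral>\<^sup>+\<xi>. ennreal (norm (H xn \<xi> - H xs \<xi>)) \<partial>(\<pi> \<bind> P))"
      by (simp add: stationary_bind[OF kernel stat])
    also have "\<dots> = (\<integral>\<^sup>+\<xi>. \<integral>\<^sup>+\<xi>'. ennreal (norm (H xn \<xi>' - H xs \<xi>')) \<partial>P \<xi> \<partial>\<pi>)"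
      by (rule nn_integral_bind_markov[OF kernel pi_sets]) simp
    also have "\<dots> \<le> (\<integral>\<^sup>+\<xi>. ennreal (LH * norm (xn - xs)) \<partial>\<pi>)" by (intro nn_integral_mono LH(2))
    also have "\<dots> < \<infinity>" by (simp add: prob_space.emeasure_space_1[OF pi_prob])
    finally show ?thesis unfolding integrable_iff_bounded by (simp add: measurable_cong_sets[OF pi_sets refl])
  qed
  have "(\<integral>\<xi>. H xn \<xi> \<partial>\<pi>) = (\<integral>\<xi>. H xn \<xi> - H xs \<xi> \<partial>\<pi>)"
    using Bochner_Integration.integral_add[OF iHd H_xs_integrable] root by simp
  also have "\<dots> = (\<integral>\<xi>. ?D \<xi> \<partial>\<pi>)" by (rule integral_kernel[OF iHd, symmetric])
  finally have e: "(\<integral>\<xi>. H xn \<xi> - H xs \<xi> \<partial>\<pi>n) - (\<integral>\<xi>. H xn \<xi> \<partial>\<pi>) =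
     ((\<integral>\<xi>. ?D \<xi> \<partial>\<pi>n) - (\<integral>\<xi>. ?D \<xi> \<partial>\<pi>)) + \<theta> *\<^sub>R (\<integral>\<xi>. \<integral>y. h \<xi> y *\<^sub>R (H xn y - H xs y) \<partial>P \<xi> \<partial>\<pi>n)"
    using D_pin[of xn xs] by simp
  have "norm ((\<integral>\<xi>. ?D \<xi> \<partial>\<pi>n) - (\<integral>\<xi>. ?D \<xi> \<partial>\<pi>)) \<le> (\<Sum>i\<in>UNIV. \<bar>((\<integral>\<xi>. ?D \<xi> \<partial>\<pi>n) - (\<integral>\<xi>. ?D \<xi> \<partial>\<pi>)) $ i\<bar>)"
    by (rule norm_le_l1_cart)
  also have "\<dots> \<le> (\<Sum>i\<in>(UNIV :: 'd set). \<theta> * (C * (4 * (\<theta> * (LH * K1)) * \<kappa> / (1 - \<rho>))))"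
  proof (rule sum_mono)
    fix i :: 'd
    have "(\<lambda>\<xi>. ?D \<xi> $ i) \<in> borel_measurable borel" unfolding cart_eq_inner_axis
      by (intro borel_measurable_inner D_measurable borel_measurable_const)
    then have "\<bar>(\<integral>\<xi>. ?D \<xi> $ i \<partial>\<pi>n) - (\<integral>\<xi>. ?D \<xi> $ i \<partial>\<pi>)\<bar> \<le> \<theta> * (C * (4 * (\<theta> * (LH * K1)) * \<kappa> / (1 - \<rho>)))"
      by (rule pin_close) (rule order_trans[OF component_le_norm_cart Dle])
    then show "\<bar>((\<integral>\<xi>. ?D \<xi> \<partial>\<pi>n) - (\<integral>\<xi>. ?D \<xi> \<partial>\<pi>)) $ i\<bar> \<le> \<theta> * (C * (4 * (\<theta> * (LH * K1)) * \<kappa> / (1 - \<rho>)))"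
      using integral_bounded_linear[OF bounded_linear_vec_nth iD(1), of i]
        integral_bounded_linear[OF bounded_linear_vec_nth iD(2), of i] by simp
  qed
  also have "\<dots> = \<theta>\<^sup>2 * (real CARD('d) * (C * (4 * (LH * K1) * \<kappa> / (1 - \<rho>))))"
    by (simp add: power2_eq_square)
  finally have 1: "norm ((\<integral>\<xi>. ?D \<xi> \<partial>\<pi>n) - (\<integral>\<xi>. ?D \<xi> \<partial>\<pi>)) \<le> \<theta>\<^sup>2 * (real CARD('d) * (C * (4 * (LH * K1) * \<kappa> / (1 - \<rho>))))" .
  have "norm (\<theta> *\<^sub>R (\<integral>\<xi>. \<integral>y. h \<xi> y *\<^sub>R (H xn y - H xs y) \<partial>P \<xi> \<partial>\<pi>n)) \<le> \<theta> * (C * LH) * norm (xn - xs)"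
    by (rule hD_pin_le)
  also have "\<dots> \<le> \<theta> * (C * LH) * (\<theta> * K1)" using theta_nonneg C_nonneg LH
    by (intro mult_left_mono xn_close) auto
  also have "\<dots> = \<theta>\<^sup>2 * (C * LH * K1)" by (simp add: power2_eq_square)
  finally have 2: "norm (\<theta> *\<^sub>R (\<integral>\<xi>. \<integral>y. h \<xi> y *\<^sub>R (H xn y - H xs y) \<partial>P \<xi> \<partial>\<pi>n)) \<le> \<theta>\<^sup>2 * (C * LH * K1)" .
  show ?thesis unfolding e K2_def distrib_left by (rule norm_triangle_mono[OF 1 2])
qed

text \<open>The equation defining \<open>xn\<close> is linearised in the point by \<open>lin\<close>
  and in the measure by \<open>D_diff_le\<close>; the two remainders are the summands of the
  bound.\<close>

lemma xn_expansion:
  assumes "\<theta> * K1 \<le> \<delta>"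
  shows "norm (G *v (xn - xs) + (\<integral>\<xi>. H xs \<xi> \<partial>\<pi>n)) \<le> \<theta>\<^sup>2 * (\<bar>LG\<bar> * K1\<^sup>2 + K2)"
proof -
  have "norm ((\<integral>\<xi>. H xn \<xi> \<partial>\<pi>) - G *v (xn - xs)) \<le> LG * (norm (xn - xs))\<^sup>2"
    by (rule lin(2)) (rule order_trans[OF xn_close assms])
  also have "\<dots> \<le> \<bar>LG\<bar> * (norm (xn - xs))\<^sup>2" by (intro mult_right_mono) auto
  also have "\<dots> \<le> \<bar>LG\<bar> * (\<theta> * K1)\<^sup>2"
    by (intro mult_left_mono power_mono xn_close) auto
  finally have 1: "norm ((\<integral>\<xi>. H xn \<xi> \<partial>\<pi>) - G *v (xn - xs)) \<le> \<theta>\<^sup>2 * (\<bar>LG\<bar> * K1\<^sup>2)"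
    by (simp add: power_mult_distrib mult_ac)
  have "G *v (xn - xs) + (\<integral>\<xi>. H xs \<xi> \<partial>\<pi>n) = - (((\<integral>\<xi>. H xn \<xi> \<partial>\<pi>) - G *v (xn - xs)) +
     ((\<integral>\<xi>. H xn \<xi> - H xs \<xi> \<partial>\<pi>n) - (\<integral>\<xi>. H xn \<xi> \<partial>\<pi>)))"
    using xn_root H_integrable_pin by simp
  then show ?thesis using norm_triangle_mono[OF 1 D_diff_le] by (simp only: norm_minus_cancel distrib_left)
qed

lemma J_close: "\<bar>(\<integral>\<xi>. J u \<xi> \<partial>\<pi>n) - (\<integral>\<xi>. \<integral>y. h \<xi> y * (u \<bullet> H xs y + R u y) \<partial>P \<xi> \<partial>\<pi>)\<bar> \<le>
    \<theta> * (C * (4 * J_bound u * \<kappa> / (1 - \<rho>)))"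
proof -
  note h_measurable[measurable] R_props(1)[measurable]
  have "(\<lambda>\<xi>. \<integral>y. h \<xi> y * (u \<bullet> H xs y + R u y) \<partial>P \<xi>) \<in> borel_measurable borel"
    by (intro integral_measurable_kernel[OF P_D(1)]) measurable
  then have "(\<integral>\<xi>. \<integral>y. h \<xi> y * (u \<bullet> H xs y + R u y) \<partial>P \<xi> \<partial>\<pi>) = (\<integral>\<xi>. J u \<xi> \<partial>\<pi>)"
    using J_props(1)[of u]
    by (intro integral_cong_AE) (use H_xs_integrable_AE in \<open>auto simp: measurable_cong_sets[OF pi_sets refl] J_eq\<close>)
  then show ?thesis using pin_close[OF J_props] by simp
qed

end

section \<open>Path laws\<close>

lemma const_div_sqrt_tendsto_0: "(\<lambda>n. c / sqrt (real n)) \<longlonglongrightarrow> 0"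
  by (intro tendsto_divide_0[OF tendsto_const] filterlim_at_top_imp_at_infinity
      filterlim_compose[OF sqrt_at_top filterlim_real_sequentially])

lemma eventually_const_div_sqrt_le:
  assumes "0 < e" shows "\<forall>\<^sub>F n in sequentially. c / sqrt (real n) \<le> e"
  using order_tendstoD(2)[OF const_div_sqrt_tendsto_0[of c] assms] by eventually_elim simp

context ergodic_chain
begin

lemma ex_mixing_power: "\<exists>m>0. \<rho> ^ m \<le> 1/8 \<and> \<kappa> * \<rho> ^ m \<le> 1/8"
proof -
  have l: "(\<lambda>m. \<rho> ^ m) \<longlonglongrightarrow> 0" using rho by (intro LIMSEQ_realpow_zero)
  have "(\<lambda>m. \<kappa> * \<rho> ^ m) \<longlonglongrightarrow> \<kappa> * 0" by (intro tendsto_mult_left l)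
  then have "\<forall>\<^sub>F m in sequentially. \<kappa> * \<rho> ^ m < 1/8" by (intro order_tendstoD(2)) auto
  moreover have "\<forall>\<^sub>F m in sequentially. \<rho> ^ m < 1/8" by (rule order_tendstoD(2)[OF l]) auto
  ultimately have "\<forall>\<^sub>F m in sequentially. 0 < m \<and> \<rho> ^ m \<le> 1/8 \<and> \<kappa> * \<rho> ^ m \<le> 1/8"
    using eventually_gt_at_top[of 0] by eventually_elim auto
  then show ?thesis unfolding eventually_sequentially by blast
qed

lemma eventually_perturbed_chain:
  assumes h: "h \<in> perturbation_class P" "\<And>x y. \<bar>h x y\<bar> \<le> C"
  shows "\<exists>m. \<forall>\<^sub>F n in sequentially. perturbed_chain P \<pi> \<kappa> \<rho> h C m n"
proof -
  obtain m where m: "0 < m" "\<rho> ^ m \<le> 1/8" "\<kappa> * \<rho> ^ m \<le> 1/8" using ex_mixing_power by auto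
  have "\<forall>\<^sub>F n in sequentially. m * C / sqrt (real n) \<le> 1/8" by (rule eventually_const_div_sqrt_le) simp
  then have "\<forall>\<^sub>F n in sequentially. perturbed_chain P \<pi> \<kappa> \<rho> h C m n"
    by eventually_elim (unfold_locales, use h m in auto)
  then show ?thesis ..
qed

end

context stoch_approx_pert
begin

lemma xn_asymptotics:
  assumes "\<theta> * K1 \<le> \<delta>" "0 < n"
  shows "\<bar>sqrt n * (u \<bullet> (G *v (xn - xs))) + (\<integral>\<xi>. \<integral>y. h \<xi> y * (u \<bullet> H xs y + R u y) \<partial>P \<xi> \<partial>\<pi>)\<bar>
    \<le> (norm u * (\<bar>LG\<bar> * K1\<^sup>2 + K2) + C * (4 * J_bound u * \<kappa> / (1 - \<rho>))) / sqrt n"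
proof -
  let ?I = "\<integral>\<xi>. \<integral>y. h \<xi> y * (u \<bullet> H xs y + R u y) \<partial>P \<xi> \<partial>\<pi>"
  let ?S = "\<integral>\<xi>. J u \<xi> \<partial>\<pi>n"
  let ?w = "G *v (xn - xs) + (\<integral>\<xi>. H xs \<xi> \<partial>\<pi>n)"
  have s: "sqrt n * \<theta> = 1" using assms(2) by (simp add: \<theta>_def)
  have "sqrt n * (u \<bullet> ?w) = sqrt n * (u \<bullet> (G *v (xn - xs))) + (sqrt n * \<theta>) * ?S"
    by (simp add: inner_add_right distrib_left H_xs_pin mult.assoc)
  then have e: "sqrt n * (u \<bullet> (G *v (xn - xs))) + ?I = sqrt n * (u \<bullet> ?w) - (?S - ?I)" by (simp add: s)
  have "\<bar>sqrt n * (u \<bullet> ?w)\<bar> \<le> sqrt n * (norm u * norm ?w)"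
    by (simp add: abs_mult mult_left_mono Cauchy_Schwarz_ineq2)
  also have "\<dots> \<le> sqrt n * (norm u * (\<theta>\<^sup>2 * (\<bar>LG\<bar> * K1\<^sup>2 + K2)))"
    by (intro mult_left_mono xn_expansion assms(1)) auto
  also have "\<dots> = (sqrt n * \<theta>) * (norm u * (\<bar>LG\<bar> * K1\<^sup>2 + K2)) * \<theta>" by (simp add: power2_eq_square mult_ac)
  finally have 1: "\<bar>sqrt n * (u \<bullet> ?w)\<bar> \<le> norm u * (\<bar>LG\<bar> * K1\<^sup>2 + K2) * \<theta>" by (simp add: s)
  have "\<bar>?S - ?I\<bar> \<le> C * (4 * J_bound u * \<kappa> / (1 - \<rho>)) * \<theta>" using J_close[of u] by (simp add: mult.commute)
  with 1 have "\<bar>sqrt n * (u \<bullet> ?w) - (?S - ?I)\<bar> \<le> (norm u * (\<bar>LG\<bar> * K1\<^sup>2 + K2) + C * (4 * J_bound u * \<kappa> / (1 - \<rho>))) * \<theta>"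
    unfolding distrib_right by linarith
  then show ?thesis unfolding e by (simp add: \<theta>_def)
qed

end

context stoch_approx
begin

theorem pert_root_expansion:
  assumes h: "h \<in> perturbation_class P" "\<And>x y. \<bar>h x y\<bar> \<le> C"
    and W: "\<And>u \<xi>. integrable (P \<xi>) (H xs) \<Longrightarrow> \<bar>\<integral>y. h \<xi> y * (u \<bullet> H xs y) \<partial>P \<xi>\<bar> \<le> W u"
  shows "(\<lambda>n. sqrt n * (u \<bullet> (G *v (pert_root P H h n - xs)))) \<longlonglongrightarrow>
    - (\<integral>\<xi>. \<integral>y. h \<xi> y * (u \<bullet> H xs y + R u y) \<partial>P \<xi> \<partial>\<pi>)"
proof -
  let ?I = "\<integral>\<xi>. \<integral>y. h \<xi> y * (u \<bullet> H xs y + R u y) \<partial>P \<xi> \<partial>\<pi>"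
  obtain m where m: "\<forall>\<^sub>F n in sequentially. perturbed_chain P \<pi> \<kappa> \<rho> h C m n"
    using eventually_perturbed_chain[OF h] by auto
  obtain a where a: "a > 0" "\<And>x. nrm x \<le> a * norm x" using is_norm_le_norm[OF nrm] by auto
  obtain b where b: "b > 0" "\<And>x. norm x \<le> b * nrm x" using norm_le_is_norm[OF nrm] by auto
  have "\<forall>\<^sub>F n in sequentially. (a * (C * LH) * b) / sqrt (real n) \<le> (1 - \<gamma>) * c / 2"
    using contr by (intro eventually_const_div_sqrt_le) auto
  with m have loc: "\<forall>\<^sub>F n in sequentially. stoch_approx_pert P \<pi> \<kappa> \<rho> H xs nrm p \<sigma> LH \<gamma> c LG \<delta> G h C m n W a b"
  proof eventually_elim
    case (elim n)
    then interpret perturbed_chain P \<pi> \<kappa> \<rho> h C m n by simp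
    show ?case by unfold_locales (use a b W elim in auto)
  qed
  \<comment> \<open>The exported constants take neither \<open>n\<close> nor \<open>m\<close> as an
    argument, so one bound \<open>B\<close> serves all large \<open>n\<close>.\<close>
  define K1 where "K1 = stoch_approx_pert.K1 \<kappa> \<rho> \<sigma> \<gamma> c C W a b"
  define B where "B = norm u * (\<bar>LG\<bar> * K1\<^sup>2 + stoch_approx_pert.K2 \<kappa> \<rho> \<sigma> LH \<gamma> c C W a b)
      + C * (4 * stoch_approx_pert.J_bound \<kappa> \<rho> \<sigma> C W u * \<kappa> / (1 - \<rho>))"
  have "\<forall>\<^sub>F n in sequentially. K1 / sqrt (real n) \<le> \<delta>"
    by (rule eventually_const_div_sqrt_le[OF lin(1)])
  with loc eventually_gt_at_top[of 0]
  have "\<forall>\<^sub>F n in sequentially. norm (sqrt n * (u \<bullet> (G *v (pert_root P H h n - xs))) + ?I) \<le> B / sqrt n"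
  proof eventually_elim
    case (elim n)
    then interpret s: stoch_approx_pert P \<pi> \<kappa> \<rho> H xs nrm p \<sigma> LH \<gamma> c LG \<delta> G h C m n W a b by simp
    have "s.\<theta> * s.K1 \<le> \<delta>" using elim by (simp add: K1_def s.\<theta>_def)
    from s.xn_asymptotics[OF this elim(2)] show ?case by (simp add: B_def K1_def)
  qed
  then have "(\<lambda>n. sqrt n * (u \<bullet> (G *v (pert_root P H h n - xs))) + ?I) \<longlonglongrightarrow> 0"
    by (rule Lim_null_comparison[OF _ const_div_sqrt_tendsto_0])
  from tendsto_add[OF this tendsto_const[of "- ?I"]] show ?thesis by simp
qed

end

section \<open>The law of a finite path and its marginals\<close>

lemma measurable_coordinate: "i \<in> I \<Longrightarrow> (\<lambda>\<omega>. \<omega> i) \<in> PiM I (\<lambda>_. M) \<rightarrow>\<^sub>M M"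
  by (rule measurable_component_singleton)

lemma measurable_chain_step:
  fixes K :: "'x::topological_space \<Rightarrow> 'x measure"
  assumes K[measurable]: "markov_kernel K"
  shows "(\<lambda>\<omega>. distr (K (\<omega> n)) (PiM {..Suc n} (\<lambda>_. borel)) (\<lambda>y. fun_upd \<omega> (Suc n) y))
    \<in> PiM {..n} (\<lambda>_. borel) \<rightarrow>\<^sub>M prob_algebra (PiM {..Suc n} (\<lambda>_. borel))"
proof (rule measurable_distr_prob_space2[where M=borel])
  show "(\<lambda>\<omega>. K (\<omega> n)) \<in> PiM {..n} (\<lambda>_. borel) \<rightarrow>\<^sub>M prob_algebra borel"
    by (rule measurable_compose[OF measurable_coordinate markov_kernelD(1)[OF K]]) simp
  have "{..Suc n} = {..n} \<union> {Suc n}" by auto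
  then show "(\<lambda>(\<omega>, y). fun_upd \<omega> (Suc n) y) \<in> PiM {..n} (\<lambda>_. borel) \<Otimes>\<^sub>M borel \<rightarrow>\<^sub>M PiM {..Suc n} (\<lambda>_. borel)"
    unfolding case_prod_beta by (rule measurable_fun_upd) measurable
qed

context
  fixes K :: "'x::topological_space \<Rightarrow> 'x measure" and \<mu> :: "'x measure"
  assumes K: "markov_kernel K" and \<mu>: "prob_space \<mu>" "sets \<mu> = sets borel"
begin

lemma chain_law_prob_sets:
  "prob_space (chain_law \<mu> K n) \<and> sets (chain_law \<mu> K n) = sets (PiM {..n} (\<lambda>_. borel))"
proof (induction n)
  case 0
  have "(\<lambda>x. \<lambda>i\<in>{..0::nat}. x) \<in> \<mu> \<rightarrow>\<^sub>M PiM {..0} (\<lambda>_. borel)"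
    using \<mu>(2) by (intro measurable_restrict) (simp add: measurable_cong_sets[OF \<mu>(2) refl])
  then show ?case using prob_space.prob_space_distr[OF \<mu>(1)] by simp
next
  case (Suc n)
  then have "chain_law \<mu> K n \<in> space (prob_algebra (PiM {..n} (\<lambda>_. borel)))" by (simp add: space_prob_algebra)
  from prob_space_bind'[OF this measurable_chain_step[OF K]] sets_bind'[OF this measurable_chain_step[OF K]]
  show ?case by simp
qed

lemmas chain_law_prob = chain_law_prob_sets[THEN conjunct1]
lemmas chain_law_sets = chain_law_prob_sets[THEN conjunct2]
lemmas chain_law_measurable_cong = measurable_cong_sets[OF chain_law_sets refl]

lemma nn_integral_chain_law_Suc:
  assumes F: "F \<in> borel_measurable (PiM {..Suc n} (\<lambda>_. borel))"
  shows "(\<integral>\<^sup>+\<omega>. F \<omega> \<partial>chain_law \<mu> K (Suc n)) = (\<integral>\<^sup>+\<omega>. \<integral>\<^sup>+y. F (fun_upd \<omega> (Suc n) y) \<partial>K (\<omega> n) \<partial>chain_law \<mu> K n)"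
proof -
  have "(\<integral>\<^sup>+\<omega>. F \<omega> \<partial>chain_law \<mu> K (Suc n)) =
    (\<integral>\<^sup>+\<omega>. \<integral>\<^sup>+\<omega>'. F \<omega>' \<partial>distr (K (\<omega> n)) (PiM {..Suc n} (\<lambda>_. borel)) (\<lambda>y. fun_upd \<omega> (Suc n) y) \<partial>chain_law \<mu> K n)"
    unfolding chain_law.simps
    by (rule nn_integral_bind[OF F])
      (use measurable_prob_algebraD[OF measurable_chain_step[OF K, of n]] in \<open>simp add: chain_law_measurable_cong\<close>)
  also have "\<dots> = (\<integral>\<^sup>+\<omega>. \<integral>\<^sup>+y. F (fun_upd \<omega> (Suc n) y) \<partial>K (\<omega> n) \<partial>chain_law \<mu> K n)"
  proof (rule nn_integral_cong)
    fix \<omega> assume "\<omega> \<in> space (chain_law \<mu> K n)"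
    then have w: "\<omega> \<in> space (PiM {..n} (\<lambda>_. borel))" using sets_eq_imp_space_eq[OF chain_law_sets] by auto
    have eq: "{..Suc n} = {..n} \<union> {Suc n}" by auto
    have "(\<lambda>y. fun_upd \<omega> (Suc n) y) \<in> K (\<omega> n) \<rightarrow>\<^sub>M PiM {..Suc n} (\<lambda>_. borel)"
      by (rule measurable_fun_upd[OF eq]) (use w in \<open>auto simp: measurable_cong_sets[OF markov_kernelD(3)[OF K] refl]\<close>)
    then show "(\<integral>\<^sup>+\<omega>'. F \<omega>' \<partial>distr (K (\<omega> n)) (PiM {..Suc n} (\<lambda>_. borel)) (\<lambda>y. fun_upd \<omega> (Suc n) y)) =
        (\<integral>\<^sup>+y. F (fun_upd \<omega> (Suc n) y) \<partial>K (\<omega> n))"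
      by (rule nn_integral_distr) (use F in simp)
  qed
  finally show ?thesis .
qed

lemma integral_chain_law_Suc:
  fixes F :: "(nat \<Rightarrow> 'x) \<Rightarrow> real"
  assumes F: "F \<in> borel_measurable (PiM {..Suc n} (\<lambda>_. borel))" and B: "\<And>\<omega>. \<bar>F \<omega>\<bar> \<le> B"
  shows "(\<integral>\<omega>. F \<omega> \<partial>chain_law \<mu> K (Suc n)) = (\<integral>\<omega>. \<integral>y. F (fun_upd \<omega> (Suc n) y) \<partial>K (\<omega> n) \<partial>chain_law \<mu> K n)"
proof -
  have k: "(\<lambda>\<omega>. distr (K (\<omega> n)) (PiM {..Suc n} (\<lambda>_. borel)) (\<lambda>y. fun_upd \<omega> (Suc n) y))
    \<in> chain_law \<mu> K n \<rightarrow>\<^sub>M prob_algebra (PiM {..Suc n} (\<lambda>_. borel))"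
    using measurable_chain_step[OF K, of n] by (simp add: chain_law_measurable_cong)
  have i: "integrable (chain_law \<mu> K (Suc n)) F"
    by (rule finite_measure.integrable_const_bound[where B=B])
      (use F B chain_law_prob[of "Suc n"] in \<open>auto simp: chain_law_measurable_cong prob_space.finite_measure simp del: chain_law.simps\<close>)
  have "(\<integral>\<omega>. F \<omega> \<partial>chain_law \<mu> K (Suc n)) =
    (\<integral>\<omega>. \<integral>\<omega>'. F \<omega>' \<partial>distr (K (\<omega> n)) (PiM {..Suc n} (\<lambda>_. borel)) (\<lambda>y. fun_upd \<omega> (Suc n) y) \<partial>chain_law \<mu> K n)"
    using i unfolding chain_law.simps by (rule integral_bind_kernel[OF k chain_law_prob])
  also have "\<dots> = (\<integral>\<omega>. \<integral>y. F (fun_upd \<omega> (Suc n) y) \<partial>K (\<omega> n) \<partial>chain_law \<mu> K n)"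
  proof (rule Bochner_Integration.integral_cong[OF refl])
    fix \<omega> assume "\<omega> \<in> space (chain_law \<mu> K n)"
    then have w: "\<omega> \<in> space (PiM {..n} (\<lambda>_. borel))" using sets_eq_imp_space_eq[OF chain_law_sets] by auto
    have eq: "{..Suc n} = {..n} \<union> {Suc n}" by auto
    have "(\<lambda>y. fun_upd \<omega> (Suc n) y) \<in> K (\<omega> n) \<rightarrow>\<^sub>M PiM {..Suc n} (\<lambda>_. borel)"
      by (rule measurable_fun_upd[OF eq]) (use w in \<open>auto simp: measurable_cong_sets[OF markov_kernelD(3)[OF K] refl]\<close>)
    then show "(\<integral>\<omega>'. F \<omega>' \<partial>distr (K (\<omega> n)) (PiM {..Suc n} (\<lambda>_. borel)) (\<lambda>y. fun_upd \<omega> (Suc n) y)) =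
        (\<integral>y. F (fun_upd \<omega> (Suc n) y) \<partial>K (\<omega> n))"
      by (rule integral_distr) (use F in simp)
  qed
  finally show ?thesis .
qed

lemma coordinate_measurable: "i \<le> n \<Longrightarrow> (\<lambda>\<omega>. \<omega> i) \<in> chain_law \<mu> K n \<rightarrow>\<^sub>M borel"
  using measurable_coordinate[of i "{..n}" borel] by (simp add: chain_law_measurable_cong)

text \<open>\<open>chain_law\<close> grows at its end while \<open>kpow\<close> unfolds at its
  start, hence the passage through \<open>kpow_Suc_right\<close>.\<close>

lemma nn_integral_chain_law_last:
  assumes f: "f \<in> borel_measurable borel"
  shows "(\<integral>\<^sup>+\<omega>. f (\<omega> n) \<partial>chain_law \<mu> K n) = (\<integral>\<^sup>+x. \<integral>\<^sup>+y. f y \<partial>kpow K n x \<partial>\<mu>)"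
  using f
proof (induction n arbitrary: f)
  case 0
  have "(\<lambda>x. \<lambda>i\<in>{..0::nat}. x) \<in> \<mu> \<rightarrow>\<^sub>M PiM {..0} (\<lambda>_. borel)"
    using \<mu>(2) by (intro measurable_restrict) (simp add: measurable_cong_sets[OF \<mu>(2) refl])
  moreover have "(\<lambda>\<omega>. f (\<omega> 0)) \<in> borel_measurable (PiM {..0::nat} (\<lambda>_. borel))"
    by (rule measurable_compose[OF measurable_coordinate 0]) simp
  ultimately have "(\<integral>\<^sup>+\<omega>. f (\<omega> 0) \<partial>chain_law \<mu> K 0) = (\<integral>\<^sup>+x. f x \<partial>\<mu>)"
    by (simp add: nn_integral_distr)
  also have "\<dots> = (\<integral>\<^sup>+x. \<integral>\<^sup>+y. f y \<partial>kpow K 0 x \<partial>\<mu>)" using 0 by (simp add: nn_integral_return)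
  finally show ?case .
next
  case (Suc n)
  have m: "(\<lambda>x. \<integral>\<^sup>+y. f y \<partial>K x) \<in> borel_measurable borel"
    by (rule markov_nn_integral_measurable[OF K Suc.prems])
  have "(\<lambda>\<omega>. f (\<omega> (Suc n))) \<in> borel_measurable (PiM {..Suc n} (\<lambda>_. borel))"
    by (rule measurable_compose[OF measurable_coordinate Suc.prems]) simp
  from nn_integral_chain_law_Suc[OF this]
  have "(\<integral>\<^sup>+\<omega>. f (\<omega> (Suc n)) \<partial>chain_law \<mu> K (Suc n)) = (\<integral>\<^sup>+\<omega>. (\<integral>\<^sup>+y. f y \<partial>K (\<omega> n)) \<partial>chain_law \<mu> K n)"
    by (simp del: chain_law.simps)
  also have "\<dots> = (\<integral>\<^sup>+x. \<integral>\<^sup>+z. \<integral>\<^sup>+y. f y \<partial>K z \<partial>kpow K n x \<partial>\<mu>)" by (rule Suc.IH[OF m])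
  also have "\<dots> = (\<integral>\<^sup>+x. \<integral>\<^sup>+y. f y \<partial>kpow K (Suc n) x \<partial>\<mu>)"
    by (simp only: kpow_Suc_right[OF K] nn_integral_bind_markov[OF K markov_kernelD(3)[OF markov_kernel_kpow[OF K]] Suc.prems])
  finally show ?case .
qed

lemma marginal_eq_bind: "marginal \<mu> K t = \<mu> \<bind> kpow K t"
proof (rule measure_eqI)
  note b = prob_space_bind_markov[OF markov_kernel_kpow[OF K, of t] \<mu>]
  show "sets (marginal \<mu> K t) = sets (\<mu> \<bind> kpow K t)" using b by (simp add: marginal_def)
  fix A assume "A \<in> sets (marginal \<mu> K t)"
  then have A: "A \<in> sets borel" by (simp add: marginal_def)
  have "emeasure (marginal \<mu> K t) A = (\<integral>\<^sup>+x. indicator A x \<partial>marginal \<mu> K t)" using A by (simp add: marginal_def)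
  also have "\<dots> = (\<integral>\<^sup>+\<omega>. indicator A (\<omega> t) \<partial>chain_law \<mu> K t)"
    unfolding marginal_def by (rule nn_integral_distr) (use A coordinate_measurable[of t t] in auto)
  also have "\<dots> = (\<integral>\<^sup>+x. \<integral>\<^sup>+y. indicator A y \<partial>kpow K t x \<partial>\<mu>)"
    using A by (intro nn_integral_chain_law_last) simp
  also have "\<dots> = (\<integral>\<^sup>+x. indicator A x \<partial>(\<mu> \<bind> kpow K t))"
    using A by (intro nn_integral_bind_markov[symmetric] markov_kernel_kpow K \<mu>) simp
  finally show "emeasure (marginal \<mu> K t) A = emeasure (\<mu> \<bind> kpow K t) A" using A b by simp
qed

lemma integral_chain_law_last:
  fixes q :: "'x \<Rightarrow> real"
  assumes q: "q \<in> borel_measurable borel" "\<And>x. \<bar>q x\<bar> \<le> B"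
  shows "(\<integral>\<omega>. q (\<omega> n) \<partial>chain_law \<mu> K n) = (\<integral>x. \<integral>y. q y \<partial>kpow K n x \<partial>\<mu>)"
proof -
  have "(\<integral>\<omega>. q (\<omega> n) \<partial>chain_law \<mu> K n) = (\<integral>x. q x \<partial>marginal \<mu> K n)"
    unfolding marginal_def by (rule integral_distr[symmetric]) (use q coordinate_measurable[of n n] in auto)
  also have "\<dots> = (\<integral>x. \<integral>y. q y \<partial>kpow K n x \<partial>\<mu>)"
    unfolding marginal_eq_bind by (rule integral_bind_markov_bounded[where B=B]) (use q \<mu> markov_kernel_kpow[OF K] in auto)
  finally show ?thesis .
qed

end

context ergodic_chain
begin

context
  fixes \<mu> :: "'x measure"
  assumes \<mu>: "prob_space \<mu>" "sets \<mu> = sets borel"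
begin

lemma chain_mix_integral:
  fixes q :: "'x \<Rightarrow> real"
  assumes q: "q \<in> borel_measurable borel" "\<And>x. \<bar>q x\<bar> \<le> B"
  shows "\<bar>(\<integral>\<omega>. q (\<omega> t) \<partial>chain_law \<mu> P t) - (\<integral>y. q y \<partial>\<pi>)\<bar> \<le> 2 * B * (\<kappa> * \<rho> ^ t)"
proof -
  interpret mu: prob_space \<mu> by (rule \<mu>)
  let ?r = "\<lambda>x. \<integral>y. q y \<partial>kpow P t x"
  have r: "?r \<in> borel_measurable borel" by (intro markov_integral_measurable markov_kernel_kpow kernel q)
  have "\<bar>?r x\<bar> \<le> B" for x using norm_integral_le_prob[OF kpow_D(2), where q=q and B=B] q by simp
  then have i: "integrable \<mu> ?r" using r by (intro integrable_bounded_borel[OF \<mu>, where B=B]) auto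
  have "(\<integral>\<omega>. q (\<omega> t) \<partial>chain_law \<mu> P t) - (\<integral>y. q y \<partial>\<pi>) = (\<integral>x. ?r x - (\<integral>y. q y \<partial>\<pi>) \<partial>\<mu>)"
    using i by (simp add: integral_chain_law_last[OF kernel \<mu> q] mu.prob_space)
  also have "\<bar>\<dots>\<bar> \<le> 2 * B * (\<kappa> * \<rho> ^ t)"
    using norm_integral_le_prob[OF \<mu>(1), where q="\<lambda>x. ?r x - (\<integral>y. q y \<partial>\<pi>)"] mix_integral[OF q] by simp
  finally show ?thesis .
qed

text \<open>The moment bound is given along the chain started from \<mu>, but is needed under \<pi>.
  Truncation at \<open>N\<close> makes mixing applicable as t tends to infinity; monotone
  convergence then removes \<open>N\<close>.\<close>

lemma moment_pi_le:
  assumes f: "f \<in> borel_measurable borel" "\<And>x. 0 \<le> f x"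
    and B: "\<And>t. (\<integral>\<^sup>+x. ennreal (f x) \<partial>marginal \<mu> P t) \<le> ennreal B"
  shows "(\<integral>\<^sup>+x. ennreal (f x) \<partial>\<pi>) \<le> ennreal B"
proof -
  have trunc: "(\<integral>\<^sup>+x. ennreal (min (f x) (real N)) \<partial>\<pi>) \<le> ennreal B" for N :: nat
  proof -
    let ?q = "\<lambda>x. min (f x) (real N)"
    have q: "?q \<in> borel_measurable borel" "\<bar>?q x\<bar> \<le> N" for x using f(1) f(2)[of x] by auto
    have q0: "0 \<le> ?q x" for x using f(2)[of x] by simp
    have le: "(\<integral>x. ?q x \<partial>\<pi>) \<le> max B 0 + 2 * real N * (\<kappa> * \<rho> ^ t)" for t
    proof -
      have "ennreal (\<integral>\<omega>. ?q (\<omega> t) \<partial>chain_law \<mu> P t) = (\<integral>\<^sup>+\<omega>. ennreal (?q (\<omega> t)) \<partial>chain_law \<mu> P t)"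
      proof (rule nn_integral_eq_integral[symmetric])
        show "integrable (chain_law \<mu> P t) (\<lambda>\<omega>. ?q (\<omega> t))"
          by (rule finite_measure.integrable_const_bound[where B=N])
           (use q chain_law_prob[OF kernel \<mu>] measurable_compose[OF coordinate_measurable[OF kernel \<mu> order_refl, of t] q(1)]
             in \<open>auto simp: prob_space.finite_measure\<close>)
      qed (use q0 in auto)
      also have "\<dots> = (\<integral>\<^sup>+x. ennreal (?q x) \<partial>marginal \<mu> P t)"
        unfolding marginal_def
        by (rule nn_integral_distr[symmetric]) (use coordinate_measurable[OF kernel \<mu> order_refl, of t] q(1) in auto)
      also have "\<dots> \<le> (\<integral>\<^sup>+x. ennreal (f x) \<partial>marginal \<mu> P t)" by (intro nn_integral_mono ennreal_leI) auto
      also have "\<dots> \<le> ennreal B" by (rule B)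
      also have "\<dots> = ennreal (max B 0)" by (simp add: max_def ennreal_neg)
      finally have A: "(\<integral>\<omega>. ?q (\<omega> t) \<partial>chain_law \<mu> P t) \<le> max B 0"
        by (rule ennreal_le_iff[THEN iffD1, rotated]) simp
      have "\<bar>(\<integral>\<omega>. ?q (\<omega> t) \<partial>chain_law \<mu> P t) - (\<integral>x. ?q x \<partial>\<pi>)\<bar> \<le> 2 * real N * (\<kappa> * \<rho> ^ t)"
        by (rule chain_mix_integral[OF q])
      then have D: "(\<integral>x. ?q x \<partial>\<pi>) \<le> (\<integral>\<omega>. ?q (\<omega> t) \<partial>chain_law \<mu> P t) + 2 * real N * (\<kappa> * \<rho> ^ t)"
        unfolding abs_le_iff minus_diff_eq by (simp only: diff_le_eq add.commute)
      show ?thesis by (rule order_trans[OF D add_right_mono[OF A]])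
    qed
    have "(\<lambda>t. max B 0 + 2 * real N * (\<kappa> * \<rho> ^ t)) \<longlonglongrightarrow> max B 0 + 2 * real N * (\<kappa> * 0)"
      using rho by (intro tendsto_add tendsto_const tendsto_mult_left LIMSEQ_realpow_zero)
    then have "(\<integral>x. ?q x \<partial>\<pi>) \<le> max B 0 + 2 * real N * (\<kappa> * 0)" by (rule LIMSEQ_le_const) (use le in blast)
    then have "ennreal (\<integral>x. ?q x \<partial>\<pi>) \<le> ennreal (max B 0)" by (intro ennreal_leI) simp
    moreover have "(\<integral>\<^sup>+x. ennreal (?q x) \<partial>\<pi>) = ennreal (\<integral>x. ?q x \<partial>\<pi>)"
      by (rule nn_integral_eq_integral) (use q0 integrable_pi_bounded[of ?q N] q in auto)
    ultimately show ?thesis by (simp add: max_def ennreal_neg split: if_splits)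
  qed
  have "(\<integral>\<^sup>+x. ennreal (f x) \<partial>\<pi>) = (\<integral>\<^sup>+x. (SUP N::nat. ennreal (min (f x) (real N))) \<partial>\<pi>)"
  proof (rule nn_integral_cong)
    fix x
    obtain N0 :: nat where "f x \<le> real N0" using real_arch_simple by blast
    then have e: "ennreal (min (f x) (real N0)) = ennreal (f x)" by (simp add: min_def)
    show "ennreal (f x) = (SUP N::nat. ennreal (min (f x) (real N)))"
    proof (rule antisym)
      show "ennreal (f x) \<le> (SUP N::nat. ennreal (min (f x) (real N)))"
        by (rule SUP_upper2[of N0]) (simp_all only: e UNIV_I order_refl)
      show "(SUP N::nat. ennreal (min (f x) (real N))) \<le> ennreal (f x)"
        by (intro SUP_least ennreal_leI) simp
    qed
  qed
  also have "\<dots> = (SUP N::nat. (\<integral>\<^sup>+x. ennreal (min (f x) (real N)) \<partial>\<pi>))"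
  proof (rule nn_integral_monotone_convergence_SUP)
    show "incseq (\<lambda>N x. ennreal (min (f x) (real N)))"
      by (intro incseq_SucI le_funI ennreal_leI) (simp add: min_def)
    show "(\<lambda>x. ennreal (min (f x) (real N))) \<in> borel_measurable \<pi>" for N
      using f(1) by (simp add: measurable_cong_sets[OF pi_sets refl])
  qed
  also have "\<dots> \<le> ennreal B" by (intro SUP_least trunc)
  finally show ?thesis .
qed

end

end

section \<open>The likelihood ratio\<close>

lemma integral_Cauchy_Schwarz:
  fixes f g :: "'a \<Rightarrow> real"
  assumes f: "integrable M (\<lambda>x. (f x)\<^sup>2)" and g: "integrable M (\<lambda>x. (g x)\<^sup>2)" and fg: "integrable M (\<lambda>x. f x * g x)"
  shows "(\<integral>x. f x * g x \<partial>M)\<^sup>2 \<le> (\<integral>x. (f x)\<^sup>2 \<partial>M) * (\<integral>x. (g x)\<^sup>2 \<partial>M)"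
proof -
  define a b d where "a = (\<integral>x. (f x)\<^sup>2 \<partial>M)" and "b = (\<integral>x. f x * g x \<partial>M)" and "d = (\<integral>x. (g x)\<^sup>2 \<partial>M)"
  have q: "0 \<le> a - 2 * s * b + s\<^sup>2 * d" for s
  proof -
    have "0 \<le> (\<integral>x. (f x - s * g x)\<^sup>2 \<partial>M)" by (rule Bochner_Integration.integral_nonneg) simp
    also have "\<dots> = (\<integral>x. (f x)\<^sup>2 - (2 * s) * (f x * g x) + s\<^sup>2 * (g x)\<^sup>2 \<partial>M)"
      by (intro Bochner_Integration.integral_cong refl) (simp add: power2_eq_square algebra_simps)
    also have "\<dots> = a - 2 * s * b + s\<^sup>2 * d" using f g fg by (simp add: a_def b_def d_def)
    finally show ?thesis .
  qed
  have d0: "0 \<le> d" unfolding d_def by (rule Bochner_Integration.integral_nonneg) simp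
  have "b\<^sup>2 \<le> a * d"
  proof (cases "d = 0")
    case True
    have "b = 0"
    proof (rule ccontr)
      assume "b \<noteq> 0"
      \<comment> \<open>With d = 0 the form is linear in s, and this choice of s gives it the value
        -1.\<close>
      then show False using q[of "(a + 1) / (2 * b)"] True by simp
    qed
    then show ?thesis using True by simp
  next
    case False
    then have "0 \<le> d * (a - 2 * (b / d) * b + (b / d)\<^sup>2 * d)" using q[of "b / d"] d0 by (intro mult_nonneg_nonneg)
    also have "\<dots> = a * d - b\<^sup>2" using False by (simp add: power2_eq_square field_simps)
    finally show ?thesis by simp
  qed
  then show ?thesis by (simp add: a_def b_def d_def)
qed

context perturbed_chain
begin

definition LR :: "nat \<Rightarrow> (nat \<Rightarrow> 'x) \<Rightarrow> real" where
  "LR k \<omega> = (\<Prod>i\<in>{1..k}. 1 + \<theta> * h (\<omega> (i - 1)) (\<omega> i))"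

lemma LR_Suc: "LR (Suc k) \<omega> = LR k \<omega> * (1 + \<theta> * h (\<omega> k) (\<omega> (Suc k)))"
  by (simp add: LR_def)

lemma LR_upd: "LR (Suc k) (fun_upd \<omega> (Suc k) y) = LR k \<omega> * (1 + \<theta> * h (\<omega> k) y)"
proof -
  have "LR k (fun_upd \<omega> (Suc k) y) = LR k \<omega>"
    unfolding LR_def by (intro prod.cong refl) auto
  then show ?thesis by (simp add: LR_Suc)
qed

lemma LR_measurable: "LR k \<in> borel_measurable (PiM {..k} (\<lambda>_. borel))"
  unfolding LR_def[abs_def]
proof (intro borel_measurable_prod borel_measurable_add borel_measurable_times borel_measurable_const)
  fix i assume i: "i \<in> {1..k}"
  have "(\<lambda>\<omega>. (\<omega> (i - 1), \<omega> i)) \<in> PiM {..k} (\<lambda>_. borel) \<rightarrow>\<^sub>M borel \<Otimes>\<^sub>M borel"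
    by (intro measurable_Pair measurable_coordinate) (use i in auto)
  from measurable_compose[OF this h_measurable]
  show "(\<lambda>\<omega>. h (\<omega> (i - 1)) (\<omega> i)) \<in> borel_measurable (PiM {..k} (\<lambda>_. borel))" by simp
qed

lemma LR_nonneg: "0 \<le> LR k \<omega>"
  unfolding LR_def by (intro prod_nonneg order_trans[OF _ weight_bounds(1)]) auto

lemma LR_le: "LR k \<omega> \<le> (1 + C * \<theta>) ^ k"
proof -
  have "LR k \<omega> \<le> (\<Prod>i\<in>{1..k}. 1 + C * \<theta>)"
    unfolding LR_def by (intro prod_mono conjI weight_bounds order_trans[OF _ weight_bounds(1)]) auto
  then show ?thesis by simp
qed

context
  fixes \<mu> :: "'x measure"
  assumes \<mu>: "prob_space \<mu>" "sets \<mu> = sets borel"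
begin

text \<open>The last perturbed step is rewritten as a weighted \<open>P\<close> step first; the
  induction hypothesis then applies to the resulting function of the shorter path, whose
  measurability is the main burden.\<close>

lemma nn_integral_chain_law_Pn:
  assumes F: "F \<in> borel_measurable (PiM {..k} (\<lambda>_. borel))"
  shows "(\<integral>\<^sup>+\<omega>. F \<omega> \<partial>chain_law \<mu> Pn k) = (\<integral>\<^sup>+\<omega>. ennreal (LR k \<omega>) * F \<omega> \<partial>chain_law \<mu> P k)"
  using F
proof (induction k arbitrary: F)
  case 0
  then show ?case by (simp add: LR_def)
next
  case (Suc k)
  let ?w = "\<lambda>\<omega> y. ennreal (1 + \<theta> * h (\<omega> k) y) * F (fun_upd \<omega> (Suc k) y)"
  have eq: "{..Suc k} = {..k} \<union> {Suc k}" by auto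
  have upd: "(\<lambda>(\<omega>, y). fun_upd \<omega> (Suc k) y) \<in> PiM {..k} (\<lambda>_. borel) \<Otimes>\<^sub>M borel \<rightarrow>\<^sub>M PiM {..Suc k} (\<lambda>_. borel :: 'x measure)"
    unfolding case_prod_beta by (rule measurable_fun_upd[OF eq]) measurable
  have Fu: "(\<lambda>(\<omega>, y). F (fun_upd \<omega> (Suc k) y)) \<in> borel_measurable (PiM {..k} (\<lambda>_. borel) \<Otimes>\<^sub>M borel)"
    using measurable_compose[OF upd Suc.prems] unfolding case_prod_beta .
  have "(\<lambda>z. (fst z k, snd z)) \<in> PiM {..k} (\<lambda>_. borel :: 'x measure) \<Otimes>\<^sub>M borel \<rightarrow>\<^sub>M borel \<Otimes>\<^sub>M (borel :: 'x measure)"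
    by (intro measurable_Pair measurable_compose[OF measurable_fst measurable_coordinate]) auto
  from measurable_compose[OF this h_measurable]
  have hm: "(\<lambda>(\<omega>, y). h (\<omega> k) y) \<in> borel_measurable (PiM {..k} (\<lambda>_. borel) \<Otimes>\<^sub>M borel)" by (simp add: case_prod_beta)
  have wm: "(\<lambda>(\<omega>, y). ?w \<omega> y) \<in> borel_measurable (PiM {..k} (\<lambda>_. borel) \<Otimes>\<^sub>M borel)"
    using hm Fu by (simp add: case_prod_beta)
  have Kk: "(\<lambda>\<omega>. P (\<omega> k)) \<in> PiM {..k} (\<lambda>_. borel) \<rightarrow>\<^sub>M prob_algebra borel"
    by (rule measurable_compose[OF measurable_coordinate P_D(1)]) simp
  have Im: "(\<lambda>\<omega>. \<integral>\<^sup>+y. ?w \<omega> y \<partial>P (\<omega> k)) \<in> borel_measurable (PiM {..k} (\<lambda>_. borel))"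
    by (rule nn_integral_measurable_kernel[OF Kk wm])
  have Fs: "(\<lambda>y. F (fun_upd \<omega> (Suc k) y)) \<in> borel_measurable borel" if "\<omega> \<in> space (PiM {..k} (\<lambda>_. borel))" for \<omega>
    using measurable_Pair2[OF Fu that] by simp
  have sp: "space (chain_law \<mu> P k) = space (PiM {..k} (\<lambda>_. borel))"
    "space (chain_law \<mu> Pn k) = space (PiM {..k} (\<lambda>_. borel))"
    using chain_law_sets[OF kernel \<mu>, of k] chain_law_sets[OF markov_Pn \<mu>, of k] by (auto dest: sets_eq_imp_space_eq)
  have "(\<integral>\<^sup>+\<omega>. F \<omega> \<partial>chain_law \<mu> Pn (Suc k)) = (\<integral>\<^sup>+\<omega>. \<integral>\<^sup>+y. F (fun_upd \<omega> (Suc k) y) \<partial>Pn (\<omega> k) \<partial>chain_law \<mu> Pn k)"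
    by (rule nn_integral_chain_law_Suc[OF markov_Pn \<mu> Suc.prems])
  also have "\<dots> = (\<integral>\<^sup>+\<omega>. \<integral>\<^sup>+y. ?w \<omega> y \<partial>P (\<omega> k) \<partial>chain_law \<mu> Pn k)"
    by (intro nn_integral_cong nn_integral_Pn Fs) (simp add: sp)
  also have "\<dots> = (\<integral>\<^sup>+\<omega>. ennreal (LR k \<omega>) * (\<integral>\<^sup>+y. ?w \<omega> y \<partial>P (\<omega> k)) \<partial>chain_law \<mu> P k)"
    by (rule Suc.IH[OF Im])
  also have "\<dots> = (\<integral>\<^sup>+\<omega>. \<integral>\<^sup>+y. ennreal (LR (Suc k) (fun_upd \<omega> (Suc k) y)) * F (fun_upd \<omega> (Suc k) y) \<partial>P (\<omega> k) \<partial>chain_law \<mu> P k)"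
  proof (rule nn_integral_cong)
    fix \<omega> assume "\<omega> \<in> space (chain_law \<mu> P k)"
    then have w: "\<omega> \<in> space (PiM {..k} (\<lambda>_. borel))" by (simp add: sp)
    have "?w \<omega> \<in> borel_measurable (P (\<omega> k))"
      using measurable_Pair2[OF wm w] by (simp add: measurable_cong_sets[OF P_D(3) refl])
    then have "ennreal (LR k \<omega>) * (\<integral>\<^sup>+y. ?w \<omega> y \<partial>P (\<omega> k)) = (\<integral>\<^sup>+y. ennreal (LR k \<omega>) * ?w \<omega> y \<partial>P (\<omega> k))"
      by (rule nn_integral_cmult[symmetric])
    also have "\<dots> = (\<integral>\<^sup>+y. ennreal (LR (Suc k) (fun_upd \<omega> (Suc k) y)) * F (fun_upd \<omega> (Suc k) y) \<partial>P (\<omega> k))"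
    proof (rule nn_integral_cong)
      fix y
      have "0 \<le> 1 + \<theta> * h (\<omega> k) y" using weight_bounds(1)[of "\<omega> k" y] by linarith
      then show "ennreal (LR k \<omega>) * ?w \<omega> y = ennreal (LR (Suc k) (fun_upd \<omega> (Suc k) y)) * F (fun_upd \<omega> (Suc k) y)"
        unfolding LR_upd by (simp add: ennreal_mult LR_nonneg mult.assoc)
    qed
    finally show "ennreal (LR k \<omega>) * (\<integral>\<^sup>+y. ?w \<omega> y \<partial>P (\<omega> k)) =
      (\<integral>\<^sup>+y. ennreal (LR (Suc k) (fun_upd \<omega> (Suc k) y)) * F (fun_upd \<omega> (Suc k) y) \<partial>P (\<omega> k))" .
  qed
  also have "\<dots> = (\<integral>\<^sup>+\<omega>. ennreal (LR (Suc k) \<omega>) * F \<omega> \<partial>chain_law \<mu> P (Suc k))"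
    by (rule nn_integral_chain_law_Suc[OF kernel \<mu>, symmetric])
      (intro borel_measurable_times_ennreal measurable_compose[OF LR_measurable measurable_ennreal] Suc.prems)
  finally show ?case .
qed

lemma chain_law_Pn: "chain_law \<mu> Pn k = density (chain_law \<mu> P k) (\<lambda>\<omega>. ennreal (LR k \<omega>))"
proof (rule measure_eqI)
  note s = chain_law_sets[OF kernel \<mu>, of k] chain_law_sets[OF markov_Pn \<mu>, of k]
  show "sets (chain_law \<mu> Pn k) = sets (density (chain_law \<mu> P k) (\<lambda>\<omega>. ennreal (LR k \<omega>)))" by (simp add: s)
  fix A assume A: "A \<in> sets (chain_law \<mu> Pn k)"
  then have A': "A \<in> sets (PiM {..k} (\<lambda>_. borel))" "A \<in> sets (chain_law \<mu> P k)" by (auto simp: s)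
  have "emeasure (chain_law \<mu> Pn k) A = (\<integral>\<^sup>+\<omega>. indicator A \<omega> \<partial>chain_law \<mu> Pn k)" using A by simp
  also have "\<dots> = (\<integral>\<^sup>+\<omega>. ennreal (LR k \<omega>) * indicator A \<omega> \<partial>chain_law \<mu> P k)"
    by (rule nn_integral_chain_law_Pn) (use A' in simp)
  also have "\<dots> = emeasure (density (chain_law \<mu> P k) (\<lambda>\<omega>. ennreal (LR k \<omega>))) A"
    by (rule emeasure_density[symmetric]) (use A' LR_measurable in \<open>auto simp: chain_law_measurable_cong[OF kernel \<mu>]\<close>)
  finally show "emeasure (chain_law \<mu> Pn k) A = emeasure (density (chain_law \<mu> P k) (\<lambda>\<omega>. ennreal (LR k \<omega>))) A" .
qed

lemma integrable_chain_bounded: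
  fixes F :: "(nat \<Rightarrow> 'x) \<Rightarrow> real"
  assumes "F \<in> borel_measurable (PiM {..k} (\<lambda>_. borel))" "\<And>\<omega>. \<bar>F \<omega>\<bar> \<le> B"
  shows "integrable (chain_law \<mu> P k) F"
  by (rule finite_measure.integrable_const_bound[where B=B])
    (use assms chain_law_prob[OF kernel \<mu>] in \<open>auto simp: prob_space.finite_measure chain_law_measurable_cong[OF kernel \<mu>]\<close>)

lemma integral_chain_law_Pn:
  fixes F :: "(nat \<Rightarrow> 'x) \<Rightarrow> real"
  assumes F: "F \<in> borel_measurable (PiM {..k} (\<lambda>_. borel))"
  shows "(\<integral>\<omega>. F \<omega> \<partial>chain_law \<mu> Pn k) = (\<integral>\<omega>. LR k \<omega> * F \<omega> \<partial>chain_law \<mu> P k)"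
  unfolding chain_law_Pn
  using integral_density[of F "chain_law \<mu> P k" "LR k"] F LR_measurable[of k] LR_nonneg
  by (simp add: chain_law_measurable_cong[OF kernel \<mu>])

lemma LR_abs_le: "\<bar>LR k \<omega>\<bar> \<le> (1 + C * \<theta>) ^ k"
  using LR_le[of k \<omega>] LR_nonneg[of k \<omega>] by simp

lemma LR_integrable: "integrable (chain_law \<mu> P k) (LR k)"
  by (rule integrable_chain_bounded[OF LR_measurable LR_abs_le])

lemma LR_sq_le: "\<bar>(LR k \<omega>)\<^sup>2\<bar> \<le> ((1 + C * \<theta>) ^ k)\<^sup>2"
  unfolding power_abs by (intro power_mono LR_abs_le) auto

lemma LR_sq_measurable: "(\<lambda>\<omega>. (LR k \<omega>)\<^sup>2) \<in> borel_measurable (PiM {..k} (\<lambda>_. borel))"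
  by (intro borel_measurable_power LR_measurable)

lemma LR_sq_integrable: "integrable (chain_law \<mu> P k) (\<lambda>\<omega>. (LR k \<omega>)\<^sup>2)"
  by (rule integrable_chain_bounded[OF LR_sq_measurable LR_sq_le])

lemma LR_integral: "(\<integral>\<omega>. LR k \<omega> \<partial>chain_law \<mu> P k) = 1"
  using integral_chain_law_Pn[of "\<lambda>_. 1" k] prob_space.prob_space[OF chain_law_prob[OF markov_Pn \<mu>, of k]] by simp

section \<open>Growth of the chi-square divergence along the path\<close>

definition q :: "'x \<Rightarrow> real" where "q x = (\<integral>y. (h x y)\<^sup>2 \<partial>P x)"

lemma h_sq_le: "(h x y)\<^sup>2 \<le> C\<^sup>2"
  using h_le[of x y] power_mono[of "\<bar>h x y\<bar>" C 2] by simp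

lemma q_props: "q \<in> borel_measurable borel" "0 \<le> q x" "q x \<le> C\<^sup>2" "\<bar>q x\<bar> \<le> C\<^sup>2"
proof -
  note h_measurable[measurable]
  show "q \<in> borel_measurable borel" unfolding q_def[abs_def]
    by (intro integral_measurable_kernel[OF P_D(1)]) measurable
  show 1: "0 \<le> q x" unfolding q_def by (rule Bochner_Integration.integral_nonneg) simp
  show 2: "\<bar>q x\<bar> \<le> C\<^sup>2" unfolding q_def
    using norm_integral_le_prob[OF P_D(2), where q="\<lambda>y. (h x y)\<^sup>2" and B="C\<^sup>2"] h_sq_le by simp
  show "q x \<le> C\<^sup>2" using 1 2 by simp
qed

text \<open>\<open>M2 k - 1\<close> is the chi-square divergence of the perturbed path law from the
  unperturbed one.\<close>

definition M2 :: "nat \<Rightarrow> real" where "M2 k = (\<integral>\<omega>. (LR k \<omega>)\<^sup>2 \<partial>chain_law \<mu> P k)"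

lemma M2_0: "M2 0 = 1"
  using prob_space.prob_space[OF chain_law_prob[OF kernel \<mu>, of 0]] by (simp add: M2_def LR_def del: chain_law.simps)

lemma qk_measurable: "(\<lambda>\<omega>. q (\<omega> (k::nat))) \<in> borel_measurable (PiM {..k} (\<lambda>_. borel))"
  by (rule measurable_compose[OF measurable_coordinate q_props(1)]) simp

lemma LR_sq_q_integrable: "integrable (chain_law \<mu> P k) (\<lambda>\<omega>. (LR k \<omega>)\<^sup>2 * q (\<omega> k))"
proof (rule integrable_chain_bounded)
  show "(\<lambda>\<omega>. (LR k \<omega>)\<^sup>2 * q (\<omega> k)) \<in> borel_measurable (PiM {..k} (\<lambda>_. borel))"
    by (intro borel_measurable_times LR_sq_measurable qk_measurable)
  show "\<bar>(LR k \<omega>)\<^sup>2 * q (\<omega> k)\<bar> \<le> ((1 + C * \<theta>) ^ k)\<^sup>2 * C\<^sup>2" for \<omega>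
    unfolding abs_mult by (intro mult_mono LR_sq_le q_props) auto
qed

text \<open>The cross term linear in \<open>h\<close> vanishes because \<open>h\<close> has
  conditional mean zero, so each step adds only \<theta>^2 times the conditional second
  moment.\<close>

lemma M2_Suc: "M2 (Suc k) = M2 k + \<theta>\<^sup>2 * (\<integral>\<omega>. (LR k \<omega>)\<^sup>2 * q (\<omega> k) \<partial>chain_law \<mu> P k)"
proof -
  have "M2 (Suc k) = (\<integral>\<omega>. \<integral>y. (LR (Suc k) (fun_upd \<omega> (Suc k) y))\<^sup>2 \<partial>P (\<omega> k) \<partial>chain_law \<mu> P k)"
    unfolding M2_def by (rule integral_chain_law_Suc[OF kernel \<mu> LR_sq_measurable LR_sq_le])
  also have "\<dots> = (\<integral>\<omega>. (LR k \<omega>)\<^sup>2 + \<theta>\<^sup>2 * ((LR k \<omega>)\<^sup>2 * q (\<omega> k)) \<partial>chain_law \<mu> P k)"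
  proof (rule Bochner_Integration.integral_cong[OF refl])
    fix \<omega> :: "nat \<Rightarrow> 'x"
    let ?x = "\<omega> k"
    interpret px: prob_space "P ?x" by (rule P_D)
    have i1: "integrable (P ?x) (h ?x)" using h_le
      by (intro integrable_bounded_borel[OF P_D(2,3) h_measurable', where B=C]) simp
    have i2: "integrable (P ?x) (\<lambda>y. (h ?x y)\<^sup>2)" using h_sq_le
      by (intro integrable_bounded_borel[OF P_D(2,3) _, where B="C\<^sup>2"] borel_measurable_power h_measurable') simp
    have "(\<integral>y. (LR (Suc k) (fun_upd \<omega> (Suc k) y))\<^sup>2 \<partial>P ?x) =
       (\<integral>y. (LR k \<omega>)\<^sup>2 * (1 + (2 * \<theta>) * h ?x y + \<theta>\<^sup>2 * (h ?x y)\<^sup>2) \<partial>P ?x)"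
      unfolding LR_upd
      by (intro Bochner_Integration.integral_cong refl) (simp add: power2_eq_square algebra_simps)
    also have "\<dots> = (LR k \<omega>)\<^sup>2 * (1 + \<theta>\<^sup>2 * q ?x)"
      using i1 i2 h_integral[of ?x] by (simp add: q_def px.prob_space)
    finally show "(\<integral>y. (LR (Suc k) (fun_upd \<omega> (Suc k) y))\<^sup>2 \<partial>P ?x) = (LR k \<omega>)\<^sup>2 + \<theta>\<^sup>2 * ((LR k \<omega>)\<^sup>2 * q ?x)"
      by (simp add: algebra_simps)
  qed
  also have "\<dots> = M2 k + \<theta>\<^sup>2 * (\<integral>\<omega>. (LR k \<omega>)\<^sup>2 * q (\<omega> k) \<partial>chain_law \<mu> P k)"
    using LR_sq_integrable LR_sq_q_integrable by (simp add: M2_def)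
  finally show ?thesis .
qed

lemma M2_le_power: "M2 k \<le> (1 + \<theta>\<^sup>2 * C\<^sup>2) ^ k"
proof (induction k)
  case 0
  show ?case by (simp add: M2_0)
next
  case (Suc k)
  have "(\<integral>\<omega>. (LR k \<omega>)\<^sup>2 * q (\<omega> k) \<partial>chain_law \<mu> P k) \<le> (\<integral>\<omega>. (LR k \<omega>)\<^sup>2 * C\<^sup>2 \<partial>chain_law \<mu> P k)"
    using LR_sq_integrable by (intro integral_mono LR_sq_q_integrable mult_left_mono q_props) auto
  also have "\<dots> = C\<^sup>2 * M2 k" using LR_sq_integrable by (simp add: M2_def)
  finally have "M2 (Suc k) \<le> M2 k + \<theta>\<^sup>2 * (C\<^sup>2 * M2 k)" unfolding M2_Suc by (intro add_left_mono mult_left_mono) auto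
  also have "\<dots> = (1 + \<theta>\<^sup>2 * C\<^sup>2) * M2 k" by (simp add: algebra_simps)
  also have "\<dots> \<le> (1 + \<theta>\<^sup>2 * C\<^sup>2) * (1 + \<theta>\<^sup>2 * C\<^sup>2) ^ k" by (intro mult_left_mono Suc) auto
  finally show ?case by simp
qed

lemma theta_sq: "0 < n \<Longrightarrow> \<theta>\<^sup>2 = 1 / n"
  by (simp add: \<theta>_def power_divide)

text \<open>An a priori bound, uniform in \<open>n\<close> but with the supremum of \<open>h\<close>
  in place of its second moment. It serves to show that \<open>LR\<close> stays close to 1.\<close>

lemma M2_le:
  assumes n: "0 < n" and k: "k \<le> n" and C: "C\<^sup>2 \<le> 1/2"
  shows "M2 k \<le> 1 + 2 * C\<^sup>2"
proof -
  have "M2 k \<le> (1 + \<theta>\<^sup>2 * C\<^sup>2) ^ k" by (rule M2_le_power)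
  also have "\<dots> \<le> exp (\<theta>\<^sup>2 * C\<^sup>2) ^ k" by (intro power_mono exp_ge_add_one_self) auto
  also have "\<dots> = exp (k * (\<theta>\<^sup>2 * C\<^sup>2))" by (rule exp_of_nat_mult[symmetric])
  also have "\<dots> \<le> exp (C\<^sup>2)"
  proof -
    have "k * (\<theta>\<^sup>2 * C\<^sup>2) = (k / n) * C\<^sup>2" by (simp add: theta_sq[OF n])
    also have "\<dots> \<le> 1 * C\<^sup>2" using n k by (intro mult_right_mono) auto
    finally show ?thesis by simp
  qed
  also have "\<dots> \<le> 1 + 2 * C\<^sup>2" using C by (intro real_exp_bound_lemma) auto
  finally show ?thesis .
qed

text \<open>Allows the weight in \<open>M2_Suc\<close> to be replaced by 1, which separates the
  likelihood ratio from \<open>q\<close>. The cost is C + 5 C / 2, rounded up to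
  \<open>4 * C\<close>.\<close>

lemma LR_sq_diff_le:
  assumes n: "0 < n" and k: "k \<le> n" and C: "0 < C" "C\<^sup>2 \<le> 1/2"
  shows "(\<integral>\<omega>. \<bar>(LR k \<omega>)\<^sup>2 - 1\<bar> \<partial>chain_law \<mu> P k) \<le> 4 * C"
proof -
  let ?M = "chain_law \<mu> P k"
  interpret c: prob_space ?M by (rule chain_law_prob[OF kernel \<mu>])
  note i = LR_integrable[of k] LR_sq_integrable[of k]
  \<comment> \<open>AM--GM for \<open>\<bar>z - 1\<bar> * \<bar>z + 1\<bar>\<close>, weighted by \<open>C\<close> so that both terms are \<open>O(C)\<close>.\<close>
  have pt: "\<bar>z\<^sup>2 - 1\<bar> \<le> (1 / (2 * C)) * (z\<^sup>2 - 2 * z + 1) + (C / 2) * (z\<^sup>2 + 2 * z + 1)" for z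
  proof -
    have "0 \<le> (\<bar>z - 1\<bar> - C * \<bar>z + 1\<bar>)\<^sup>2" by simp
    then have "2 * C * (\<bar>z - 1\<bar> * \<bar>z + 1\<bar>) \<le> (z - 1)\<^sup>2 + C\<^sup>2 * (z + 1)\<^sup>2"
      unfolding power2_diff power_mult_distrib power2_abs by (simp add: mult_ac)
    then have "\<bar>z - 1\<bar> * \<bar>z + 1\<bar> \<le> ((z - 1)\<^sup>2 + C\<^sup>2 * (z + 1)\<^sup>2) / (2 * C)"
      using C by (simp add: field_simps)
    also have "\<dots> = (1 / (2 * C)) * (z\<^sup>2 - 2 * z + 1) + (C / 2) * (z\<^sup>2 + 2 * z + 1)"
      using C by (simp add: field_simps power2_eq_square)
    also have "\<bar>z - 1\<bar> * \<bar>z + 1\<bar> = \<bar>z\<^sup>2 - 1\<bar>" by (simp add: abs_mult[symmetric] power2_eq_square algebra_simps)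
    finally show ?thesis .
  qed
  have "(\<integral>\<omega>. \<bar>(LR k \<omega>)\<^sup>2 - 1\<bar> \<partial>?M) \<le>
     (\<integral>\<omega>. (1 / (2 * C)) * ((LR k \<omega>)\<^sup>2 - 2 * LR k \<omega> + 1) + (C / 2) * ((LR k \<omega>)\<^sup>2 + 2 * LR k \<omega> + 1) \<partial>?M)"
    using i by (intro integral_mono pt integrable_abs Bochner_Integration.integrable_add Bochner_Integration.integrable_diff
        integrable_mult_right) auto
  also have "\<dots> = (1 / (2 * C)) * (M2 k - 1) + (C / 2) * (M2 k + 3)"
    using i LR_integral[of k] by (simp add: M2_def c.prob_space)
  also have "\<dots> \<le> (1 / (2 * C)) * (2 * C\<^sup>2) + (C / 2) * (1 + 2 * C\<^sup>2 + 3)"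
    using M2_le[OF n k C(2)] C(1) by (intro add_mono mult_left_mono) auto
  also have "\<dots> \<le> (1 / (2 * C)) * (2 * C\<^sup>2) + (C / 2) * 5"
    using C by (intro add_left_mono mult_left_mono) auto
  also have "\<dots> \<le> 4 * C" using C(1) by (simp add: power2_eq_square)
  finally show ?thesis .
qed

text \<open>\<open>4 * C ^ 3\<close> pays for dropping the weight, as \<open>q\<close> is at most
  C^2; the term with \<open>\<rho> ^ k\<close> pays for a start outside stationarity.\<close>

lemma M2_increment:
  assumes n: "0 < n" and k: "k \<le> n" and C: "0 < C" "C\<^sup>2 \<le> 1/2"
  shows "M2 (Suc k) - M2 k \<le> \<theta>\<^sup>2 * ((\<integral>x. q x \<partial>\<pi>) + 4 * C ^ 3 + 2 * C\<^sup>2 * \<kappa> * \<rho> ^ k)"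
proof -
  let ?M = "chain_law \<mu> P k"
  interpret c: prob_space ?M by (rule chain_law_prob[OF kernel \<mu>])
  have iq: "integrable ?M (\<lambda>\<omega>. q (\<omega> k))" by (rule integrable_chain_bounded[OF qk_measurable q_props(4)])
  have ia: "integrable ?M (\<lambda>\<omega>. \<bar>(LR k \<omega>)\<^sup>2 - 1\<bar>)" using LR_sq_integrable by simp
  have "(\<integral>\<omega>. (LR k \<omega>)\<^sup>2 * q (\<omega> k) \<partial>?M) \<le> (\<integral>\<omega>. q (\<omega> k) + C\<^sup>2 * \<bar>(LR k \<omega>)\<^sup>2 - 1\<bar> \<partial>?M)"
  proof (intro integral_mono LR_sq_q_integrable Bochner_Integration.integrable_add iq integrable_mult_right ia)
    fix \<omega>
    have "((LR k \<omega>)\<^sup>2 - 1) * q (\<omega> k) \<le> \<bar>(LR k \<omega>)\<^sup>2 - 1\<bar> * C\<^sup>2"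
      by (intro mult_mono q_props) auto
    then show "(LR k \<omega>)\<^sup>2 * q (\<omega> k) \<le> q (\<omega> k) + C\<^sup>2 * \<bar>(LR k \<omega>)\<^sup>2 - 1\<bar>" by (simp add: algebra_simps)
  qed
  also have "\<dots> = (\<integral>\<omega>. q (\<omega> k) \<partial>?M) + C\<^sup>2 * (\<integral>\<omega>. \<bar>(LR k \<omega>)\<^sup>2 - 1\<bar> \<partial>?M)" using iq ia by simp
  also have "\<dots> \<le> ((\<integral>x. q x \<partial>\<pi>) + 2 * C\<^sup>2 * (\<kappa> * \<rho> ^ k)) + C\<^sup>2 * (4 * C)"
  proof (intro add_mono mult_left_mono LR_sq_diff_le[OF n k C])
    show "(\<integral>\<omega>. q (\<omega> k) \<partial>?M) \<le> (\<integral>x. q x \<partial>\<pi>) + 2 * C\<^sup>2 * (\<kappa> * \<rho> ^ k)"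
      using chain_mix_integral[OF \<mu> q_props(1,4), of k] by linarith
  qed simp
  finally have "\<theta>\<^sup>2 * (\<integral>\<omega>. (LR k \<omega>)\<^sup>2 * q (\<omega> k) \<partial>?M) \<le> \<theta>\<^sup>2 * (((\<integral>x. q x \<partial>\<pi>) + 2 * C\<^sup>2 * (\<kappa> * \<rho> ^ k)) + C\<^sup>2 * (4 * C))"
    by (rule mult_left_mono) simp
  then show ?thesis unfolding M2_Suc by (simp add: power2_eq_square power3_eq_cube algebra_simps)
qed

text \<open>The initial law enters only through a geometric sum, which the factor \<theta>^2 = 1/n
  removes in the limit. What is left is the information plus a remainder cubic in the size of
  \<open>h\<close>.\<close>

lemma M2_final:
  assumes n: "0 < n" and C: "0 < C" "C\<^sup>2 \<le> 1/2"
  shows "M2 n - 1 \<le> (\<integral>x. \<integral>y. (h x y)\<^sup>2 \<partial>P x \<partial>\<pi>) + 4 * C ^ 3 + (2 * C\<^sup>2 * \<kappa> / (1 - \<rho>)) / n"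
proof -
  have "M2 n - 1 = (\<Sum>k<n. M2 (Suc k) - M2 k)" by (simp add: sum_lessThan_telescope M2_0)
  also have "\<dots> \<le> (\<Sum>k<n. \<theta>\<^sup>2 * ((\<integral>x. q x \<partial>\<pi>) + 4 * C ^ 3 + 2 * C\<^sup>2 * \<kappa> * \<rho> ^ k))"
    by (intro sum_mono M2_increment n C) auto
  also have "\<dots> = \<theta>\<^sup>2 * (n * ((\<integral>x. q x \<partial>\<pi>) + 4 * C ^ 3) + 2 * C\<^sup>2 * \<kappa> * (\<Sum>k<n. \<rho> ^ k))"
    by (simp add: sum_distrib_left[symmetric] sum.distrib)
  also have "\<dots> = (\<integral>x. q x \<partial>\<pi>) + 4 * C ^ 3 + (2 * C\<^sup>2 * \<kappa> * (\<Sum>k<n. \<rho> ^ k)) / n"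
    using n by (simp add: theta_sq add_divide_distrib)
  also have "\<dots> \<le> (\<integral>x. q x \<partial>\<pi>) + 4 * C ^ 3 + (2 * C\<^sup>2 * \<kappa> * (1 / (1 - \<rho>))) / n"
  proof (intro add_left_mono divide_right_mono mult_left_mono)
    have "(\<Sum>k<n. \<rho> ^ k) \<le> (\<Sum>k. \<rho> ^ k)" using rho by (intro sum_le_suminf summable_geometric) auto
    then show "(\<Sum>k<n. \<rho> ^ k) \<le> 1 / (1 - \<rho>)" using rho by (simp add: suminf_geometric)
  qed (use kappa_nonneg in auto)
  finally show ?thesis by (simp add: q_def)
qed

lemma chapman_robbins:
  fixes F :: "(nat \<Rightarrow> 'x) \<Rightarrow> real"
  assumes F: "F \<in> borel_measurable (PiM {..k} (\<lambda>_. borel))" and B: "\<And>\<omega>. \<bar>F \<omega>\<bar> \<le> B"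
  shows "((\<integral>\<omega>. F \<omega> \<partial>chain_law \<mu> Pn k) - (\<integral>\<omega>. F \<omega> \<partial>chain_law \<mu> P k))\<^sup>2
    \<le> (\<integral>\<omega>. (F \<omega>)\<^sup>2 \<partial>chain_law \<mu> P k) * (M2 k - 1)"
proof -
  let ?M = "chain_law \<mu> P k"
  interpret c: prob_space ?M by (rule chain_law_prob[OF kernel \<mu>])
  have B0: "0 \<le> B" using B[of undefined] by simp
  have iF: "integrable ?M F" by (rule integrable_chain_bounded[OF F B])
  have iF2: "integrable ?M (\<lambda>\<omega>. (F \<omega>)\<^sup>2)"
  proof (rule integrable_chain_bounded)
    show "\<bar>(F \<omega>)\<^sup>2\<bar> \<le> B\<^sup>2" for \<omega> unfolding power_abs by (intro power_mono B) auto
  qed (intro borel_measurable_power F)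
  have iLF: "integrable ?M (\<lambda>\<omega>. LR k \<omega> * F \<omega>)"
  proof (rule integrable_chain_bounded)
    show "\<bar>LR k \<omega> * F \<omega>\<bar> \<le> (1 + C * \<theta>) ^ k * B" for \<omega>
      unfolding abs_mult using C_theta(1) by (intro mult_mono LR_abs_le B) auto
  qed (intro borel_measurable_times F LR_measurable)
  have sq: "(LR k \<omega> - 1)\<^sup>2 = (LR k \<omega>)\<^sup>2 - 2 * LR k \<omega> + 1" for \<omega> by (simp add: power2_eq_square algebra_simps)
  have e1: "(\<integral>\<omega>. F \<omega> \<partial>chain_law \<mu> Pn k) - (\<integral>\<omega>. F \<omega> \<partial>?M) = (\<integral>\<omega>. F \<omega> * (LR k \<omega> - 1) \<partial>?M)"
    unfolding integral_chain_law_Pn[OF F] using iF iLF by (simp add: algebra_simps)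
  have e2: "(\<integral>\<omega>. (LR k \<omega> - 1)\<^sup>2 \<partial>?M) = M2 k - 1"
    unfolding sq using LR_integrable LR_sq_integrable LR_integral by (simp add: M2_def c.prob_space)
  have "(\<integral>\<omega>. F \<omega> * (LR k \<omega> - 1) \<partial>?M)\<^sup>2 \<le> (\<integral>\<omega>. (F \<omega>)\<^sup>2 \<partial>?M) * (\<integral>\<omega>. (LR k \<omega> - 1)\<^sup>2 \<partial>?M)"
  proof (rule integral_Cauchy_Schwarz[OF iF2])
    show "integrable ?M (\<lambda>\<omega>. (LR k \<omega> - 1)\<^sup>2)" unfolding sq using LR_integrable LR_sq_integrable by simp
    have "(\<lambda>\<omega>. F \<omega> * (LR k \<omega> - 1)) = (\<lambda>\<omega>. LR k \<omega> * F \<omega> - F \<omega>)" by (simp add: algebra_simps)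
    then show "integrable ?M (\<lambda>\<omega>. F \<omega> * (LR k \<omega> - 1))" using iF iLF by simp
  qed
  then show ?thesis unfolding e1 e2 .
qed

end

end

section \<open>A Hammersley--Chapman--Robbins bound\<close>

text \<open>Clipping is bounded and continuous, hence yields test functions for convergence in
  distribution; being 1-Lipschitz, it also absorbs small shifts of its argument.\<close>

definition clip :: "real \<Rightarrow> real \<Rightarrow> real" where "clip K z = max (- K) (min K z)"

lemma clip_abs_le: "0 \<le> K \<Longrightarrow> \<bar>clip K z\<bar> \<le> K"
  and clip_abs_le_self: "0 \<le> K \<Longrightarrow> \<bar>clip K z\<bar> \<le> \<bar>z\<bar>"
  and clip_diff_le: "\<bar>clip K z - clip K w\<bar> \<le> \<bar>z - w\<bar>"
  by (auto simp: clip_def max_def min_def)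

lemma clip_eq: "\<bar>z\<bar> \<le> K \<Longrightarrow> clip K z = z"
  by (auto simp: clip_def max_def min_def)

lemma clip_continuous: "continuous_on S f \<Longrightarrow> continuous_on S (\<lambda>x. clip K (f x))"
  unfolding clip_def by (intro continuous_intros)

lemma clip_measurable: "f \<in> borel_measurable M \<Longrightarrow> (\<lambda>x. clip K (f x)) \<in> borel_measurable M"
  unfolding clip_def by (intro borel_measurable_max borel_measurable_min borel_measurable_const)

context stoch_approx
begin

text \<open>Up to sign, the derivative of the perturbed root in direction \<open>h\<close>, read
  through the functional \<open>w \<mapsto> u \<bullet> (G *v w)\<close>.\<close>

definition score_pairing :: "('x \<Rightarrow> 'x \<Rightarrow> real) \<Rightarrow> real^'d \<Rightarrow> real" where
  "score_pairing h u = (\<integral>\<xi>. \<integral>y. h \<xi> y * (u \<bullet> H xs y + R u y) \<partial>P \<xi> \<partial>\<pi>)"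

context
  fixes \<mu> :: "'x measure" and T :: "nat \<Rightarrow> (nat \<Rightarrow> 'x) \<Rightarrow> real^'d" and L :: "(real^'d) measure" and u v :: "real^'d"
  assumes \<mu>: "prob_space \<mu>" "sets \<mu> = sets borel"
    and T: "estimator T" and reg: "regular \<mu> P H T L"
    and uv: "\<And>w. u \<bullet> (G *v w) = v \<bullet> w"
begin

lemma L_prob: "prob_space L" "sets L = sets borel"
  using reg by (auto simp: regular_def)

lemma estimator_stat_measurable:
  "(\<lambda>\<omega>. v \<bullet> (sqrt n *\<^sub>R (T n \<omega> - x))) \<in> borel_measurable (PiM {..n} (\<lambda>_. borel))"
proof -
  have "T n \<in> borel_measurable (PiM {..n} (\<lambda>_. borel))" using T by (simp add: estimator_def)
  then show ?thesis
    by (intro borel_measurable_inner borel_measurable_scaleR borel_measurable_diff borel_measurable_const)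
qed

text \<open>Regularity centres the estimator at the perturbed root. Recentring at \<open>xs\<close>
  adds a deterministic shift that converges to \<open>- score_pairing h u\<close>; the Lipschitz
  property of \<open>clip\<close> allows the shift to be replaced by its limit.\<close>

lemma clip_limit:
  assumes h: "h \<in> perturbation_class P" "\<And>x y. \<bar>h x y\<bar> \<le> C"
    and W: "\<And>u \<xi>. integrable (P \<xi>) (H xs) \<Longrightarrow> \<bar>\<integral>y. h \<xi> y * (u \<bullet> H xs y) \<partial>P \<xi>\<bar> \<le> W u"
    and K: "0 \<le> K"
  shows "(\<lambda>n. \<integral>\<omega>. clip K (v \<bullet> (sqrt n *\<^sub>R (T n \<omega> - xs))) \<partial>chain_law \<mu> (pert_kernel P h n) n)
     \<longlonglongrightarrow> (\<integral>z. clip K (v \<bullet> z - score_pairing h u) \<partial>L)"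
proof -
  let ?M = "\<lambda>n. chain_law \<mu> (pert_kernel P h n) n"
  let ?t = "- score_pairing h u"
  let ?f = "\<lambda>z. clip K (v \<bullet> z + ?t)"
  let ?Z = "\<lambda>n \<omega>. sqrt n *\<^sub>R (T n \<omega> - pert_root P H h n)"
  let ?tn = "\<lambda>n. sqrt n * (v \<bullet> (pert_root P H h n - xs))"
  have tn: "?tn \<longlonglongrightarrow> ?t"
    using pert_root_expansion[OF h W, of u] by (simp add: uv score_pairing_def)
  have "continuous_on UNIV ?f" by (intro clip_continuous continuous_intros)
  moreover have "bounded (range ?f)" by (rule boundedI[of _ K]) (use clip_abs_le[OF K] in auto)
  ultimately have l1: "(\<lambda>n. \<integral>\<omega>. ?f (?Z n \<omega>) \<partial>?M n) \<longlonglongrightarrow> (\<integral>z. ?f z \<partial>L)"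
    using reg h(1) unfolding regular_def conv_distr_def by blast
  obtain m where m: "\<forall>\<^sub>F n in sequentially. perturbed_chain P \<pi> \<kappa> \<rho> h C m n"
    using eventually_perturbed_chain[OF h] by auto
  have "\<forall>\<^sub>F n in sequentially. norm ((\<integral>\<omega>. clip K (v \<bullet> (sqrt n *\<^sub>R (T n \<omega> - xs))) \<partial>?M n) - (\<integral>\<omega>. ?f (?Z n \<omega>) \<partial>?M n))
      \<le> \<bar>?tn n - ?t\<bar>"
    using m
  proof eventually_elim
    case (elim n)
    then interpret p: perturbed_chain P \<pi> \<kappa> \<rho> h C m n .
    interpret M: prob_space "?M n" by (rule chain_law_prob[OF p.markov_Pn \<mu>])
    note mc = chain_law_measurable_cong[OF p.markov_Pn \<mu>]
    have i1: "integrable (?M n) (\<lambda>\<omega>. clip K (v \<bullet> (sqrt n *\<^sub>R (T n \<omega> - xs))))"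
      by (rule M.integrable_const_bound[where B=K])
        (use clip_abs_le[OF K] clip_measurable[OF estimator_stat_measurable, of K n xs] in \<open>auto simp: mc\<close>)
    have "(\<lambda>\<omega>. v \<bullet> (?Z n \<omega>) + ?t) \<in> borel_measurable (PiM {..n} (\<lambda>_. borel))"
      by (intro borel_measurable_add estimator_stat_measurable borel_measurable_const)
    then have i2: "integrable (?M n) (\<lambda>\<omega>. ?f (?Z n \<omega>))"
      by (intro M.integrable_const_bound[where B=K]) (use clip_abs_le[OF K] in \<open>auto simp: mc intro!: clip_measurable\<close>)
    have "norm (\<integral>\<omega>. clip K (v \<bullet> (sqrt n *\<^sub>R (T n \<omega> - xs))) - ?f (?Z n \<omega>) \<partial>?M n) \<le> \<bar>?tn n - ?t\<bar>"
    proof (rule norm_integral_le_prob[OF M.prob_space_axioms])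
      fix \<omega>
      have e: "v \<bullet> (sqrt n *\<^sub>R (T n \<omega> - xs)) - (v \<bullet> (?Z n \<omega>) + ?t) = ?tn n - ?t"
        by (simp add: inner_diff_right algebra_simps)
      show "norm (clip K (v \<bullet> (sqrt n *\<^sub>R (T n \<omega> - xs))) - ?f (?Z n \<omega>)) \<le> \<bar>?tn n - ?t\<bar>"
        using clip_diff_le[of K "v \<bullet> (sqrt n *\<^sub>R (T n \<omega> - xs))" "v \<bullet> (?Z n \<omega>) + ?t"] unfolding e by simp
    qed
    then show ?case using i1 i2 by simp
  qed
  moreover have "(\<lambda>n. \<bar>?tn n - ?t\<bar>) \<longlonglongrightarrow> 0" by (intro tendsto_rabs_zero LIM_zero tn)
  ultimately have "(\<lambda>n. (\<integral>\<omega>. clip K (v \<bullet> (sqrt n *\<^sub>R (T n \<omega> - xs))) \<partial>?M n) - (\<integral>\<omega>. ?f (?Z n \<omega>) \<partial>?M n)) \<longlonglongrightarrow> 0"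
    by (rule Lim_null_comparison)
  from tendsto_add[OF this l1] show ?thesis by simp
qed

text \<open>The unperturbed chain belongs to the family, so regularity yields the limit under
  \<open>P\<close> with the same \<open>L\<close>.\<close>

lemma zero_perturbation: "(\<lambda>_ _. 0) \<in> perturbation_class P" "pert_kernel P (\<lambda>_ _. 0) n = P"
  by (auto simp: perturbation_class_def pert_kernel_def case_prod_beta density_1 intro!: exI[of _ 0])

lemma score_pairing_zero: "score_pairing (\<lambda>_ _. 0) u = 0"
  by (simp add: score_pairing_def)

context
  fixes h :: "'x \<Rightarrow> 'x \<Rightarrow> real" and C V :: real and W :: "real^'d \<Rightarrow> real"
  assumes h: "h \<in> perturbation_class P" "\<And>x y. \<bar>h x y\<bar> \<le> C" and C: "0 < C"
    and W: "\<And>u \<xi>. integrable (P \<xi>) (H xs) \<Longrightarrow> \<bar>\<integral>y. h \<xi> y * (u \<bullet> H xs y) \<partial>P \<xi>\<bar> \<le> W u"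
    and X_int: "\<forall>\<^sub>F n in sequentially. integrable (chain_law \<mu> P n) (\<lambda>\<omega>. (v \<bullet> (sqrt n *\<^sub>R (T n \<omega> - xs)))\<^sup>2)"
    and X_lim: "(\<lambda>n. \<integral>\<omega>. (v \<bullet> (sqrt n *\<^sub>R (T n \<omega> - xs)))\<^sup>2 \<partial>chain_law \<mu> P n) \<longlonglongrightarrow> V"
begin

text \<open>The second moment in the Chapman-Robbins inequality is taken under \<open>P\<close>,
  where its limit \<open>V\<close> is given; clipping can only decrease it.\<close>

lemma clip_information_bound:
  assumes C2: "C\<^sup>2 \<le> 1/2" and K: "0 \<le> K"
  shows "((\<integral>z. clip K (v \<bullet> z - score_pairing h u) \<partial>L) - (\<integral>z. clip K (v \<bullet> z) \<partial>L))\<^sup>2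
    \<le> V * ((\<integral>x. \<integral>y. (h x y)\<^sup>2 \<partial>P x \<partial>\<pi>) + 4 * C ^ 3)"
proof -
  let ?X = "\<lambda>n \<omega>. v \<bullet> (sqrt n *\<^sub>R (T n \<omega> - xs))"
  let ?s = "\<integral>x. \<integral>y. (h x y)\<^sup>2 \<partial>P x \<partial>\<pi>"
  let ?b = "\<lambda>n. ?s + 4 * C ^ 3 + (2 * C\<^sup>2 * \<kappa> / (1 - \<rho>)) / real n"
  define A where "A n = (\<integral>\<omega>. clip K (?X n \<omega>) \<partial>chain_law \<mu> (pert_kernel P h n) n)" for n
  define B where "B n = (\<integral>\<omega>. clip K (?X n \<omega>) \<partial>chain_law \<mu> P n)" for n
  have A: "A \<longlonglongrightarrow> (\<integral>z. clip K (v \<bullet> z - score_pairing h u) \<partial>L)"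
    unfolding A_def by (rule clip_limit[OF h W K])
  have B: "B \<longlonglongrightarrow> (\<integral>z. clip K (v \<bullet> z) \<partial>L)"
    using clip_limit[OF zero_perturbation(1), of 0 "\<lambda>_. 0" K] K
    by (simp add: zero_perturbation(2) score_pairing_zero B_def[abs_def])
  have l: "(\<lambda>n. (A n - B n)\<^sup>2) \<longlonglongrightarrow> ((\<integral>z. clip K (v \<bullet> z - score_pairing h u) \<partial>L) - (\<integral>z. clip K (v \<bullet> z) \<partial>L))\<^sup>2"
    by (intro tendsto_power tendsto_diff A B)
  have "(\<lambda>n. (2 * C\<^sup>2 * \<kappa> / (1 - \<rho>)) / real n) \<longlonglongrightarrow> 0" by (rule lim_const_over_n)
  then have r: "(\<lambda>n. (\<integral>\<omega>. (?X n \<omega>)\<^sup>2 \<partial>chain_law \<mu> P n) * ?b n) \<longlonglongrightarrow> V * (?s + 4 * C ^ 3 + 0)"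
    by (intro tendsto_mult X_lim tendsto_add tendsto_const)
  obtain m where m: "\<forall>\<^sub>F n in sequentially. perturbed_chain P \<pi> \<kappa> \<rho> h C m n"
    using eventually_perturbed_chain[OF h] by auto
  have s0: "0 \<le> ?s" by (intro Bochner_Integration.integral_nonneg) auto
  have "\<forall>\<^sub>F n in sequentially. (A n - B n)\<^sup>2 \<le> (\<integral>\<omega>. (?X n \<omega>)\<^sup>2 \<partial>chain_law \<mu> P n) * ?b n"
    using m X_int eventually_gt_at_top[of 0]
  proof eventually_elim
    case (elim n)
    then interpret p: perturbed_chain P \<pi> \<kappa> \<rho> h C m n by simp
    interpret M: prob_space "chain_law \<mu> P n" by (rule chain_law_prob[OF kernel \<mu>])
    have Xm: "(\<lambda>\<omega>. clip K (?X n \<omega>)) \<in> borel_measurable (PiM {..n} (\<lambda>_. borel))"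
      by (intro clip_measurable estimator_stat_measurable)
    have b0: "0 \<le> ?b n" using s0 C kappa_nonneg rho by simp
    have "(A n - B n)\<^sup>2 \<le> (\<integral>\<omega>. (clip K (?X n \<omega>))\<^sup>2 \<partial>chain_law \<mu> P n) * (p.M2 \<mu> n - 1)"
      unfolding A_def B_def by (rule p.chapman_robbins[OF \<mu> Xm clip_abs_le[OF K]])
    also have "\<dots> \<le> (\<integral>\<omega>. (clip K (?X n \<omega>))\<^sup>2 \<partial>chain_law \<mu> P n) * ?b n"
      by (intro mult_left_mono p.M2_final[OF \<mu> elim(3) C C2] Bochner_Integration.integral_nonneg) auto
    also have "\<dots> \<le> (\<integral>\<omega>. (?X n \<omega>)\<^sup>2 \<partial>chain_law \<mu> P n) * ?b n"
    proof (intro mult_right_mono integral_mono b0 elim(2))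
      have sq: "(clip K z)\<^sup>2 \<le> K\<^sup>2" for z using power_mono[OF clip_abs_le[OF K, of z], of 2] by simp
      show "integrable (chain_law \<mu> P n) (\<lambda>\<omega>. (clip K (?X n \<omega>))\<^sup>2)"
        by (rule M.integrable_const_bound[where B="K\<^sup>2"])
          (use sq borel_measurable_power[OF Xm, of 2] in \<open>auto simp: chain_law_measurable_cong[OF kernel \<mu>]\<close>)
      show "(clip K (?X n \<omega>))\<^sup>2 \<le> (?X n \<omega>)\<^sup>2" for \<omega>
        using power_mono[OF clip_abs_le_self[OF K, of "?X n \<omega>"], of 2] by simp
    qed
    finally show ?case .
  qed
  from tendsto_le[OF trivial_limit_sequentially r l this] show ?thesis by simp
qed

text \<open>As the clipping level grows, the difference of the two clipped functions tends to the
  full shift. It is dominated by the size of that shift, a constant, so the limit passes under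
  \<open>L\<close> without a moment of \<open>L\<close>.\<close>

lemma small_information_bound:
  assumes C2: "C\<^sup>2 \<le> 1/2"
  shows "(score_pairing h u)\<^sup>2 \<le> V * ((\<integral>x. \<integral>y. (h x y)\<^sup>2 \<partial>P x \<partial>\<pi>) + 4 * C ^ 3)"
proof -
  interpret L: prob_space L by (rule L_prob)
  let ?t = "score_pairing h u"
  have m: "(\<lambda>z. v \<bullet> z - w) \<in> borel_measurable L" for w
    by (simp add: measurable_cong_sets[OF L_prob(2) refl])
  have i: "integrable L (\<lambda>z. clip (real N) (v \<bullet> z - w))" for N w
    by (rule L.integrable_const_bound[where B="real N"]) (use clip_abs_le clip_measurable[OF m] in auto)
  have "(\<lambda>N. \<integral>z. clip (real N) (v \<bullet> z - ?t) - clip (real N) (v \<bullet> z - 0) \<partial>L) \<longlonglongrightarrow> (\<integral>z. - ?t \<partial>L)"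
  proof (rule integral_dominated_convergence[where w="\<lambda>_. \<bar>?t\<bar>"])
    show "AE z in L. (\<lambda>N. clip (real N) (v \<bullet> z - ?t) - clip (real N) (v \<bullet> z - 0)) \<longlonglongrightarrow> - ?t"
    proof (rule AE_I2)
      fix z
      obtain N0 where N0: "\<bar>v \<bullet> z\<bar> + \<bar>?t\<bar> \<le> real N0" using real_arch_simple by blast
      show "(\<lambda>N. clip (real N) (v \<bullet> z - ?t) - clip (real N) (v \<bullet> z - 0)) \<longlonglongrightarrow> - ?t"
      proof (rule tendsto_eventually, rule eventually_sequentiallyI)
        fix N assume "N0 \<le> N"
        then have "\<bar>v \<bullet> z\<bar> + \<bar>?t\<bar> \<le> real N" using N0 by simp
        then show "clip (real N) (v \<bullet> z - ?t) - clip (real N) (v \<bullet> z - 0) = - ?t"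
          by (simp add: clip_eq)
      qed
    qed
    show "AE z in L. norm (clip (real N) (v \<bullet> z - ?t) - clip (real N) (v \<bullet> z - 0)) \<le> \<bar>?t\<bar>" for N
    proof (rule AE_I2)
      show "norm (clip (real N) (v \<bullet> z - ?t) - clip (real N) (v \<bullet> z - 0)) \<le> \<bar>?t\<bar>" for z
        using clip_diff_le[of N "v \<bullet> z - ?t" "v \<bullet> z - 0"] by simp
    qed
  qed (use borel_measurable_integrable[OF Bochner_Integration.integrable_diff[OF i[of _ ?t] i[of _ 0]]] in auto)
  then have "(\<lambda>N. (\<integral>z. clip (real N) (v \<bullet> z - ?t) \<partial>L) - (\<integral>z. clip (real N) (v \<bullet> z) \<partial>L)) \<longlonglongrightarrow> - ?t"
    using i[of _ ?t] i[of _ 0] by (simp add: L.prob_space)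
  then have "(\<lambda>N. ((\<integral>z. clip (real N) (v \<bullet> z - ?t) \<partial>L) - (\<integral>z. clip (real N) (v \<bullet> z) \<partial>L))\<^sup>2) \<longlonglongrightarrow> (- ?t)\<^sup>2"
    by (rule tendsto_power)
  then have "(- ?t)\<^sup>2 \<le> V * ((\<integral>x. \<integral>y. (h x y)\<^sup>2 \<partial>P x \<partial>\<pi>) + 4 * C ^ 3)"
    by (rule LIMSEQ_le_const2) (use clip_information_bound[OF C2] in auto)
  then show ?thesis by simp
qed

end

theorem information_bound:
  fixes h :: "'x \<Rightarrow> 'x \<Rightarrow> real" and C V :: real and W :: "real^'d \<Rightarrow> real"
  assumes h: "h \<in> perturbation_class P" "\<And>x y. \<bar>h x y\<bar> \<le> C" and C: "0 < C"
    and W: "\<And>u \<xi>. integrable (P \<xi>) (H xs) \<Longrightarrow> \<bar>\<integral>y. h \<xi> y * (u \<bullet> H xs y) \<partial>P \<xi>\<bar> \<le> W u"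
    and X_int: "\<forall>\<^sub>F n in sequentially. integrable (chain_law \<mu> P n) (\<lambda>\<omega>. (v \<bullet> (sqrt n *\<^sub>R (T n \<omega> - xs)))\<^sup>2)"
    and X_lim: "(\<lambda>n. \<integral>\<omega>. (v \<bullet> (sqrt n *\<^sub>R (T n \<omega> - xs)))\<^sup>2 \<partial>chain_law \<mu> P n) \<longlonglongrightarrow> V"
  shows "(score_pairing h u)\<^sup>2 \<le> V * (\<integral>x. \<integral>y. (h x y)\<^sup>2 \<partial>P x \<partial>\<pi>)"
proof -
  let ?s = "\<integral>x. \<integral>y. (h x y)\<^sup>2 \<partial>P x \<partial>\<pi>"
  define e where "e k = 1 / (2 * C) * inverse (real (Suc k))" for k
  have e0: "0 < e k" for k using C by (simp add: e_def)
  have eC: "(e k * C)\<^sup>2 \<le> 1/2" for k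
  proof -
    have "e k * C = (1/2) * inverse (real (Suc k))" using C by (simp add: e_def)
    also have "\<dots> \<le> 1/2" by (simp add: field_simps)
    finally have "(e k * C)\<^sup>2 \<le> (1/2)\<^sup>2" using e0[of k] C by (intro power_mono) auto
    then show ?thesis by (simp add: power2_eq_square)
  qed
  have "(score_pairing h u)\<^sup>2 \<le> V * (?s + 4 * (e k * C ^ 3))" for k
  proof -
    let ?h = "\<lambda>x y. e k * h x y"
    have p: "?h \<in> perturbation_class P"
    proof -
      obtain B where "\<And>x y. \<bar>h x y\<bar> \<le> B" using h(2) by blast
      then have "\<bar>e k * h x y\<bar> \<le> e k * B" for x y using e0[of k] by (simp add: abs_mult mult_left_mono)
      moreover have "case_prod h \<in> borel_measurable borel" using h(1) by (simp add: perturbation_class_def)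
      then have "(\<lambda>z. e k * case_prod h z) \<in> borel_measurable borel" by simp
      ultimately show ?thesis using h(1) by (auto simp: perturbation_class_def case_prod_beta')
    qed
    have le: "\<bar>?h x y\<bar> \<le> e k * C" for x y
      using e0[of k] h(2)[of x y] by (simp add: abs_mult mult_left_mono)
    have W': "\<bar>\<integral>y. ?h \<xi> y * (u \<bullet> H xs y) \<partial>P \<xi>\<bar> \<le> e k * W u" if "integrable (P \<xi>) (H xs)" for u \<xi>
      using W[OF that, of u] e0[of k] by (simp add: mult.assoc abs_mult mult_left_mono)
    have "(score_pairing ?h u)\<^sup>2 \<le> V * ((\<integral>x. \<integral>y. (?h x y)\<^sup>2 \<partial>P x \<partial>\<pi>) + 4 * (e k * C) ^ 3)"
      by (rule small_information_bound[OF p le _ W' X_int X_lim eC]) (use e0[of k] C in auto)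
    also have "score_pairing ?h u = e k * score_pairing h u"
      by (simp add: score_pairing_def mult.assoc)
    also have "(\<integral>x. \<integral>y. (?h x y)\<^sup>2 \<partial>P x \<partial>\<pi>) = (e k)\<^sup>2 * ?s" by (simp add: power_mult_distrib)
    finally have "(e k)\<^sup>2 * (score_pairing h u)\<^sup>2 \<le> (e k)\<^sup>2 * (V * (?s + 4 * (e k * C ^ 3)))"
      by (simp add: power_mult_distrib power3_eq_cube power2_eq_square algebra_simps)
    then show ?thesis using e0[of k] by simp
  qed
  note b = this
  have "e \<longlonglongrightarrow> 1 / (2 * C) * 0" unfolding e_def[abs_def] by (intro tendsto_mult_left LIMSEQ_inverse_real_of_nat)
  then have "(\<lambda>k. V * (?s + 4 * (e k * C ^ 3))) \<longlonglongrightarrow> V * (?s + 4 * ((1 / (2 * C) * 0) * C ^ 3))"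
    by (intro tendsto_intros)
  then have "(score_pairing h u)\<^sup>2 \<le> V * (?s + 4 * ((1 / (2 * C) * 0) * C ^ 3))"
    by (rule LIMSEQ_le_const) (use b in blast)
  then show ?thesis by simp
qed

end

end

section \<open>The least favourable perturbations\<close>

context ergodic_chain
begin

text \<open>By stationarity, the mean of \<open>emeasure (P \<xi>) N\<close> under \<pi> is the
  \<pi>-measure of \<open>N\<close>; when that is 0, almost every summand of the mean is 0.\<close>

lemma AE_kernel:
  assumes "AE y in \<pi>. Q y"
  shows "AE \<xi> in \<pi>. AE y in P \<xi>. Q y"
proof -
  obtain N where N: "\<And>x. x \<in> space \<pi> - N \<Longrightarrow> Q x" "N \<in> null_sets \<pi>"
    using AE_E3[OF assms] by blast
  then have Nb: "N \<in> sets borel" and N0: "emeasure \<pi> N = 0" by (auto simp: null_sets_def pi_sets)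
  have m: "(\<lambda>\<xi>. emeasure (P \<xi>) N) \<in> borel_measurable \<pi>"
  proof -
    have "(\<lambda>\<xi>. \<integral>\<^sup>+y. indicator N y \<partial>P \<xi>) \<in> borel_measurable borel"
      using Nb by (intro markov_nn_integral_measurable kernel) simp
    then show ?thesis using Nb by (simp add: P_D measurable_cong_sets[OF pi_sets refl])
  qed
  have "(\<integral>\<^sup>+\<xi>. emeasure (P \<xi>) N \<partial>\<pi>) = 0" using stat Nb N0 by (simp add: stationary_def)
  then have "AE \<xi> in \<pi>. emeasure (P \<xi>) N = 0" using m by (simp add: nn_integral_0_iff_AE)
  then show ?thesis
  proof eventually_elim
    case (elim \<xi>)
    show ?case by (rule AE_I[of _ _ N]) (use N(1) elim Nb in \<open>auto simp: P_D pi_space\<close>)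
  qed
qed

end

section \<open>The series for U in terms of H and R\<close>

context stoch_approx
begin

lemma AE_kpow_integrable: "AE \<xi> in \<pi>. \<forall>t. integrable (kpow P t \<xi>) (H xs)"
  unfolding AE_all_countable
proof
  fix t
  have "integrable (\<pi> \<bind> kpow P t) (H xs)" using H_xs_integrable by (simp add: stationary_bind_kpow[OF kernel stat])
  then show "AE \<xi> in \<pi>. integrable (kpow P t \<xi>) (H xs)"
    by (rule AE_integrable_bind_markov[OF markov_kernel_kpow[OF kernel] pi_prob pi_sets])
qed

abbreviation "U \<equiv> poisson_U P \<pi> H xs"

lemma U_measurable: "U \<in> borel_measurable borel"
  unfolding poisson_U_def[abs_def] Pop_pow_def
  by (intro borel_measurable_suminf borel_measurable_diff borel_measurable_const markov_integral_measurable
      markov_kernel_kpow kernel H_measurable)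

text \<open>Only the term t = 0 of the series is unbounded; later terms are iterates of
  \<open>P\<close> acting on the bounded \<open>P H\<close>. The integrability hypothesis excludes
  default values of the integral in \<open>Pop_pow\<close>.\<close>

lemma U_inner:
  assumes int: "\<forall>t. integrable (kpow P t \<xi>) (H xs)"
  shows "w \<bullet> U \<xi> = w \<bullet> H xs \<xi> + R w \<xi>"
proof -
  define f where "f t = Pop_pow P t H xs \<xi>" for t
  have f0: "f 0 = H xs \<xi>" by (simp add: f_def Pop_pow_def integral_return)
  have fS: "w \<bullet> f (Suc t) = (\<integral>z. r w z \<partial>kpow P t \<xi>)" for w t
  proof -
    have i: "integrable (kpow P t \<xi> \<bind> P) (H xs)" using int by (simp add: kpow_Suc_right[OF kernel, symmetric] del: kpow.simps)
    have "f (Suc t) = (\<integral>z. Pop P H xs z \<partial>kpow P t \<xi>)"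
      unfolding f_def Pop_pow_def kpow_Suc_right[OF kernel] Pop_def
      by (rule integral_bind_markov[OF kernel kpow_D(2,3) i])
    moreover have "integrable (kpow P t \<xi>) (Pop P H xs)"
      by (rule integrable_bounded_borel[OF kpow_D(2,3) Pop_measurable PH_le])
    ultimately show ?thesis by simp
  qed
  have s1: "summable (\<lambda>t. f (Suc t))"
  proof (rule summable_comparison_test')
    show "summable (\<lambda>t. (\<Sum>i\<in>(UNIV :: 'd set). 2 * (norm (axis i 1 :: real^'d) * \<sigma>) * \<kappa>) * \<rho> ^ t)"
      using rho by (intro summable_mult summable_geometric) auto
    fix t
    have "norm (f (Suc t)) \<le> (\<Sum>i\<in>UNIV. \<bar>f (Suc t) $ i\<bar>)" by (rule norm_le_l1_cart)
    also have "\<dots> \<le> (\<Sum>i\<in>(UNIV :: 'd set). 2 * (norm (axis i 1 :: real^'d) * \<sigma>) * \<kappa> * \<rho> ^ t)"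
    proof (rule sum_mono)
      fix i
      have "f (Suc t) $ i = (\<integral>z. r (axis i 1) z \<partial>kpow P t \<xi>)" using fS[of "axis i 1" t] by (simp add: inner_axis')
      then show "\<bar>f (Suc t) $ i\<bar> \<le> 2 * (norm (axis i 1 :: real^'d) * \<sigma>) * \<kappa> * \<rho> ^ t"
        using poisson_term_le[OF r_props[of "axis i 1"], of t \<xi>] by simp
    qed
    finally show "norm (f (Suc t)) \<le> (\<Sum>i\<in>(UNIV :: 'd set). 2 * (norm (axis i 1 :: real^'d) * \<sigma>) * \<kappa>) * \<rho> ^ t"
      by (simp add: sum_distrib_right)
  qed
  then have s: "summable f" by (simp add: summable_Suc_iff)
  have "U \<xi> = suminf f" using root by (simp add: poisson_U_def mean_field_def f_def[abs_def])
  also have "\<dots> = (\<Sum>t. f (Suc t)) + f 0" using suminf_split_head[OF s] by simp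
  finally have "w \<bullet> U \<xi> = w \<bullet> (\<Sum>t. f (Suc t)) + w \<bullet> f 0" by (simp add: inner_add_right)
  also have "w \<bullet> (\<Sum>t. f (Suc t)) = (\<Sum>t. w \<bullet> f (Suc t))"
    by (rule bounded_linear.suminf[OF bounded_linear_inner_right s1])
  also have "\<dots> = R w \<xi>" by (simp add: fS poisson_sol_def)
  finally show ?thesis by (simp add: f0)
qed

text \<open>From U = H + R and Poisson's equation, P U = P H + P R = R in every direction.
  Integrability of \<open>U\<close> has to come first, by domination with the norm of
  \<open>H\<close>, since \<open>Pop\<close> integrates vectors.\<close>

lemma PU_inner:
  assumes int: "integrable (P \<xi>) (H xs)" and ae: "AE y in P \<xi>. \<forall>t. integrable (kpow P t y) (H xs)"
  shows "w \<bullet> Pop P (poisson_U P \<pi> H) xs \<xi> = R w \<xi>"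
proof -
  interpret px: prob_space "P \<xi>" by (rule P_D)
  let ?B = "\<Sum>i\<in>(UNIV :: 'd set). 2 * (norm (axis i 1 :: real^'d) * \<sigma>) * \<kappa> / (1 - \<rho>)"
  have "integrable (P \<xi>) U"
  proof (rule Bochner_Integration.integrable_bound)
    show "integrable (P \<xi>) (\<lambda>y. norm (H xs y) + ?B)" using int by simp
    show "U \<in> borel_measurable (P \<xi>)" using U_measurable by (simp add: measurable_cong_sets[OF P_D(3) refl])
    show "AE y in P \<xi>. norm (U y) \<le> norm (norm (H xs y) + ?B)"
      using ae
    proof eventually_elim
      case (elim y)
      have "norm (U y - H xs y) \<le> (\<Sum>i\<in>UNIV. \<bar>(U y - H xs y) $ i\<bar>)" by (rule norm_le_l1_cart)
      also have "\<dots> \<le> ?B"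
      proof (rule sum_mono)
        fix i :: 'd
        have "(U y - H xs y) $ i = R (axis i 1) y" using U_inner[OF elim, of "axis i 1"] by (simp add: inner_axis')
        then show "\<bar>(U y - H xs y) $ i\<bar> \<le> 2 * (norm (axis i 1 :: real^'d) * \<sigma>) * \<kappa> / (1 - \<rho>)"
          using R_props(2)[of "axis i 1" y] by simp
      qed
      finally have "norm (U y) \<le> norm (H xs y) + ?B" using norm_triangle_ineq2[of "U y" "H xs y"] by linarith
      then show ?case by simp
    qed
  qed
  then have "w \<bullet> Pop P (poisson_U P \<pi> H) xs \<xi> = (\<integral>y. w \<bullet> U y \<partial>P \<xi>)" by (simp add: Pop_def)
  also have "\<dots> = (\<integral>y. w \<bullet> H xs y + R w y \<partial>P \<xi>)"
    using U_measurable R_props(1)[of w]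
    by (intro integral_cong_AE) (use ae in \<open>auto simp: measurable_cong_sets[OF P_D(3) refl] U_inner\<close>)
  also have "\<dots> = r w \<xi> + (\<integral>y. R w y \<partial>P \<xi>)"
  proof -
    have "integrable (P \<xi>) (R w)" using R_props(2)[of w] by (intro integrable_bounded_borel[OF P_D(2,3) R_props(1)]) auto
    then show ?thesis using int by (simp add: Pop_def)
  qed
  finally show ?thesis using R_eq[of w \<xi>] by simp
qed

section \<open>Truncated scores and the variance bound\<close>

context
  fixes u :: "real^'d"
begin

text \<open>Equals \<open>u \<bullet> U\<close> wherever \<open>U_inner\<close> applies, and unlike
  the series it satisfies \<open>Y_le\<close> at every point.\<close>

definition Y :: "'x \<Rightarrow> real" where "Y y = u \<bullet> H xs y + R u y"

lemma Y_measurable: "Y \<in> borel_measurable borel"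
  unfolding Y_def[abs_def] using R_props(1)[of u] by simp

definition BR :: real where "BR = 2 * (norm u * \<sigma>) * \<kappa> / (1 - \<rho>)"

lemma R_le: "\<bar>R u y\<bar> \<le> BR" unfolding BR_def by (rule R_props)

lemma BR_nonneg: "0 \<le> BR" using R_le[of undefined] by simp

lemma Y_le: "\<bar>Y y\<bar> \<le> norm u * norm (H xs y) + BR"
  unfolding Y_def by (rule order_trans[OF abs_triangle_ineq add_mono[OF Cauchy_Schwarz_ineq2 R_le]])

lemma Y_sq_integrable: "integrable \<pi> (\<lambda>y. (Y y)\<^sup>2)"
proof (rule Bochner_Integration.integrable_bound)
  have "integrable \<pi> (\<lambda>y. norm (H xs y) powr p)"
    unfolding integrable_iff_bounded using moment by (simp add: measurable_cong_sets[OF pi_sets refl])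
  then show "integrable \<pi> (\<lambda>y. 2 * (norm u)\<^sup>2 * (1 + norm (H xs y) powr p) + 2 * BR\<^sup>2)"
    using prob_space.finite_measure[OF pi_prob]
    by (intro Bochner_Integration.integrable_add integrable_mult_right) (auto intro: finite_measure.integrable_const)
  show "(\<lambda>y. (Y y)\<^sup>2) \<in> borel_measurable \<pi>" using Y_measurable by (simp add: measurable_cong_sets[OF pi_sets refl])
  show "AE y in \<pi>. norm ((Y y)\<^sup>2) \<le> norm (2 * (norm u)\<^sup>2 * (1 + norm (H xs y) powr p) + 2 * BR\<^sup>2)"
  proof (rule AE_I2)
    fix y
    let ?f = "norm (H xs y)"
    have f2: "?f\<^sup>2 \<le> 1 + ?f powr p"
    proof (cases "?f \<le> 1")
      case True
      then have "?f\<^sup>2 \<le> 1" by (simp add: power_le_one)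
      then show ?thesis by (simp add: add_increasing2)
    next
      case False
      then have "?f powr 2 \<le> ?f powr p" using p by (intro powr_mono) auto
      then show ?thesis using False by (simp add: powr_numeral)
    qed
    have "(Y y)\<^sup>2 \<le> (norm u * ?f + BR)\<^sup>2" using power_mono[OF Y_le[of y], of 2] by simp
    also have "\<dots> \<le> 2 * (norm u * ?f)\<^sup>2 + 2 * BR\<^sup>2"
      using sum_squares_bound[of "norm u * ?f" BR] by (simp add: power2_sum)
    also have "\<dots> = 2 * (norm u)\<^sup>2 * ?f\<^sup>2 + 2 * BR\<^sup>2" by (simp add: power_mult_distrib)
    also have "\<dots> \<le> 2 * (norm u)\<^sup>2 * (1 + ?f powr p) + 2 * BR\<^sup>2"
      by (intro add_right_mono mult_left_mono f2) auto
    finally show "norm ((Y y)\<^sup>2) \<le> norm (2 * (norm u)\<^sup>2 * (1 + ?f powr p) + 2 * BR\<^sup>2)" by simp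
  qed
qed

lemma PY:
  assumes "integrable (P \<xi>) (H xs)"
  shows "integrable (P \<xi>) Y" "(\<integral>y. Y y \<partial>P \<xi>) = R u \<xi>"
proof -
  have iR: "integrable (P \<xi>) (R u)" using R_props(2)[of u] by (intro integrable_bounded_borel[OF P_D(2,3) R_props(1)]) auto
  show "integrable (P \<xi>) Y" unfolding Y_def[abs_def] using assms iR by simp
  show "(\<integral>y. Y y \<partial>P \<xi>) = R u \<xi>" unfolding Y_def using assms iR R_eq[of u \<xi>] by (simp add: Pop_def)
qed

context
  fixes N :: nat
begin

text \<open>The cut is by the size of \<open>H\<close> and not of \<open>Y\<close>: this also bounds
  \<open>YN\<close> times \<open>H\<close> in every direction, including those that \<open>Y\<close>
  does not see, as the bound \<open>W\<close> demands.\<close>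

definition YN :: "'x \<Rightarrow> real" where "YN y = (if norm (H xs y) \<le> N then Y y else 0)"
definition gN :: "'x \<Rightarrow> real" where "gN \<xi> = (\<integral>y. YN y \<partial>P \<xi>)"
definition hN :: "'x \<Rightarrow> 'x \<Rightarrow> real" where "hN \<xi> y = YN y - gN \<xi>"
definition CN :: real where "CN = norm u * N + BR"

lemma YN_measurable: "YN \<in> borel_measurable borel"
  unfolding YN_def[abs_def] using Y_measurable by measurable

lemma CN_nonneg: "0 \<le> CN" unfolding CN_def using BR_nonneg by simp

lemma YN_le: "\<bar>YN y\<bar> \<le> CN"
proof (cases "norm (H xs y) \<le> N")
  case True
  then have "norm u * norm (H xs y) + BR \<le> CN" unfolding CN_def by (intro add_right_mono mult_left_mono) auto
  then show ?thesis using True Y_le[of y] by (simp add: YN_def)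
qed (use CN_nonneg in \<open>simp add: YN_def\<close>)

lemma YN_sq_le: "\<bar>(YN y)\<^sup>2\<bar> \<le> CN\<^sup>2"
  unfolding power_abs by (intro power_mono YN_le) auto

lemma YN_integrable: "integrable (P \<xi>) YN" "integrable (P \<xi>) (\<lambda>y. (YN y)\<^sup>2)" "integrable \<pi> (\<lambda>y. (YN y)\<^sup>2)"
  using YN_le YN_sq_le integrable_bounded_borel[OF P_D(2,3) YN_measurable, of CN]
    integrable_bounded_borel[OF P_D(2,3) borel_measurable_power[OF YN_measurable, of 2], of "CN\<^sup>2"]
    integrable_pi_bounded[OF borel_measurable_power[OF YN_measurable, of 2], of "CN\<^sup>2"] by auto

lemma gN_measurable: "gN \<in> borel_measurable borel"
  unfolding gN_def[abs_def] by (intro markov_integral_measurable kernel YN_measurable)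

lemma gN_le: "\<bar>gN \<xi>\<bar> \<le> CN"
  unfolding gN_def using norm_integral_le_prob[OF P_D(2), where q=YN and B=CN] YN_le by simp

lemma gN_sq_le: "(gN \<xi>)\<^sup>2 \<le> (\<integral>y. (YN y)\<^sup>2 \<partial>P \<xi>)"
proof -
  interpret px: prob_space "P \<xi>" by (rule P_D)
  show ?thesis using integral_Cauchy_Schwarz[OF YN_integrable(2), of \<xi> "\<lambda>_. 1"] YN_integrable(1)
    by (simp add: gN_def px.prob_space)
qed

text \<open>The summand 1 keeps the bound strictly positive, as \<open>information_bound\<close>
  requires of \<open>C\<close>.\<close>

lemma hN_le: "\<bar>hN \<xi> y\<bar> \<le> 2 * CN + 1"
  using YN_le[of y] gN_le[of \<xi>] unfolding hN_def by linarith

lemma hN_class: "hN \<in> perturbation_class P"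
proof -
  interpret px: prob_space "P \<xi>" for \<xi> by (rule P_D)
  note YN_measurable[measurable] gN_measurable[measurable]
  have "(\<lambda>z. YN (snd z) - gN (fst z)) \<in> borel_measurable (borel \<Otimes>\<^sub>M borel)" by measurable
  then have "case_prod hN \<in> borel_measurable borel"
    by (simp add: hN_def case_prod_beta' borel_prod)
  moreover have "(\<integral>y. hN \<xi> y \<partial>P \<xi>) = 0" for \<xi>
    unfolding hN_def using YN_integrable(1) by (simp add: gN_def px.prob_space)
  ultimately show ?thesis unfolding perturbation_class_def using hN_le by auto
qed

lemma hN_H_le:
  assumes int: "integrable (P \<xi>) (H xs)"
  shows "\<bar>\<integral>y. hN \<xi> y * (w \<bullet> H xs y) \<partial>P \<xi>\<bar> \<le> CN * (norm w * N) + CN * (norm w * \<sigma>)"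
proof -
  have b: "\<bar>YN y * (w \<bullet> H xs y)\<bar> \<le> CN * (norm w * N)" for y
  proof (cases "norm (H xs y) \<le> N")
    case True
    then have "norm w * norm (H xs y) \<le> norm w * N" by (intro mult_left_mono) auto
    with Cauchy_Schwarz_ineq2[of w "H xs y"] have "\<bar>w \<bullet> H xs y\<bar> \<le> norm w * N" by linarith
    then show ?thesis unfolding abs_mult by (intro mult_mono YN_le CN_nonneg) auto
  qed (simp add: YN_def CN_nonneg)
  have i1: "integrable (P \<xi>) (\<lambda>y. YN y * (w \<bullet> H xs y))"
    by (rule integrable_bounded_borel[OF P_D(2,3)]) (use b YN_measurable in auto)
  have "(\<integral>y. hN \<xi> y * (w \<bullet> H xs y) \<partial>P \<xi>) = (\<integral>y. YN y * (w \<bullet> H xs y) \<partial>P \<xi>) - gN \<xi> * r w \<xi>"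
    unfolding hN_def left_diff_distrib using i1 int by (simp add: Pop_def)
  moreover have "\<bar>\<integral>y. YN y * (w \<bullet> H xs y) \<partial>P \<xi>\<bar> \<le> CN * (norm w * N)"
    using norm_integral_le_prob[OF P_D(2), where q="\<lambda>y. YN y * (w \<bullet> H xs y)"] b by simp
  moreover have "\<bar>gN \<xi> * r w \<xi>\<bar> \<le> CN * (norm w * \<sigma>)"
    unfolding abs_mult by (intro mult_mono gN_le r_props CN_nonneg) auto
  ultimately show ?thesis by linarith
qed

lemma kernel_YN_sq:
  "(\<lambda>\<xi>. \<integral>y. (YN y)\<^sup>2 \<partial>P \<xi>) \<in> borel_measurable borel"
  "integrable \<pi> (\<lambda>\<xi>. \<integral>y. (YN y)\<^sup>2 \<partial>P \<xi>)"
  "(\<integral>\<xi>. \<integral>y. (YN y)\<^sup>2 \<partial>P \<xi> \<partial>\<pi>) = (\<integral>y. (YN y)\<^sup>2 \<partial>\<pi>)"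
  using integrable_kernel[OF YN_integrable(3)] integral_kernel[OF YN_integrable(3)]
  by (auto intro!: markov_integral_measurable kernel borel_measurable_power YN_measurable)

lemma hN_sq_integral:
  "(\<integral>\<xi>. \<integral>y. (hN \<xi> y)\<^sup>2 \<partial>P \<xi> \<partial>\<pi>) = (\<integral>y. (YN y)\<^sup>2 \<partial>\<pi>) - (\<integral>\<xi>. (gN \<xi>)\<^sup>2 \<partial>\<pi>)"
proof -
  have "(\<integral>y. (hN \<xi> y)\<^sup>2 \<partial>P \<xi>) = (\<integral>y. (YN y)\<^sup>2 \<partial>P \<xi>) - (gN \<xi>)\<^sup>2" for \<xi>
  proof -
    interpret px: prob_space "P \<xi>" by (rule P_D)
    have "(hN \<xi> y)\<^sup>2 = (YN y)\<^sup>2 - 2 * gN \<xi> * YN y + (gN \<xi>)\<^sup>2" for y by (simp add: hN_def power2_eq_square algebra_simps)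
    then have "(\<integral>y. (hN \<xi> y)\<^sup>2 \<partial>P \<xi>) = (\<integral>y. (YN y)\<^sup>2 \<partial>P \<xi>) - 2 * gN \<xi> * (\<integral>y. YN y \<partial>P \<xi>) + (gN \<xi>)\<^sup>2"
      using YN_integrable by (simp add: px.prob_space)
    then show ?thesis by (simp add: gN_def[symmetric] power2_eq_square)
  qed
  moreover have "integrable \<pi> (\<lambda>\<xi>. (gN \<xi>)\<^sup>2)"
  proof (rule integrable_pi_bounded[OF borel_measurable_power[OF gN_measurable]])
    show "norm ((gN \<xi>)\<^sup>2) \<le> CN\<^sup>2" for \<xi> using power_mono[OF gN_le[of \<xi>], of 2] by simp
  qed
  ultimately show ?thesis using kernel_YN_sq by simp
qed

text \<open>The centring term pairs with \<open>P Y\<close>, which is \<open>R u\<close>,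
  untruncated. So the pairing differs from the squared norm in \<open>hN_sq_integral\<close> by
  having \<open>gN * R u\<close> in place of \<open>gN\<close> squared; the difference vanishes in
  the limit.\<close>

lemma score_pairing_hN:
  "score_pairing hN u = (\<integral>y. (YN y)\<^sup>2 \<partial>\<pi>) - (\<integral>\<xi>. gN \<xi> * R u \<xi> \<partial>\<pi>)"
proof -
  have gR: "(\<lambda>\<xi>. gN \<xi> * R u \<xi>) \<in> borel_measurable borel" by (intro borel_measurable_times gN_measurable R_props)
  have igR: "integrable \<pi> (\<lambda>\<xi>. gN \<xi> * R u \<xi>)"
  proof (rule integrable_pi_bounded[OF gR])
    show "norm (gN \<xi> * R u \<xi>) \<le> CN * BR" for \<xi>
      unfolding real_norm_def abs_mult by (intro mult_mono gN_le R_le CN_nonneg) auto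
  qed
  have hm: "(\<lambda>(x, y). hN x y) \<in> borel_measurable (borel \<Otimes>\<^sub>M borel)"
    using hN_class by (simp add: perturbation_class_def borel_prod)
  note [measurable] = hm Y_measurable
  have "score_pairing hN u = (\<integral>\<xi>. (\<integral>y. (YN y)\<^sup>2 \<partial>P \<xi>) - gN \<xi> * R u \<xi> \<partial>\<pi>)"
    unfolding score_pairing_def Y_def[symmetric]
  proof (rule integral_cong_AE)
    have "(\<lambda>\<xi>. \<integral>y. hN \<xi> y * Y y \<partial>P \<xi>) \<in> borel_measurable borel"
      by (intro integral_measurable_kernel[OF P_D(1)]) measurable
    then show "(\<lambda>\<xi>. \<integral>y. hN \<xi> y * Y y \<partial>P \<xi>) \<in> borel_measurable \<pi>" by (simp add: measurable_cong_sets[OF pi_sets refl])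
    show "(\<lambda>\<xi>. (\<integral>y. (YN y)\<^sup>2 \<partial>P \<xi>) - gN \<xi> * R u \<xi>) \<in> borel_measurable \<pi>"
      using kernel_YN_sq(1) gR by (simp add: measurable_cong_sets[OF pi_sets refl])
    show "AE \<xi> in \<pi>. (\<integral>y. hN \<xi> y * Y y \<partial>P \<xi>) = (\<integral>y. (YN y)\<^sup>2 \<partial>P \<xi>) - gN \<xi> * R u \<xi>"
      using H_xs_integrable_AE
    proof eventually_elim
      case (elim \<xi>)
      \<comment> \<open>\<open>YN\<close> is either \<open>Y\<close> or 0, so its product with
        \<open>Y\<close> is its own square.\<close>
      have "hN \<xi> y * Y y = (YN y)\<^sup>2 - gN \<xi> * Y y" for y by (simp add: hN_def YN_def power2_eq_square left_diff_distrib)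
      then show ?case using YN_integrable(2) PY[OF elim] by simp
    qed
  qed
  also have "\<dots> = (\<integral>y. (YN y)\<^sup>2 \<partial>\<pi>) - (\<integral>\<xi>. gN \<xi> * R u \<xi> \<partial>\<pi>)" using kernel_YN_sq igR by simp
  finally show ?thesis .
qed

end

lemma YN_tendsto: "(\<lambda>N. YN N y) \<longlonglongrightarrow> Y y"
proof (rule tendsto_eventually)
  obtain N0 where "norm (H xs y) \<le> real N0" using real_arch_simple by blast
  then show "\<forall>\<^sub>F N in sequentially. YN N y = Y y"
    by (intro eventually_sequentiallyI[of N0]) (simp add: YN_def)
qed

lemma YN_abs_le_Y: "\<bar>YN N y\<bar> \<le> \<bar>Y y\<bar>"
  by (simp add: YN_def)

lemma YN_sq_le_Y: "(YN N y)\<^sup>2 \<le> (Y y)\<^sup>2"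
  by (simp add: YN_def)

lemma YN_sq_limit: "(\<lambda>N. \<integral>y. (YN N y)\<^sup>2 \<partial>\<pi>) \<longlonglongrightarrow> (\<integral>y. (Y y)\<^sup>2 \<partial>\<pi>)"
proof (rule integral_dominated_convergence[OF _ _ Y_sq_integrable])
  show "AE y in \<pi>. (\<lambda>N. (YN N y)\<^sup>2) \<longlonglongrightarrow> (Y y)\<^sup>2" by (intro AE_I2 tendsto_power YN_tendsto)
  show "AE y in \<pi>. norm ((YN N y)\<^sup>2) \<le> (Y y)\<^sup>2" for N using YN_sq_le_Y by simp
qed (use YN_measurable Y_measurable in \<open>auto simp: measurable_cong_sets[OF pi_sets refl]\<close>)

lemma gN_tendsto:
  assumes "integrable (P \<xi>) (H xs)"
  shows "(\<lambda>N. gN N \<xi>) \<longlonglongrightarrow> R u \<xi>"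
  unfolding gN_def PY(2)[OF assms, symmetric]
proof (rule integral_dominated_convergence)
  show "integrable (P \<xi>) (\<lambda>y. \<bar>Y y\<bar>)" using PY(1)[OF assms] by simp
  show "AE y in P \<xi>. (\<lambda>N. YN N y) \<longlonglongrightarrow> Y y" by (intro AE_I2 YN_tendsto)
  show "AE y in P \<xi>. norm (YN N y) \<le> \<bar>Y y\<bar>" for N using YN_abs_le_Y by simp
qed (use YN_measurable Y_measurable in \<open>auto simp: measurable_cong_sets[OF P_D(3) refl]\<close>)

text \<open>The right side is \<pi>-integrable by stationarity and provides the domination in the
  two limits that follow.\<close>

lemma gN_sq_le_Y: "AE \<xi> in \<pi>. \<forall>N. (gN N \<xi>)\<^sup>2 \<le> (\<integral>y. (Y y)\<^sup>2 \<partial>P \<xi>)"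
  using AE_integrable_kernel[OF Y_sq_integrable]
proof eventually_elim
  case (elim \<xi>)
  show ?case
  proof
    fix N
    have "(gN N \<xi>)\<^sup>2 \<le> (\<integral>y. (YN N y)\<^sup>2 \<partial>P \<xi>)" by (rule gN_sq_le)
    also have "\<dots> \<le> (\<integral>y. (Y y)\<^sup>2 \<partial>P \<xi>)" by (intro integral_mono YN_integrable elim YN_sq_le_Y)
    finally show "(gN N \<xi>)\<^sup>2 \<le> (\<integral>y. (Y y)\<^sup>2 \<partial>P \<xi>)" .
  qed
qed

lemma gN_sq_limit: "(\<lambda>N. \<integral>\<xi>. (gN N \<xi>)\<^sup>2 \<partial>\<pi>) \<longlonglongrightarrow> (\<integral>\<xi>. (R u \<xi>)\<^sup>2 \<partial>\<pi>)"
proof (rule integral_dominated_convergence[OF _ _ integrable_kernel[OF Y_sq_integrable]])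
  show "AE \<xi> in \<pi>. (\<lambda>N. (gN N \<xi>)\<^sup>2) \<longlonglongrightarrow> (R u \<xi>)\<^sup>2"
    using H_xs_integrable_AE by eventually_elim (intro tendsto_power gN_tendsto)
  show "AE \<xi> in \<pi>. norm ((gN N \<xi>)\<^sup>2) \<le> (\<integral>y. (Y y)\<^sup>2 \<partial>P \<xi>)" for N
    using gN_sq_le_Y by eventually_elim simp
qed (use gN_measurable R_props(1)[of u] in \<open>auto simp: measurable_cong_sets[OF pi_sets refl]\<close>)

lemma gN_R_limit: "(\<lambda>N. \<integral>\<xi>. gN N \<xi> * R u \<xi> \<partial>\<pi>) \<longlonglongrightarrow> (\<integral>\<xi>. (R u \<xi>)\<^sup>2 \<partial>\<pi>)"
proof (rule integral_dominated_convergence)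
  show "integrable \<pi> (\<lambda>\<xi>. (\<integral>y. (Y y)\<^sup>2 \<partial>P \<xi>) + BR\<^sup>2)"
    using integrable_kernel[OF Y_sq_integrable] prob_space.finite_measure[OF pi_prob]
    by (intro Bochner_Integration.integrable_add) (auto intro: finite_measure.integrable_const)
  show "AE \<xi> in \<pi>. (\<lambda>N. gN N \<xi> * R u \<xi>) \<longlonglongrightarrow> (R u \<xi>)\<^sup>2"
    unfolding power2_eq_square using H_xs_integrable_AE by eventually_elim (intro tendsto_mult_right gN_tendsto)
  show "AE \<xi> in \<pi>. norm (gN N \<xi> * R u \<xi>) \<le> (\<integral>y. (Y y)\<^sup>2 \<partial>P \<xi>) + BR\<^sup>2" for N
    using gN_sq_le_Y
  proof eventually_elim
    case (elim \<xi>)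
    have "0 \<le> (\<bar>gN N \<xi>\<bar> - \<bar>R u \<xi>\<bar>)\<^sup>2" by simp
    then have "2 * (\<bar>gN N \<xi>\<bar> * \<bar>R u \<xi>\<bar>) \<le> (gN N \<xi>)\<^sup>2 + (R u \<xi>)\<^sup>2" by (simp add: power2_diff)
    moreover have "0 \<le> \<bar>gN N \<xi>\<bar> * \<bar>R u \<xi>\<bar>" by simp
    moreover have "(R u \<xi>)\<^sup>2 \<le> BR\<^sup>2" using power_mono[OF R_le[of \<xi>], of 2] by simp
    moreover have "(gN N \<xi>)\<^sup>2 \<le> (\<integral>y. (Y y)\<^sup>2 \<partial>P \<xi>)" using elim by blast
    ultimately show ?case unfolding norm_mult real_norm_def by linarith
  qed
qed (use gN_measurable R_props(1)[of u] in \<open>auto simp: measurable_cong_sets[OF pi_sets refl]\<close>)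

text \<open>Pairing and squared norm of \<open>hN\<close> have the same limit D, so the truncated
  perturbations approach the equality case of Cauchy-Schwarz and the bound becomes D^2 \<le> V * D.
  For D = 0 the claim is V \<ge> 0.\<close>

theorem variance_lower_bound:
  fixes v :: "real^'d" and V :: real
  assumes \<mu>: "prob_space \<mu>" "sets \<mu> = sets borel"
    and T: "estimator T" "regular \<mu> P H T L"
    and uv: "\<And>w. u \<bullet> (G *v w) = v \<bullet> w"
    and X_int: "\<forall>\<^sub>F n in sequentially. integrable (chain_law \<mu> P n) (\<lambda>\<omega>. (v \<bullet> (sqrt n *\<^sub>R (T n \<omega> - xs)))\<^sup>2)"
    and X_lim: "(\<lambda>n. \<integral>\<omega>. (v \<bullet> (sqrt n *\<^sub>R (T n \<omega> - xs)))\<^sup>2 \<partial>chain_law \<mu> P n) \<longlonglongrightarrow> V"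
  shows "(\<integral>y. (Y y)\<^sup>2 \<partial>\<pi>) - (\<integral>\<xi>. (R u \<xi>)\<^sup>2 \<partial>\<pi>) \<le> V"
proof -
  let ?D = "(\<integral>y. (Y y)\<^sup>2 \<partial>\<pi>) - (\<integral>\<xi>. (R u \<xi>)\<^sup>2 \<partial>\<pi>)"
  have b: "(score_pairing (hN N) u)\<^sup>2 \<le> V * (\<integral>\<xi>. \<integral>y. (hN N \<xi> y)\<^sup>2 \<partial>P \<xi> \<partial>\<pi>)" for N
    by (rule information_bound[OF \<mu> T uv hN_class hN_le _ hN_H_le X_int X_lim])
      (use CN_nonneg[of N] in simp)
  have l1: "(\<lambda>N. score_pairing (hN N) u) \<longlonglongrightarrow> ?D"
    unfolding score_pairing_hN by (intro tendsto_diff YN_sq_limit gN_R_limit)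
  have l2: "(\<lambda>N. \<integral>\<xi>. \<integral>y. (hN N \<xi> y)\<^sup>2 \<partial>P \<xi> \<partial>\<pi>) \<longlonglongrightarrow> ?D"
    unfolding hN_sq_integral by (intro tendsto_diff YN_sq_limit gN_sq_limit)
  have D2: "?D\<^sup>2 \<le> V * ?D"
    by (rule LIMSEQ_le[OF tendsto_power[OF l1, of 2] tendsto_mult_left[OF l2, of V]]) (use b in auto)
  have D0: "0 \<le> ?D"
    by (rule LIMSEQ_le_const[OF l2]) (auto intro!: Bochner_Integration.integral_nonneg)
  have V0: "0 \<le> V"
    by (rule LIMSEQ_le_const[OF X_lim]) (auto intro!: Bochner_Integration.integral_nonneg)
  show ?thesis
  proof (cases "?D = 0")
    case False
    then show ?thesis using D0 D2 by (simp add: power2_eq_square)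
  qed (use V0 in simp)
qed

end

end

section \<open>The lower bound\<close>

lemma inner_outer: "v \<bullet> (outer x y *v w) = (v \<bullet> x) * (y \<bullet> w)" for v x y w :: "real^'d"
proof -
  have "outer x y *v w = (y \<bullet> w) *\<^sub>R x"
    by (simp add: vec_eq_iff outer_def matrix_vector_mult_def inner_vec_def sum_distrib_left sum_distrib_right mult_ac)
  then show ?thesis by simp
qed

lemma bounded_linear_quadratic_form: "bounded_linear (\<lambda>A :: real^'d^'d. v \<bullet> (A *v v))"
proof -
  have "linear (\<lambda>A :: real^'d^'d. v \<bullet> (A *v v))"
    by (rule linearI) (simp_all add: matrix_vector_mult_add_rdistrib inner_add_right scaleR_matrix_vector_assoc[symmetric])
  then show ?thesis by (simp add: linear_conv_bounded_linear)
qed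

lemma (in stoch_approx) S_quadratic_le:
  assumes D: "(\<integral>y. (Y u y)\<^sup>2 \<partial>\<pi>) - (\<integral>\<xi>. (R u \<xi>)\<^sup>2 \<partial>\<pi>) \<le> V" and V: "0 \<le> V"
  shows "u \<bullet> (S_matrix P \<pi> H xs *v u) \<le> V"
proof -
  let ?PU = "Pop P (poisson_U P \<pi> H) xs"
  let ?I = "\<lambda>\<xi>. outer (U \<xi>) (U \<xi>) - outer (?PU \<xi>) (?PU \<xi>)"
  show ?thesis
  proof (cases "integrable \<pi> ?I")
    case False
    \<comment> \<open>The Bochner integral of a non-integrable function is \<open>0\<close>.\<close>
    then have "S_matrix P \<pi> H xs = 0" by (simp add: S_matrix_def not_integrable_integral_eq)
    then show ?thesis using V by simp
  next
    case True
    have "integrable \<pi> (\<lambda>\<xi>. (R u \<xi>)\<^sup>2)"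
    proof (rule integrable_pi_bounded[OF borel_measurable_power[OF R_props(1)]])
      show "norm ((R u \<xi>)\<^sup>2) \<le> (BR u)\<^sup>2" for \<xi> using power_mono[OF R_le[of u \<xi>], of 2] by simp
    qed
    note iYR = Y_sq_integrable[of u] this
    have "u \<bullet> (S_matrix P \<pi> H xs *v u) = (\<integral>\<xi>. u \<bullet> (?I \<xi> *v u) \<partial>\<pi>)"
      unfolding S_matrix_def using integral_bounded_linear[OF bounded_linear_quadratic_form True, of u] by simp
    also have "\<dots> = (\<integral>\<xi>. (Y u \<xi>)\<^sup>2 - (R u \<xi>)\<^sup>2 \<partial>\<pi>)"
    proof (rule integral_cong_AE)
      show "(\<lambda>\<xi>. u \<bullet> (?I \<xi> *v u)) \<in> borel_measurable \<pi>"
        by (rule borel_measurable_integrable[OF integrable_bounded_linear[OF bounded_linear_quadratic_form True]])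
      show "(\<lambda>\<xi>. (Y u \<xi>)\<^sup>2 - (R u \<xi>)\<^sup>2) \<in> borel_measurable \<pi>"
        by (intro borel_measurable_integrable Bochner_Integration.integrable_diff iYR)
      show "AE \<xi> in \<pi>. u \<bullet> (?I \<xi> *v u) = (Y u \<xi>)\<^sup>2 - (R u \<xi>)\<^sup>2"
        using AE_kpow_integrable AE_kernel[OF AE_kpow_integrable] H_xs_integrable_AE
      proof eventually_elim
        case (elim \<xi>)
        have "u \<bullet> U \<xi> = Y u \<xi>" using U_inner[OF elim(1), of u] by (simp add: Y_def)
        moreover have "u \<bullet> ?PU \<xi> = R u \<xi>" by (rule PU_inner[OF elim(3,2)])
        ultimately show ?case
          by (simp add: matrix_vector_mult_diff_rdistrib inner_diff_right inner_outer inner_commute power2_eq_square)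
      qed
    qed
    also have "\<dots> \<le> V" using D iYR by simp
    finally show ?thesis .
  qed
qed

text \<open>The Lipschitz constant \<open>LH\<close> comes with no sign, and \<open>powr\<close>
  sees only the absolute value of its base; so \<open>LH\<close> can be replaced by
  \<bar>LH\<bar>.\<close>

lemma powr_abs_base: "\<bar>z\<bar> powr p = z powr p" for z p :: real
  by (simp add: powr_def abs_if ln_minus)

lemma tv_dist_ge:
  assumes M: "prob_space M" and N: "prob_space N" and A: "A \<in> sets borel"
  shows "\<bar>measure M A - measure N A\<bar> \<le> tv_dist M N"
  unfolding tv_dist_def
proof (rule cSUP_upper[OF A])
  show "bdd_above ((\<lambda>A. \<bar>measure M A - measure N A\<bar>) ` sets borel)"
  proof (rule bdd_aboveI2)
    show "\<bar>measure M A - measure N A\<bar> \<le> 1" for A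
      using prob_space.prob_le_1[OF M, of A] prob_space.prob_le_1[OF N, of A]
        measure_nonneg[of M A] measure_nonneg[of N A] by linarith
  qed
qed

text \<open>Integrate \<open>f \<le> s + s\<^sup>1\<^sup>-\<^sup>p f\<^sup>p\<close>; Jensen would remove the factor \<open>2\<close>.\<close>

lemma nn_integral_le_of_powr:
  fixes f :: "'a \<Rightarrow> real"
  assumes M: "prob_space M" and f: "f \<in> borel_measurable M"
    and p: "1 < p" and s: "0 \<le> s" and f0: "\<And>x. 0 \<le> f x"
    and le: "(\<integral>\<^sup>+x. ennreal (f x powr p) \<partial>M) \<le> ennreal (s powr p)"
  shows "(\<integral>\<^sup>+x. ennreal (f x) \<partial>M) \<le> ennreal (2 * s)"
proof (rule ennreal_le_epsilon)
  interpret prob_space M by fact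
  fix e :: real assume e: "0 < e"
  \<comment> \<open>\<open>s\<close> may be 0, where the power with exponent 1 - p is of no use.
    Enlarging it by e / 2 keeps it positive and makes the final bound 2 s + e.\<close>
  define s' where "s' = s + e / 2"
  have s': "0 < s'" "s \<le> s'" using s e by (auto simp: s'_def)
  have "(\<integral>\<^sup>+x. ennreal (f x) \<partial>M) \<le> (\<integral>\<^sup>+x. ennreal s' + ennreal (s' powr (1 - p)) * ennreal (f x powr p) \<partial>M)"
  proof (rule nn_integral_mono)
    fix x
    have "f x \<le> s' + s' powr (1 - p) * f x powr p"
    proof (cases "f x \<le> s'")
      case False
      then have "s' powr (p - 1) \<le> f x powr (p - 1)" using s' p by (intro powr_mono2) auto
      then have "f x * (s' powr (1 - p) * s' powr (p - 1)) \<le> f x * (s' powr (1 - p) * f x powr (p - 1))"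
        using f0[of x] by (intro mult_left_mono) auto
      also have "s' powr (1 - p) * s' powr (p - 1) = 1" using s' by (simp add: powr_add[symmetric])
      also have "f x * (s' powr (1 - p) * f x powr (p - 1)) = s' powr (1 - p) * (f x powr 1 * f x powr (p - 1))"
        using f0[of x] by simp
      also have "f x powr 1 * f x powr (p - 1) = f x powr p" by (subst powr_add[symmetric]) simp
      finally show ?thesis using s' by simp
    qed (simp add: add_increasing2)
    then have "ennreal (f x) \<le> ennreal (s' + s' powr (1 - p) * f x powr p)" by (rule ennreal_leI)
    also have "\<dots> = ennreal s' + ennreal (s' powr (1 - p)) * ennreal (f x powr p)"
      using s' by (simp add: ennreal_mult)
    finally show "ennreal (f x) \<le> ennreal s' + ennreal (s' powr (1 - p)) * ennreal (f x powr p)" .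
  qed
  also have "\<dots> = ennreal s' + ennreal (s' powr (1 - p)) * (\<integral>\<^sup>+x. ennreal (f x powr p) \<partial>M)"
    using f by (simp add: nn_integral_add nn_integral_cmult emeasure_space_1)
  also have "\<dots> \<le> ennreal s' + ennreal (s' powr (1 - p)) * ennreal (s' powr p)"
    using s s' p by (intro add_left_mono mult_left_mono order_trans[OF le] ennreal_leI powr_mono2) auto
  also have "\<dots> = ennreal (s' + s' powr (1 - p) * s' powr p)" using s' by (simp add: ennreal_mult)
  also have "s' + s' powr (1 - p) * s' powr p = 2 * s + e" using s' by (simp add: powr_add[symmetric] s'_def)
  also have "ennreal (2 * s + e) = ennreal (2 * s) + ennreal e" using s e by simp
  finally show "(\<integral>\<^sup>+x. ennreal (f x) \<partial>M) \<le> ennreal (2 * s) + ennreal e" .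
qed

lemma invertible_of_eigenvalues:
  fixes G :: "real^'d^'d"
  assumes "\<not> complex_eigenvalue G 0"
  shows "invertible G"
proof -
  have "x = 0" if x: "G *v x = 0" for x
  proof (rule ccontr)
    assume "x \<noteq> 0"
    define z :: "complex^'d" where "z = (\<chi> i. complex_of_real (x $ i))"
    have "z \<noteq> 0" using \<open>x \<noteq> 0\<close> by (auto simp: z_def vec_eq_iff)
    moreover have "(\<chi> i j. complex_of_real (G $ i $ j)) *v z = 0 *s z"
    proof (simp add: vec_eq_iff, rule allI)
      fix i
      have "(\<Sum>j\<in>UNIV. G $ i $ j * x $ j) = 0" using x by (auto simp: vec_eq_iff matrix_vector_mult_def)
      then have "complex_of_real (\<Sum>j\<in>UNIV. G $ i $ j * x $ j) = 0" by simp
      then show "((\<chi> i j. complex_of_real (G $ i $ j)) *v z) $ i = 0"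
        by (simp add: matrix_vector_mult_def z_def)
    qed
    ultimately show False using assms unfolding complex_eigenvalue_def by blast
  qed
  then show ?thesis by (simp add: invertible_left_inverse matrix_left_invertible_ker)
qed

theorem theorem3:
  fixes P :: "'x::polish_space \<Rightarrow> 'x measure"
    and \<pi> \<mu> :: "'x measure"
    and nrm :: "real^'d \<Rightarrow> real"
    and H :: "real^'d \<Rightarrow> 'x \<Rightarrow> real^'d"
    and xs :: "real^'d"
    and G :: "real^'d^'d"
    and T :: "nat \<Rightarrow> (nat \<Rightarrow> 'x) \<Rightarrow> real^'d"
    and Sigma :: "real^'d^'d"
  assumes kernel: "markov_kernel P"
    and stat: "stationary P \<pi>"
    and init: "prob_space \<mu>" "sets \<mu> = sets borel"
    and norm: "is_norm nrm"
    and H_meas: "case_prod H \<in> borel_measurable borel"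
    and root: "mean_field \<pi> H xs = 0"
    and A1: "\<exists>LG \<delta>G. LG > 0 \<and> \<delta>G > 0 \<and>
               (\<forall>lam. complex_eigenvalue G lam \<longrightarrow> Re lam > 0) \<and>
               (\<forall>x. nrm (x - xs) \<le> \<delta>G \<longrightarrow>
                  nrm (mean_field \<pi> H x - G *v (x - xs)) \<le> LG * (nrm (x - xs))\<^sup>2)"
    and A2_A3: "\<exists>p::real. p > 2 \<and>
               (\<exists>B::real. \<forall>t. (\<integral>\<^sup>+ \<xi>. ennreal (nrm (H xs \<xi>) powr p) \<partial>marginal \<mu> P t) \<le> ennreal B) \<and>
               (\<exists>\<sigma>>0. \<forall>\<xi>. nrm (Pop P H xs \<xi>) \<le> \<sigma>) \<and>
               (\<exists>LH. \<forall>x y \<xi>. (\<integral>\<^sup>+ \<xi>'. ennreal (nrm (H x \<xi>' - H y \<xi>') powr p) \<partial>P \<xi>)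
                                \<le> ennreal ((LH * nrm (x - y)) powr p))"
    and A4: "(\<forall>\<pi>'. stationary P \<pi>' \<longrightarrow> \<pi>' = \<pi>) \<and>
             (\<exists>\<kappa> \<rho>. \<kappa> \<ge> exp 1 \<and> 0 \<le> \<rho> \<and> \<rho> < 1 \<and>
                 (\<forall>\<xi> t. tv_dist (kpow P t \<xi>) \<pi> \<le> \<kappa> * \<rho> ^ t / 2))"
    and A7: "\<exists>\<gamma> c. 0 \<le> \<gamma> \<and> \<gamma> < 1 \<and> c > 0 \<and>
             (\<forall>x y \<xi>. nrm ((\<integral>\<xi>'. H x \<xi>' - H y \<xi>' \<partial>P \<xi>) - c *\<^sub>R (x - y)) \<le> \<gamma> * c * nrm (x - y))"
    and ral: "RAL \<mu> P \<pi> H xs T"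
    and moments: "\<forall>\<^sub>F n in sequentially.
                    integrable (chain_law \<mu> P n) (\<lambda>\<omega>. outer (T n \<omega> - xs) (T n \<omega> - xs))"
    and lim: "(\<lambda>n. real n *\<^sub>R (\<integral>\<omega>. outer (T n \<omega> - xs) (T n \<omega> - xs) \<partial>chain_law \<mu> P n))
                \<longlonglongrightarrow> Sigma"
  shows "loewner_ge Sigma (matrix_inv G ** S_matrix P \<pi> H xs ** transpose (matrix_inv G))"
proof -
  obtain a where a: "a > 0" "\<And>x. nrm x \<le> a * norm x" using is_norm_le_norm[OF norm] by auto
  obtain b where b: "b > 0" "\<And>x. norm x \<le> b * nrm x" using norm_le_is_norm[OF norm] by auto
  obtain \<kappa> \<rho> where A4': "0 \<le> \<rho>" "\<rho> < 1" "\<And>\<xi> t. tv_dist (kpow P t \<xi>) \<pi> \<le> \<kappa> * \<rho> ^ t / 2"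
    using A4 by blast
  obtain p B \<sigma> LH where p: "p > 2"
    and B: "\<And>t. (\<integral>\<^sup>+ \<xi>. ennreal (nrm (H xs \<xi>) powr p) \<partial>marginal \<mu> P t) \<le> ennreal B"
    and \<sigma>: "\<And>\<xi>. nrm (Pop P H xs \<xi>) \<le> \<sigma>"
    and LH: "\<And>x y \<xi>. (\<integral>\<^sup>+ \<xi>'. ennreal (nrm (H x \<xi>' - H y \<xi>') powr p) \<partial>P \<xi>)
        \<le> ennreal ((LH * nrm (x - y)) powr p)"
    using A2_A3 by blast
  obtain \<gamma> c where c: "0 \<le> \<gamma>" "\<gamma> < 1" "c > 0"
    "\<And>x y \<xi>. nrm ((\<integral>\<xi>'. H x \<xi>' - H y \<xi>' \<partial>P \<xi>) - c *\<^sub>R (x - y)) \<le> \<gamma> * c * nrm (x - y)"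
    using A7 by blast
  obtain LG \<delta> where lin: "LG > 0" "\<delta> > 0"
    and eig: "\<And>lam. complex_eigenvalue G lam \<Longrightarrow> Re lam > 0"
    and G: "\<And>x. nrm (x - xs) \<le> \<delta> \<Longrightarrow> nrm (mean_field \<pi> H x - G *v (x - xs)) \<le> LG * (nrm (x - xs))\<^sup>2"
    using A1 by blast
  \<comment> \<open>The factor 1/2 of the total variation bound is absorbed into the constant of the
    locale.\<close>
  interpret e: ergodic_chain P \<pi> "\<kappa> / 2" \<rho>
  proof
    show "\<bar>measure (kpow P t x) A - measure \<pi> A\<bar> \<le> \<kappa> / 2 * \<rho> ^ t" if "A \<in> sets borel" for x t A
      using tv_dist_ge[OF markov_kernelD(2)[OF markov_kernel_kpow[OF kernel]] _ that, of \<pi> t x] stat A4'(3)[of t x]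
      by (auto simp: stationary_def)
  qed (use kernel stat A4' in auto)
  have Hx[measurable]: "H x \<in> borel_measurable borel" for x
  proof -
    have "(\<lambda>(x, y). H x y) \<in> borel_measurable (borel \<Otimes>\<^sub>M borel)" using H_meas by (simp add: borel_prod)
    from measurable_Pair2[OF this, of x] show ?thesis by simp
  qed
  have nrm_meas[measurable]: "nrm \<in> borel_measurable borel"
    by (rule borel_measurable_continuous_onI[OF is_norm_continuous[OF norm]])
  \<comment> \<open>Norm changes account for the constants: \<open>b\<close> on values,
    \<open>a\<close> on arguments, squared in the quadratic remainder. The factor 2 comes from
    \<open>nn_integral_le_of_powr\<close>, and the radius shrinks to \<open>\<delta> / a\<close> so
    that the ball lies inside the one of \<open>nrm\<close>.\<close>
  interpret s: stoch_approx P \<pi> "\<kappa> / 2" \<rho> H xs nrm p "b * \<sigma>" "b * (2 * \<bar>LH\<bar> * a)" \<gamma> c "b * LG * a\<^sup>2" "\<delta> / a" G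
  proof
    show "(\<integral>\<xi>. H xs \<xi> \<partial>\<pi>) = 0" using root by (simp add: mean_field_def)
    have m: "(\<lambda>\<xi>. nrm (H xs \<xi>) powr p) \<in> borel_measurable borel" by measurable
    show "(\<integral>\<^sup>+\<xi>. ennreal (norm (H xs \<xi>) powr p) \<partial>\<pi>) < \<infinity>"
    proof -
      have "(\<integral>\<^sup>+\<xi>. ennreal (norm (H xs \<xi>) powr p) \<partial>\<pi>) \<le> (\<integral>\<^sup>+\<xi>. ennreal (b powr p) * ennreal (nrm (H xs \<xi>) powr p) \<partial>\<pi>)"
      proof (rule nn_integral_mono)
        fix \<xi>
        have "norm (H xs \<xi>) powr p \<le> (b * nrm (H xs \<xi>)) powr p" using p b by (intro powr_mono2) auto
        also have "\<dots> = b powr p * nrm (H xs \<xi>) powr p" using b is_normD(1)[OF norm] by (simp add: powr_mult)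
        finally show "ennreal (norm (H xs \<xi>) powr p) \<le> ennreal (b powr p) * ennreal (nrm (H xs \<xi>) powr p)"
          by (simp add: ennreal_mult'[symmetric] ennreal_leI)
      qed
      also have "\<dots> = ennreal (b powr p) * (\<integral>\<^sup>+\<xi>. ennreal (nrm (H xs \<xi>) powr p) \<partial>\<pi>)"
        by (rule nn_integral_cmult) (use m in \<open>simp add: measurable_cong_sets[OF e.pi_sets refl]\<close>)
      also have "\<dots> \<le> ennreal (b powr p) * ennreal B"
        by (intro mult_left_mono e.moment_pi_le[OF init m _ B]) auto
      also have "\<dots> < \<infinity>" by (simp add: ennreal_mult_less_top)
      finally show ?thesis .
    qed
    show "norm (Pop P H xs \<xi>) \<le> b * \<sigma>" for \<xi>
      by (rule order_trans[OF b(2)]) (use b \<sigma> in simp)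
    show "(\<integral>\<^sup>+\<xi>'. ennreal (norm (H x \<xi>' - H y \<xi>')) \<partial>P \<xi>) \<le> ennreal (b * (2 * \<bar>LH\<bar> * a) * norm (x - y))" for x y \<xi>
    proof -
      let ?D = "\<lambda>\<xi>'. nrm (H x \<xi>' - H y \<xi>')"
      have D: "?D \<in> borel_measurable (P \<xi>)" by (simp add: measurable_cong_sets[OF e.P_D(3) refl])
      have "(\<integral>\<^sup>+\<xi>'. ennreal (?D \<xi>' powr p) \<partial>P \<xi>) \<le> ennreal (\<bar>LH * nrm (x - y)\<bar> powr p)"
        using LH[where x=x and y=y and \<xi>=\<xi>] by (simp add: powr_abs_base)
      then have "(\<integral>\<^sup>+\<xi>'. ennreal (?D \<xi>') \<partial>P \<xi>) \<le> ennreal (2 * \<bar>LH * nrm (x - y)\<bar>)"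
        using p by (intro nn_integral_le_of_powr[OF e.P_D(2) D _ _ is_normD(1)[OF norm]]) auto
      also have "\<dots> \<le> ennreal (2 * \<bar>LH\<bar> * (a * norm (x - y)))"
        using a is_normD(1)[OF norm, of "x - y"] by (intro ennreal_leI) (simp add: abs_mult mult_left_mono)
      finally have 1: "(\<integral>\<^sup>+\<xi>'. ennreal (?D \<xi>') \<partial>P \<xi>) \<le> ennreal (2 * \<bar>LH\<bar> * (a * norm (x - y)))" .
      have "(\<integral>\<^sup>+\<xi>'. ennreal (norm (H x \<xi>' - H y \<xi>')) \<partial>P \<xi>) \<le> (\<integral>\<^sup>+\<xi>'. ennreal b * ennreal (?D \<xi>') \<partial>P \<xi>)"
        using b is_normD(1)[OF norm] by (intro nn_integral_mono) (simp add: ennreal_mult'[symmetric] ennreal_leI)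
      also have "\<dots> = ennreal b * (\<integral>\<^sup>+\<xi>'. ennreal (?D \<xi>') \<partial>P \<xi>)" by (rule nn_integral_cmult) (use D in simp)
      also have "\<dots> \<le> ennreal b * ennreal (2 * \<bar>LH\<bar> * (a * norm (x - y)))" by (intro mult_left_mono 1) auto
      also have "\<dots> = ennreal (b * (2 * \<bar>LH\<bar> * a) * norm (x - y))"
        using b a by (simp add: ennreal_mult'[symmetric] mult.assoc)
      finally show ?thesis .
    qed
    show "norm ((\<integral>\<xi>. H x \<xi> \<partial>\<pi>) - G *v (x - xs)) \<le> b * LG * a\<^sup>2 * (norm (x - xs))\<^sup>2" if "norm (x - xs) \<le> \<delta> / a" for x
    proof -
      have "a * norm (x - xs) \<le> \<delta>" using that a by (simp add: field_simps)
      then have "nrm (x - xs) \<le> \<delta>" using a(2)[of "x - xs"] by linarith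
      then have "nrm ((\<integral>\<xi>. H x \<xi> \<partial>\<pi>) - G *v (x - xs)) \<le> LG * (nrm (x - xs))\<^sup>2"
        using G by (simp add: mean_field_def)
      also have "\<dots> \<le> LG * (a * norm (x - xs))\<^sup>2"
        using lin a is_normD(1)[OF norm] by (intro mult_left_mono power_mono) auto
      finally have "b * nrm ((\<integral>\<xi>. H x \<xi> \<partial>\<pi>) - G *v (x - xs)) \<le> b * (LG * (a * norm (x - xs))\<^sup>2)"
        using b by simp
      then show ?thesis using b(2)[of "(\<integral>\<xi>. H x \<xi> \<partial>\<pi>) - G *v (x - xs)"] by (simp add: power_mult_distrib mult_ac)
    qed
  qed (use norm H_meas p b a c lin in auto)
  have inv: "matrix_inv G ** G = mat 1"
  proof -
    have "invertible G" by (rule invertible_of_eigenvalues) (use eig in force)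
    then show ?thesis unfolding invertible_def matrix_inv_def by (rule someI2_ex) simp
  qed
  obtain L where T: "estimator T" and L: "regular \<mu> P H T L" using ral by (auto simp: RAL_def)
  have "v \<bullet> ((matrix_inv G ** S_matrix P \<pi> H xs ** transpose (matrix_inv G)) *v v) \<le> v \<bullet> (Sigma *v v)" for v
  proof -
    define u where "u = transpose (matrix_inv G) *v v"
    have u: "u \<bullet> w = v \<bullet> (matrix_inv G *v w)" for w
      unfolding u_def transpose_matrix_vector by (rule dot_lmul_matrix)
    have uv: "u \<bullet> (G *v w) = v \<bullet> w" for w by (simp add: u matrix_vector_mul_assoc inv)
    have sq: "(v \<bullet> (sqrt (real n) *\<^sub>R w))\<^sup>2 = real n * (v \<bullet> (outer w w *v v))" for n and w :: "real^'d"
      unfolding inner_outer inner_scaleR_right power_mult_distrib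
      by (simp add: power2_eq_square inner_commute[of w v])
    have X_int: "\<forall>\<^sub>F n in sequentially. integrable (chain_law \<mu> P n) (\<lambda>\<omega>. (v \<bullet> (sqrt n *\<^sub>R (T n \<omega> - xs)))\<^sup>2)"
      using moments
      by eventually_elim (unfold sq, intro integrable_mult_right integrable_bounded_linear[OF bounded_linear_quadratic_form])
    have "\<forall>\<^sub>F n in sequentially. (\<integral>\<omega>. (v \<bullet> (sqrt n *\<^sub>R (T n \<omega> - xs)))\<^sup>2 \<partial>chain_law \<mu> P n)
        = v \<bullet> ((real n *\<^sub>R (\<integral>\<omega>. outer (T n \<omega> - xs) (T n \<omega> - xs) \<partial>chain_law \<mu> P n)) *v v)"
      using moments
    proof eventually_elim
      case (elim n)
      show ?case unfolding sq
        using integral_bounded_linear[OF bounded_linear_quadratic_form[of v] elim]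
          linear_cmul[OF bounded_linear.linear[OF bounded_linear_quadratic_form[of v]]] by simp
    qed
    moreover have "(\<lambda>n. v \<bullet> ((real n *\<^sub>R (\<integral>\<omega>. outer (T n \<omega> - xs) (T n \<omega> - xs) \<partial>chain_law \<mu> P n)) *v v)) \<longlonglongrightarrow> v \<bullet> (Sigma *v v)"
      by (rule bounded_linear.tendsto[OF bounded_linear_quadratic_form lim])
    ultimately have X_lim: "(\<lambda>n. \<integral>\<omega>. (v \<bullet> (sqrt n *\<^sub>R (T n \<omega> - xs)))\<^sup>2 \<partial>chain_law \<mu> P n) \<longlonglongrightarrow> v \<bullet> (Sigma *v v)"
      by (simp add: tendsto_cong)
    have V0: "0 \<le> v \<bullet> (Sigma *v v)"
      by (rule LIMSEQ_le_const[OF X_lim]) (auto intro!: Bochner_Integration.integral_nonneg)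
    have "u \<bullet> (S_matrix P \<pi> H xs *v u) \<le> v \<bullet> (Sigma *v v)"
      by (rule s.S_quadratic_le[OF s.variance_lower_bound[OF init T L uv X_int X_lim] V0])
    then show ?thesis by (simp only: u matrix_vector_mul_assoc[symmetric] u_def[symmetric])
  qed
  then show ?thesis by (simp add: loewner_ge_def matrix_vector_mult_diff_rdistrib inner_diff_right)
qed

end
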